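(* Let $d\ge1$, $\gamma>0$, $\alpha>0$, $\nu\ge0$, $\mathcal E>0$, and consider the $(\alpha,\nu)$-harmonic system with momentum- and energy-conserving noise described in the context. The current-current time correlation function $$C_{1,1}(t)=\lim_{N\to\infty}\frac1{N^d}\mathbb E_{N,\mathcal E}\big(\mathfrak J_{\mathbf e_1}(t)\,\mathfrak J_{\mathbf e_1}(0)\big),\qquad \mathfrak J_{\mathbf e_1}=\sum_{\mathbf x\in\mathbb Z_N^d}j^a_{\mathbf x,\mathbf x+\mathbf e_1},$$ decays as $t\to\infty$ like - $C_{1,1}(t)\sim t^{-d/2}$ in the unpinned case ($\nu=0$); - $C_{1,1}(t)\sim t^{-d/2-1}$ in the pinned case ($\nu>0$).
   Context: **Asymptotic notation.** $a(t)\sim b(t)$ means that $a$ and $b$ are of the same order as $t\to\infty$: there are constants $0<c\le C<\infty$ with $c\,b(t)\le a(t)\le C\,b(t)$ for all large $t$. **Model.** $\mathbb Z_N^d=(\mathbb Z/N\mathbb Z)^d$ is the discrete torus ($N\ge 3$), $\mathbf e_1,\dots,\mathbf e_d$ is the canonical basis, and $|\mathbf y-\mathbf x|=1$ means nearest neighbours. Each site $\mathbf x$ carries $\mathbf q_{\mathbf x},\mathbf p_{\mathbf x}\in\mathbb R^d$, with coordinates $q^j_{\mathbf x},p^j_{\mathbf x}$. In the $(\alpha,\nu)$-harmonic case $$\mathcal H_N=\sum_{\mathbf x\in\mathbb Z_N^d}\Big[\tfrac12|\mathbf p_{\mathbf x}|^2+\tfrac{\nu}{2}|\mathbf q_{\mathbf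 x}|^2+\tfrac12\sum_{|\mathbf y-\mathbf x|=1}\tfrac{\alpha}{2}|\mathbf q_{\mathbf x}-\mathbf q_{\mathbf y}|^2\Big].$$ The process is the diffusion with generator $L=A+\gamma S$, where $A=\sum_{\mathbf x}\{\mathbf p_{\mathbf x}\cdot\partial_{\mathbf q_{\mathbf x}}-\partial_{\mathbf q_{\mathbf x}}\mathcal H_N\cdot\partial_{\mathbf p_{\mathbf x}}\}$. For $d\ge2$, $S=\frac1{2(d-1)}\sum_{\mathbf x}\sum_{i,j,k=1}^d(X^{i,j}_{\mathbf x,\mathbf x+\mathbf e_k})^2$ with $X^{i,j}_{\mathbf x,\mathbf z}=(p^j_{\mathbf z}-p^j_{\mathbf x})(\partial_{p^i_{\mathbf z}}-\partial_{p^i_{\mathbf x}})-(p^i_{\mathbf z}-p^i_{\mathbf x})(\partial_{p^j_{\mathbf z}}-\partial_{p^j_{\mathbf x}})$. For $d=1$, $S=\frac16\sum_{x\in\mathbb Z_N}(Y_x)^2$ with $Y_x=(p_x-p_{x+1})\partial_{p_{x-1}}+(p_{x+1}-p_{x-1})\partial_{p_x}+(p_{x-1}-p_x)\partial_{p_{x+1}}$. The Hamiltonian energy current is $j^a_{\mathbf x,\mathbf x+\mathbf e_1}=-\frac{\alpha}{2}(\mathbf q_{\mathbf x+\mathbf e_1}-\mathbf q_{\mathbf x})\cdot(\mathbf p_{\mathbf x+\mathbf e_1}+\mathbf p_{\mathbf x})$. **Microcanonical measure.** It is the uniform (Liouville) probability measure, i.e. Lebesgue measure conditioned to the indicated surface,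 on $\{\mathcal H_N=N^d\mathcal E\}$ if $\nu>0$, and on $\{\mathcal H_N=N^d\mathcal E,\ \sum_{\mathbf x}\mathbf p_{\mathbf x}=0,\ \sum_{\mathbf x}\mathbf q_{\mathbf x}=0\}$ if $\nu=0$. It is stationary, and $\mathbb E_{N,\mathcal E}$ is the expectation for the dynamics started from it. *)

theory Defs
  imports "HOL-Probability.Probability"
begin

section \<open>Phase space over the discrete torus\<close>

text \<open>A site of the torus is a function on \<open>{1..d}\<close> with values in \<open>{0..<N}\<close> (and the
  value \<open>undefined\<close> outside \<open>{1..d}\<close>); \<open>shift N k s x\<close> is \<open>x + s e_k\<close>, taken modulo \<open>N\<close>.\<close>

type_synonym site = "nat \<Rightarrow> int"

definition sites :: "nat \<Rightarrow> nat \<Rightarrow> site set" where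
  "sites d N = {1..d} \<rightarrow>\<^sub>E {0..<int N}"

definition shift :: "nat \<Rightarrow> nat \<Rightarrow> int \<Rightarrow> site \<Rightarrow> site" where
  "shift N k s x = x(k := (x k + s) mod int N)"

definition neighbours :: "nat \<Rightarrow> nat \<Rightarrow> site \<Rightarrow> site set" where
  "neighbours d N x = {y \<in> sites d N. \<exists>k\<in>{1..d}. y = shift N k 1 x \<or> y = shift N k (-1) x}"

text \<open>\<open>Pos x j\<close> and \<open>Mom x j\<close> are the names of the scalar coordinates \<open>q_x^j\<close> and \<open>p_x^j\<close>; a
  configuration assigns a real number to each of them.\<close>

datatype coord = Pos site nat | Mom site nat

type_synonym config = "coord \<Rightarrow> real"

definition coords :: "nat \<Rightarrow> nat \<Rightarrow> coord set" where
  "coords d N = (\<lambda>(x, j). Pos x j) ` (sites d N \<times> {1..d}) \<union> (\<lambda>(x, j). Mom x j) ` (sites d N \<times> {1..d})"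

definition phase_space :: "nat \<Rightarrow> nat \<Rightarrow> config set" where
  "phase_space d N = coords d N \<rightarrow>\<^sub>E UNIV"

definition phase_lborel :: "nat \<Rightarrow> nat \<Rightarrow> config measure" where
  "phase_lborel d N = PiM (coords d N) (\<lambda>_. lborel)"

section \<open>Differential operators\<close>

definition pd :: "coord \<Rightarrow> (config \<Rightarrow> real) \<Rightarrow> config \<Rightarrow> real" where
  "pd c f \<eta> = deriv (\<lambda>s. f (\<eta>(c := s))) (\<eta> c)"

definition C1_fun :: "nat \<Rightarrow> nat \<Rightarrow> (config \<Rightarrow> real) \<Rightarrow> bool" where
  "C1_fun d N f \<longleftrightarrow> continuous_on (phase_space d N) f \<and>
    (\<forall>c\<in>coords d N.
      (\<forall>\<eta>\<in>phase_space d N. (\<lambda>s. f (\<eta>(c := s))) differentiable (at (\<eta> c))) \<and>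
      continuous_on (phase_space d N) (pd c f))"

definition C2_fun :: "nat \<Rightarrow> nat \<Rightarrow> (config \<Rightarrow> real) \<Rightarrow> bool" where
  "C2_fun d N f \<longleftrightarrow> C1_fun d N f \<and> (\<forall>c\<in>coords d N. C1_fun d N (pd c f))"

definition compactly_supported :: "nat \<Rightarrow> nat \<Rightarrow> (config \<Rightarrow> real) \<Rightarrow> bool" where
  "compactly_supported d N f \<longleftrightarrow>
    (\<exists>R. \<forall>\<eta>\<in>phase_space d N. f \<eta> \<noteq> 0 \<longrightarrow> (\<forall>c\<in>coords d N. \<bar>\<eta> c\<bar> \<le> R))"

section \<open>Hamiltonian, noise and generator\<close>

definition hamiltonian :: "nat \<Rightarrow> nat \<Rightarrow> real \<Rightarrow> real \<Rightarrow> config \<Rightarrow> real" where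
  "hamiltonian d N \<alpha> \<nu> \<eta> = (\<Sum>x\<in>sites d N.
      1/2 * (\<Sum>j=1..d. (\<eta> (Mom x j))\<^sup>2) + \<nu>/2 * (\<Sum>j=1..d. (\<eta> (Pos x j))\<^sup>2)
      + 1/2 * (\<Sum>y\<in>neighbours d N x. \<alpha>/2 * (\<Sum>j=1..d. (\<eta> (Pos x j) - \<eta> (Pos y j))\<^sup>2)))"

definition liouville_op ::
  "nat \<Rightarrow> nat \<Rightarrow> real \<Rightarrow> real \<Rightarrow> (config \<Rightarrow> real) \<Rightarrow> config \<Rightarrow> real" where
  "liouville_op d N \<alpha> \<nu> f \<eta> = (\<Sum>x\<in>sites d N. \<Sum>j=1..d.
      \<eta> (Mom x j) * pd (Pos x j) f \<eta>
      - pd (Pos x j) (hamiltonian d N \<alpha> \<nu>) \<eta> * pd (Mom x j) f \<eta>)"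

definition X_op :: "nat \<Rightarrow> nat \<Rightarrow> site \<Rightarrow> site \<Rightarrow> (config \<Rightarrow> real) \<Rightarrow> config \<Rightarrow> real" where
  "X_op i j x z f \<eta> =
      (\<eta> (Mom z j) - \<eta> (Mom x j)) * (pd (Mom z i) f \<eta> - pd (Mom x i) f \<eta>)
      - (\<eta> (Mom z i) - \<eta> (Mom x i)) * (pd (Mom z j) f \<eta> - pd (Mom x j) f \<eta>)"

definition Y_op :: "nat \<Rightarrow> site \<Rightarrow> (config \<Rightarrow> real) \<Rightarrow> config \<Rightarrow> real" where
  "Y_op N x f \<eta> = (let l = shift N 1 (-1) x; r = shift N 1 1 x in
      (\<eta> (Mom x 1) - \<eta> (Mom r 1)) * pd (Mom l 1) f \<eta>
      + (\<eta> (Mom r 1) - \<eta> (Mom l 1)) * pd (Mom x 1) f \<eta>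
      + (\<eta> (Mom l 1) - \<eta> (Mom x 1)) * pd (Mom r 1) f \<eta>)"

definition noise_op :: "nat \<Rightarrow> nat \<Rightarrow> (config \<Rightarrow> real) \<Rightarrow> config \<Rightarrow> real" where
  "noise_op d N f \<eta> =
    (if d = 1 then 1/6 * (\<Sum>x\<in>sites d N. Y_op N x (Y_op N x f) \<eta>)
     else 1 / (2 * (real d - 1)) * (\<Sum>x\<in>sites d N. \<Sum>i=1..d. \<Sum>j=1..d. \<Sum>k=1..d.
       X_op i j x (shift N k 1 x) (X_op i j x (shift N k 1 x) f) \<eta>))"

definition generator ::
  "nat \<Rightarrow> nat \<Rightarrow> real \<Rightarrow> real \<Rightarrow> real \<Rightarrow> (config \<Rightarrow> real) \<Rightarrow> config \<Rightarrow> real" where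
  "generator d N \<alpha> \<nu> \<gamma> f \<eta> = liouville_op d N \<alpha> \<nu> f \<eta> + \<gamma> * noise_op d N f \<eta>"

section \<open>Microcanonical measure\<close>

text \<open>Conditioning Lebesgue measure to the (Lebesgue-null) microcanonical surface is understood as the
  weak limit of the normalised Lebesgue measure on thin shells around the surface. The shells
  thicken the values of the conserved quantities, so the limit is the Liouville measure
  (density \<open>1/|grad H|\<close> with respect to the surface area), not the normalised surface area.\<close>

definition micro_shell ::
  "nat \<Rightarrow> nat \<Rightarrow> real \<Rightarrow> real \<Rightarrow> real \<Rightarrow> real \<Rightarrow> config set" where
  "micro_shell d N \<alpha> \<nu> \<E> \<delta> = {\<eta> \<in> phase_space d N.
      \<bar>hamiltonian d N \<alpha> \<nu> \<eta> - real N ^ d * \<E>\<bar> < \<delta> \<and>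
      (\<nu> = 0 \<longrightarrow> (\<forall>j\<in>{1..d}. \<bar>\<Sum>x\<in>sites d N. \<eta> (Mom x j)\<bar> < \<delta> \<and>
                             \<bar>\<Sum>x\<in>sites d N. \<eta> (Pos x j)\<bar> < \<delta>))}"

definition microcanonical ::
  "nat \<Rightarrow> nat \<Rightarrow> real \<Rightarrow> real \<Rightarrow> real \<Rightarrow> config measure \<Rightarrow> bool" where
  "microcanonical d N \<alpha> \<nu> \<E> \<mu> \<longleftrightarrow>
    prob_space \<mu> \<and> sets \<mu> = sets (phase_lborel d N) \<and>
    (\<forall>f :: config \<Rightarrow> real. continuous_on (phase_space d N) f \<and> bounded (f ` phase_space d N) \<longrightarrow>
      ((\<lambda>\<delta>. \<integral>\<eta>. f \<eta> \<partial>uniform_measure (phase_lborel d N) (micro_shell d N \<alpha> \<nu> \<E> \<delta>))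
        \<longlongrightarrow> (\<integral>\<eta>. f \<eta> \<partial>\<mu>)) (at_right 0))"

section \<open>The diffusion\<close>

definition natural_filtration ::
  "'w measure \<Rightarrow> 's measure \<Rightarrow> (real \<Rightarrow> 'w \<Rightarrow> 's) \<Rightarrow> real \<Rightarrow> 'w measure" where
  "natural_filtration M S Z t =
    sigma (space M) {Z u -` B \<inter> space M |u B. u \<in> {0..t} \<and> B \<in> sets S}"

definition martingale ::
  "'w measure \<Rightarrow> (real \<Rightarrow> 'w measure) \<Rightarrow> (real \<Rightarrow> 'w \<Rightarrow> real) \<Rightarrow> bool" where
  "martingale M F X \<longleftrightarrow>
    (\<forall>t\<ge>0. subalgebra M (F t) \<and> X t \<in> borel_measurable (F t) \<and> integrable M (X t)) \<and>
    (\<forall>s t. 0 \<le> s \<and> s \<le> t \<longrightarrow> (AE w in M. real_cond_exp M (F s) (X t) w = X s w))"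

text \<open>A diffusion with the given generator is a continuous process solving the martingale problem for
  the generator on twice continuously differentiable functions of compact support. The generator
  comes from a stochastic differential equation with linear coefficients, so this martingale
  problem is well posed and determines the law of the process from its initial law.\<close>

definition diffusion ::
  "nat \<Rightarrow> nat \<Rightarrow> real \<Rightarrow> real \<Rightarrow> real \<Rightarrow> 'w measure \<Rightarrow> (real \<Rightarrow> 'w \<Rightarrow> config) \<Rightarrow> bool" where
  "diffusion d N \<alpha> \<nu> \<gamma> M Z \<longleftrightarrow>
    prob_space M \<and>
    (\<forall>t\<ge>0. Z t \<in> measurable M (phase_lborel d N)) \<and>
    (\<forall>w\<in>space M. continuous_on {0..} (\<lambda>t. Z t w)) \<and>
    (\<forall>f. C2_fun d N f \<and> compactly_supported d N f \<longrightarrow>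
      martingale M (natural_filtration M (phase_lborel d N) Z)
        (\<lambda>t w. f (Z t w) - (LBINT s:{0..t}. generator d N \<alpha> \<nu> \<gamma> f (Z s w))))"

definition microcanonical_diffusion ::
  "nat \<Rightarrow> nat \<Rightarrow> real \<Rightarrow> real \<Rightarrow> real \<Rightarrow> real \<Rightarrow> 'w measure \<Rightarrow> (real \<Rightarrow> 'w \<Rightarrow> config) \<Rightarrow> bool" where
  "microcanonical_diffusion d N \<alpha> \<nu> \<gamma> \<E> M Z \<longleftrightarrow>
    diffusion d N \<alpha> \<nu> \<gamma> M Z \<and> microcanonical d N \<alpha> \<nu> \<E> (distr M (phase_lborel d N) (Z 0))"

section \<open>Energy current and asymptotic order\<close>

definition current :: "nat \<Rightarrow> nat \<Rightarrow> real \<Rightarrow> site \<Rightarrow> config \<Rightarrow> real" where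
  "current d N \<alpha> x \<eta> = - (\<alpha>/2) * (\<Sum>j=1..d.
      (\<eta> (Pos (shift N 1 1 x) j) - \<eta> (Pos x j)) * (\<eta> (Mom (shift N 1 1 x) j) + \<eta> (Mom x j)))"

definition total_current :: "nat \<Rightarrow> nat \<Rightarrow> real \<Rightarrow> config \<Rightarrow> real" where
  "total_current d N \<alpha> \<eta> = (\<Sum>x\<in>sites d N. current d N \<alpha> x \<eta>)"

text \<open>Unlike \<open>bigtheta\<close>, this compares signed values: the first function is eventually positive
  whenever the second one is.\<close>

definition same_order :: "(real \<Rightarrow> real) \<Rightarrow> (real \<Rightarrow> real) \<Rightarrow> bool" where
  "same_order a b \<longleftrightarrow> (\<exists>c C. 0 < c \<and> c \<le> C \<and>
    (\<forall>\<^sub>F t in at_top. c * b t \<le> a t \<and> a t \<le> C * b t))"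

end

theory Submission
  imports Defs
begin

text \<open>The observables \<open>J\<^sub>k = \<Sum>\<^bsub>x,y\<^esub> sin (2 \<pi> k \<cdot> (y - x) / N) p\<^sub>x \<cdot> q\<^sub>y\<close> are annihilated by the Liouville operator, because a
  translation invariant antisymmetric form stays antisymmetric, and they are eigenfunctions of the
  noise with eigenvalue \<open>- \<psi>(k)\<close>. The total current is \<open>- (\<alpha> / N\<^sup>d) \<Sum>\<^sub>k sin (2 \<pi> k\<^sub>1 / N) J\<^sub>k\<close>, so its correlation
  function is a sum of exponentials \<open>exp (- \<gamma> \<psi>(k) t)\<close> weighted by the static microcanonical correlations of
  \<open>J\<^sub>k\<close> with the current. These follow from the divergence theorem on thin shells, applied to
  polynomial vector fields tangent to the level sets of the conserved quantities. As \<open>N \<rightarrow> \<infinity>\<close> the sum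
  converges to \<open>\<alpha>\<^sup>2 \<E>\<^sup>2 / d\<close> times the integral of \<open>sin\<^sup>2 (2 \<pi> y\<^sub>1) / \<omega>\<^sup>2(y) exp (- \<gamma> \<psi>(y) t)\<close> over the unit cube, which is governed by
  \<open>\<bar>y\<bar>\<close> of order \<open>1 / sqrt t\<close>: there the quotient is of order one without pinning and of order \<open>\<bar>y\<bar>\<^sup>2\<close> with
  pinning.\<close>

section \<open>Partial derivatives of smooth observables\<close>

text \<open>Two obstacles shape the proof. The martingale problem speaks only about compactly
  supported test functions, whereas the current and the modes \<open>JJ k\<close> are unbounded
  quadratic forms. They are therefore multiplied by a cut-off that depends on energy, total momentum
  and total position alone: the noise does not act on it, its support is bounded, and it equals 1 on
  the microcanonical surface. The microcanonical law, in turn, is given only as a weak limit of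
  shell averages, so its moments are derived as identities between integrals over each thin shell,
  with coefficients independent of the thickness, and then passed to the limit. These identities are
  exact at every finite \<open>N\<close>. With \<open>n\<close> degrees of freedom they produce the
  denominator \<open>n (n + 2)\<close>, as for fourth moments on a sphere. Since \<open>n\<close>
  grows like 2 d N^d, the prefactor 4 \<alpha>^2 \<E>^2 d N^(2d) / (n (n + 2)) tends to \<alpha>^2
  \<E>^2 / d.\<close>

definition has_pd :: "coord \<Rightarrow> (config \<Rightarrow> real) \<Rightarrow> (config \<Rightarrow> real) \<Rightarrow> bool" where
  "has_pd c f f' \<longleftrightarrow> (\<forall>\<eta>. ((\<lambda>s. f (\<eta>(c := s))) has_real_derivative f' \<eta>) (at (\<eta> c)))"

text \<open>Smoothness is demanded on all of \<open>config\<close> and in every coordinate, so that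
  coordinate updates never leave the domain and the calculus has no side conditions.
  \<open>C2_funI\<close> restricts it to \<open>phase_space\<close>.\<close>

fun Ck :: "nat \<Rightarrow> (config \<Rightarrow> real) \<Rightarrow> bool" where
  "Ck 0 f \<longleftrightarrow> continuous_on UNIV f"
| "Ck (Suc n) f \<longleftrightarrow> continuous_on UNIV f \<and> (\<forall>c. \<exists>f'. has_pd c f f' \<and> Ck n f')"

lemma has_pd_imp_pd: "has_pd c f f' \<Longrightarrow> pd c f = f'"
  by (rule ext) (auto simp: pd_def has_pd_def intro: DERIV_imp_deriv)

lemma has_pd_at:
  assumes "has_pd c f f'"
  shows "((\<lambda>s. f (\<eta>(c := s))) has_real_derivative f' (\<eta>(c := s))) (at s)"
proof -
  have "((\<lambda>r. f ((\<eta>(c := s))(c := r))) has_real_derivative f' (\<eta>(c := s))) (at ((\<eta>(c := s)) c))"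
    using assms unfolding has_pd_def by blast
  then show ?thesis by simp
qed

lemma Ck_continuous: "Ck n f \<Longrightarrow> continuous_on UNIV f"
  by (cases n) auto

text \<open>Derivatives are unique, so the existential witness may be taken to be
  \<open>pd c f\<close>; this is the working form of the recursion.\<close>

lemma Ck_Suc_iff: "Ck (Suc n) f \<longleftrightarrow> continuous_on UNIV f \<and> (\<forall>c. has_pd c f (pd c f) \<and> Ck n (pd c f))"
proof -
  have *: "(\<exists>f'. has_pd c f f' \<and> Ck n f') \<longleftrightarrow> has_pd c f (pd c f) \<and> Ck n (pd c f)" for c
    by (metis has_pd_imp_pd)
  show ?thesis unfolding Ck.simps(2) * ..
qed

lemma Ck_has_pd: "Ck (Suc n) f \<Longrightarrow> has_pd c f (pd c f)"
  and Ck_pd: "Ck (Suc n) f \<Longrightarrow> Ck n (pd c f)"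
  by (auto simp only: Ck_Suc_iff)

lemma Ck_Suc_D: "Ck (Suc n) f \<Longrightarrow> Ck n f"
proof (induction n arbitrary: f)
  case 0 then show ?case by simp
next
  case (Suc n)
  then show ?case using Ck_Suc_iff[of n f] Ck_Suc_iff[of "Suc n" f] by blast
qed

lemma Ck_mono: "Ck n f \<Longrightarrow> m \<le> n \<Longrightarrow> Ck m f"
  by (induction n arbitrary: m) (use Ck_Suc_D le_Suc_eq in \<open>auto simp del: Ck.simps(2)\<close>)

lemma has_pd_const: "has_pd c (\<lambda>_. a) (\<lambda>_. 0)"
  by (simp add: has_pd_def)

lemma has_pd_coord: "has_pd c (\<lambda>\<eta>. \<eta> c') (\<lambda>_. if c' = c then 1 else 0)"
  by (auto simp: has_pd_def)

lemma has_pd_add: "has_pd c f f' \<Longrightarrow> has_pd c g g' \<Longrightarrow> has_pd c (\<lambda>\<eta>. f \<eta> + g \<eta>) (\<lambda>\<eta>. f' \<eta> + g' \<eta>)"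
  unfolding has_pd_def by (intro allI DERIV_add) auto

lemma has_pd_mult:
  assumes "has_pd c f f'" "has_pd c g g'"
  shows "has_pd c (\<lambda>\<eta>. f \<eta> * g \<eta>) (\<lambda>\<eta>. f' \<eta> * g \<eta> + f \<eta> * g' \<eta>)"
  unfolding has_pd_def
proof
  fix \<eta>
  have "((\<lambda>s. f (\<eta>(c := s)) * g (\<eta>(c := s))) has_real_derivative
      f' \<eta> * g (\<eta>(c := \<eta> c)) + g' \<eta> * f (\<eta>(c := \<eta> c))) (at (\<eta> c))"
    using assms unfolding has_pd_def by (intro DERIV_mult) auto
  then show "((\<lambda>s. f (\<eta>(c := s)) * g (\<eta>(c := s))) has_real_derivative f' \<eta> * g \<eta> + f \<eta> * g' \<eta>) (at (\<eta> c))"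
    by (simp add: mult.commute)
qed

lemma has_pd_chain:
  assumes "has_pd c f f'" "\<And>s. (\<phi> has_real_derivative \<phi>' s) (at s)"
  shows "has_pd c (\<lambda>\<eta>. \<phi> (f \<eta>)) (\<lambda>\<eta>. \<phi>' (f \<eta>) * f' \<eta>)"
  unfolding has_pd_def
proof
  fix \<eta>
  have "((\<lambda>s. \<phi> (f (\<eta>(c := s)))) has_real_derivative \<phi>' (f (\<eta>(c := \<eta> c))) * f' \<eta>) (at (\<eta> c))"
    using assms unfolding has_pd_def by (intro DERIV_chain2) auto
  then show "((\<lambda>s. \<phi> (f (\<eta>(c := s)))) has_real_derivative \<phi>' (f \<eta>) * f' \<eta>) (at (\<eta> c))"
    by simp
qed

lemma Ck_const [simp]: "Ck n (\<lambda>_. a)"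
proof (induction n arbitrary: a)
  case (Suc n) then show ?case by (auto intro!: exI has_pd_const)
qed simp

lemma Ck_coord [simp]: "Ck n (\<lambda>\<eta>. \<eta> c)"
  by (cases n) (auto intro!: exI has_pd_coord)

lemma Ck_add [simp]: "Ck n f \<Longrightarrow> Ck n g \<Longrightarrow> Ck n (\<lambda>\<eta>. f \<eta> + g \<eta>)"
proof (induction n arbitrary: f g)
  case 0 then show ?case by (auto intro: continuous_on_add)
next
  case (Suc n)
  have "has_pd c (\<lambda>\<eta>. f \<eta> + g \<eta>) (\<lambda>\<eta>. pd c f \<eta> + pd c g \<eta>)
      \<and> Ck n (\<lambda>\<eta>. pd c f \<eta> + pd c g \<eta>)" for c
    using Suc by (auto intro!: has_pd_add Ck_has_pd Suc.IH dest: Ck_pd simp del: Ck.simps)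
  then show ?case
    using Suc.prems by (auto intro: continuous_on_add)
qed

lemma Ck_mult [simp]: "Ck n f \<Longrightarrow> Ck n g \<Longrightarrow> Ck n (\<lambda>\<eta>. f \<eta> * g \<eta>)"
proof (induction n arbitrary: f g)
  case 0 then show ?case by (auto intro: continuous_on_mult)
next
  case (Suc n)
  have "has_pd c (\<lambda>\<eta>. f \<eta> * g \<eta>) (\<lambda>\<eta>. pd c f \<eta> * g \<eta> + f \<eta> * pd c g \<eta>)
      \<and> Ck n (\<lambda>\<eta>. pd c f \<eta> * g \<eta> + f \<eta> * pd c g \<eta>)" for c
    using Suc by (auto intro!: has_pd_mult Ck_has_pd Ck_add Suc.IH dest: Ck_Suc_D Ck_pd simp del: Ck.simps)
  then show ?case
    using Suc.prems by (auto intro: continuous_on_mult)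
qed

lemma Ck_sum [simp]: "(\<And>i. i \<in> I \<Longrightarrow> Ck n (f i)) \<Longrightarrow> Ck n (\<lambda>\<eta>. \<Sum>i\<in>I. f i \<eta>)"
  by (induction I rule: infinite_finite_induct) auto

lemma Ck_prod: "(\<And>i. i \<in> I \<Longrightarrow> Ck n (f i)) \<Longrightarrow> Ck n (\<lambda>\<eta>. \<Prod>i\<in>I. f i \<eta>)"
  by (induction I rule: infinite_finite_induct) auto

lemma Ck_minus [simp]: "Ck n f \<Longrightarrow> Ck n (\<lambda>\<eta>. - f \<eta>)"
  using Ck_mult[of n "\<lambda>_. -1" f] by simp

lemma Ck_diff [simp]: "Ck n f \<Longrightarrow> Ck n g \<Longrightarrow> Ck n (\<lambda>\<eta>. f \<eta> - g \<eta>)"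
  using Ck_add[of n f "\<lambda>\<eta>. - g \<eta>"] by simp

lemma Ck_power [simp]: "Ck n f \<Longrightarrow> Ck n (\<lambda>\<eta>. f \<eta> ^ m)"
  by (induction m) auto

text \<open>Only the kink at 0 needs an argument: with exponent at least 2 the difference quotient
  there is dominated by a positive power of the increment.\<close>

lemma DERIV_pospart_power:
  "((\<lambda>y::real. max 0 y ^ Suc (Suc m)) has_real_derivative real (Suc (Suc m)) * max 0 y ^ Suc m) (at y)"
proof -
  consider "y > 0" | "y < 0" | "y = 0" by linarith
  then show ?thesis
  proof cases
    case 1
    have "((\<lambda>y::real. y ^ Suc (Suc m)) has_real_derivative real (Suc (Suc m)) * y ^ Suc m) (at y)"
      using DERIV_pow[of "Suc (Suc m)" y] by simp
    then have "((\<lambda>y::real. max 0 y ^ Suc (Suc m)) has_real_derivative real (Suc (Suc m)) * y ^ Suc m) (at y)"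
      by (rule DERIV_cong_ev[THEN iffD1, rotated 3, OF _ refl _ refl])
        (use 1 in \<open>auto intro: eventually_mono[OF eventually_nhds_in_open[of "{0<..}"]]\<close>)
    then show ?thesis using 1 by simp
  next
    case 2
    have "((\<lambda>y::real. 0) has_real_derivative 0) (at y)" by simp
    then have "((\<lambda>y::real. max 0 y ^ Suc (Suc m)) has_real_derivative 0) (at y)"
      by (rule DERIV_cong_ev[THEN iffD1, rotated 3, OF _ refl _ refl])
        (use 2 in \<open>auto intro!: eventually_mono[OF eventually_nhds_in_open[of "{..<0}"]]\<close>)
    then show ?thesis using 2 by simp
  next
    case 3
    have "((\<lambda>h::real. (max 0 (0 + h) ^ Suc (Suc m) - max 0 0 ^ Suc (Suc m)) / h) \<longlongrightarrow> 0) (at 0)"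
    proof (rule Lim_null_comparison)
      show "\<forall>\<^sub>F h::real in at 0. norm ((max 0 (0 + h) ^ Suc (Suc m) - max 0 0 ^ Suc (Suc m)) / h) \<le> \<bar>h\<bar> ^ Suc m"
        by (intro always_eventually allI) (auto simp: max_def intro!: mult_nonpos_nonneg)
      show "((\<lambda>h::real. \<bar>h\<bar> ^ Suc m) \<longlongrightarrow> 0) (at 0)"
        by (auto intro!: tendsto_eq_intros)
    qed
    then show ?thesis using 3 by (simp add: DERIV_def)
  qed
qed

text \<open>Each derivative costs one power of the positive part, so exponent \<open>Suc n\<close>
  survives \<open>n\<close> derivatives. This is the origin of the cube in \<open>cut\<close>, which
  must be C2, and of the square in \<open>bump\<close>, which must be C1.\<close>

lemma Ck_pospart_power: "Ck n f \<Longrightarrow> Ck n (\<lambda>\<eta>. max 0 (f \<eta>) ^ Suc n)"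
proof (induction n arbitrary: f)
  case 0 then show ?case by (auto intro!: continuous_intros)
next
  case (Suc n)
  have "has_pd c (\<lambda>\<eta>. max 0 (f \<eta>) ^ Suc (Suc n))
         (\<lambda>\<eta>. (real (Suc (Suc n)) * max 0 (f \<eta>) ^ Suc n) * pd c f \<eta>)
      \<and> Ck n (\<lambda>\<eta>. (real (Suc (Suc n)) * max 0 (f \<eta>) ^ Suc n) * pd c f \<eta>)" for c
    using has_pd_chain[OF Ck_has_pd[OF Suc.prems, of c] DERIV_pospart_power]
    by (intro conjI Ck_mult Ck_const Suc.IH Ck_pd Suc.prems Ck_Suc_D)
  then show ?case
    using Ck_continuous[OF Suc.prems] unfolding Ck.simps(2) by (auto intro!: continuous_intros simp del: power_Suc)
qed

lemma C2_funI: "Ck 2 f \<Longrightarrow> C2_fun d N f"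
proof -
  have C1: "C1_fun d N g" if "Ck (Suc 0) g" for g
    unfolding C1_fun_def
  proof (intro conjI ballI)
    show "continuous_on (phase_space d N) g" using that by (auto intro: continuous_on_subset)
    fix c assume "c \<in> coords d N"
    have "Ck 0 (pd c g)" using that by (rule Ck_pd)
    then show "continuous_on (phase_space d N) (pd c g)" by (auto intro: continuous_on_subset)
    fix \<eta>
    show "(\<lambda>s. g (\<eta>(c := s))) differentiable at (\<eta> c)"
      using Ck_has_pd[OF that, of c] unfolding has_pd_def
      using real_differentiable_def by blast
  qed
  assume "Ck 2 f"
  then have "Ck (Suc (Suc 0)) f" by (simp only: numeral_2_eq_2)
  then show ?thesis unfolding C2_fun_def using C1 Ck_Suc_D[of "Suc 0" f] Ck_pd[of "Suc 0" f] by blast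
qed

declare Ck.simps [simp del]

abbreviation "C1 \<equiv> Ck (Suc 0)"

lemma pd_const [simp]: "pd c (\<lambda>_. a) = (\<lambda>_. 0)"
  by (rule has_pd_imp_pd[OF has_pd_const])

lemma pd_coord [simp]: "pd c (\<lambda>\<eta>. \<eta> c') = (\<lambda>_. if c' = c then 1 else 0)"
  by (rule has_pd_imp_pd[OF has_pd_coord])

lemma pd_add: "C1 f \<Longrightarrow> C1 g \<Longrightarrow> pd c (\<lambda>\<eta>. f \<eta> + g \<eta>) = (\<lambda>\<eta>. pd c f \<eta> + pd c g \<eta>)"
  by (intro has_pd_imp_pd has_pd_add Ck_has_pd)

lemma pd_mult: "C1 f \<Longrightarrow> C1 g \<Longrightarrow> pd c (\<lambda>\<eta>. f \<eta> * g \<eta>) = (\<lambda>\<eta>. pd c f \<eta> * g \<eta> + f \<eta> * pd c g \<eta>)"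
  by (intro has_pd_imp_pd has_pd_mult Ck_has_pd)

lemma pd_chain: "C1 f \<Longrightarrow> (\<And>s. (\<phi> has_real_derivative \<phi>' s) (at s)) \<Longrightarrow>
    pd c (\<lambda>\<eta>. \<phi> (f \<eta>)) = (\<lambda>\<eta>. \<phi>' (f \<eta>) * pd c f \<eta>)"
  by (intro has_pd_imp_pd has_pd_chain Ck_has_pd)

lemma pd_minus: "C1 f \<Longrightarrow> pd c (\<lambda>\<eta>. - f \<eta>) = (\<lambda>\<eta>. - pd c f \<eta>)"
  using pd_mult[of "\<lambda>_. -1" f c] by simp

lemma pd_diff: "C1 f \<Longrightarrow> C1 g \<Longrightarrow> pd c (\<lambda>\<eta>. f \<eta> - g \<eta>) = (\<lambda>\<eta>. pd c f \<eta> - pd c g \<eta>)"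
  using pd_add[of f "\<lambda>\<eta>. - g \<eta>" c] by (simp add: pd_minus)

lemma pd_sum: "(\<And>i. i \<in> I \<Longrightarrow> C1 (f i)) \<Longrightarrow> pd c (\<lambda>\<eta>. \<Sum>i\<in>I. f i \<eta>) = (\<lambda>\<eta>. \<Sum>i\<in>I. pd c (f i) \<eta>)"
  by (induction I rule: infinite_finite_induct) (auto simp: pd_add)

section \<open>Derivations\<close>

text \<open>Partial derivatives, the noise fields, the Liouville operator and general vector fields
  share this calculus. The chain rule is listed separately because the Leibniz rule does not reach
  the non-polynomial cut-offs.\<close>

definition derivation :: "((config \<Rightarrow> real) \<Rightarrow> config \<Rightarrow> real) \<Rightarrow> bool" where
  "derivation D \<longleftrightarrow>
    (\<forall>f g. C1 f \<longrightarrow> C1 g \<longrightarrow> D (\<lambda>\<eta>. f \<eta> + g \<eta>) = (\<lambda>\<eta>. D f \<eta> + D g \<eta>)) \<and>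
    (\<forall>f g. C1 f \<longrightarrow> C1 g \<longrightarrow> D (\<lambda>\<eta>. f \<eta> * g \<eta>) = (\<lambda>\<eta>. D f \<eta> * g \<eta> + f \<eta> * D g \<eta>)) \<and>
    (\<forall>f \<phi> \<phi>'. C1 f \<longrightarrow> (\<forall>s. (\<phi> has_real_derivative \<phi>' s) (at s)) \<longrightarrow>
       D (\<lambda>\<eta>. \<phi> (f \<eta>)) = (\<lambda>\<eta>. \<phi>' (f \<eta>) * D f \<eta>))"

lemma derivation_pd: "derivation (pd c)"
  unfolding derivation_def by (auto intro!: pd_add pd_mult pd_chain)

lemma derivation_cmult: "derivation D \<Longrightarrow> derivation (\<lambda>f \<eta>. b \<eta> * D f \<eta>)"
  unfolding derivation_def by (auto simp: algebra_simps)

lemma derivation_add: "derivation D \<Longrightarrow> derivation D' \<Longrightarrow> derivation (\<lambda>f \<eta>. D f \<eta> + D' f \<eta>)"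
  unfolding derivation_def by (auto simp: algebra_simps)

lemma derivation_diff: "derivation D \<Longrightarrow> derivation D' \<Longrightarrow> derivation (\<lambda>f \<eta>. D f \<eta> - D' f \<eta>)"
  unfolding derivation_def by (auto simp: algebra_simps)

lemma derivation_zero: "derivation (\<lambda>_ _. 0)"
  by (auto simp: derivation_def)

lemma derivation_sum: "(\<And>i. i \<in> I \<Longrightarrow> derivation (D i)) \<Longrightarrow> derivation (\<lambda>f \<eta>. \<Sum>i\<in>I. D i f \<eta>)"
  by (induction I rule: infinite_finite_induct) (auto simp: derivation_zero intro: derivation_add)

context
  fixes D assumes D: "derivation D"
begin

lemma deriv_add: "C1 f \<Longrightarrow> C1 g \<Longrightarrow> D (\<lambda>\<eta>. f \<eta> + g \<eta>) = (\<lambda>\<eta>. D f \<eta> + D g \<eta>)"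
  and deriv_mult: "C1 f \<Longrightarrow> C1 g \<Longrightarrow> D (\<lambda>\<eta>. f \<eta> * g \<eta>) = (\<lambda>\<eta>. D f \<eta> * g \<eta> + f \<eta> * D g \<eta>)"
  using D unfolding derivation_def by blast+

lemma deriv_chain: "C1 f \<Longrightarrow> (\<And>s. (\<phi> has_real_derivative \<phi>' s) (at s)) \<Longrightarrow>
       D (\<lambda>\<eta>. \<phi> (f \<eta>)) = (\<lambda>\<eta>. \<phi>' (f \<eta>) * D f \<eta>)"
  using D unfolding derivation_def by blast

lemma deriv_const: "D (\<lambda>_. a) = (\<lambda>_. 0)"
  using deriv_chain[of "\<lambda>_. 0" "\<lambda>_. a" "\<lambda>_. 0"] by simp

lemma deriv_cmult: "C1 f \<Longrightarrow> D (\<lambda>\<eta>. a * f \<eta>) = (\<lambda>\<eta>. a * D f \<eta>)"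
  using deriv_mult[of "\<lambda>_. a" f] by (simp add: deriv_const)

lemma deriv_minus: "C1 f \<Longrightarrow> D (\<lambda>\<eta>. - f \<eta>) = (\<lambda>\<eta>. - D f \<eta>)"
  using deriv_cmult[of f "-1"] by simp

lemma deriv_diff: "C1 f \<Longrightarrow> C1 g \<Longrightarrow> D (\<lambda>\<eta>. f \<eta> - g \<eta>) = (\<lambda>\<eta>. D f \<eta> - D g \<eta>)"
  using deriv_add[of f "\<lambda>\<eta>. - g \<eta>"] by (simp add: deriv_minus)

lemma deriv_sum: "(\<And>i. i \<in> I \<Longrightarrow> C1 (f i)) \<Longrightarrow> D (\<lambda>\<eta>. \<Sum>i\<in>I. f i \<eta>) = (\<lambda>\<eta>. \<Sum>i\<in>I. D (f i) \<eta>)"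
  by (induction I rule: infinite_finite_induct) (auto simp: deriv_add deriv_const)

lemma deriv_square: "C1 f \<Longrightarrow> D (\<lambda>\<eta>. (f \<eta>)\<^sup>2) = (\<lambda>\<eta>. 2 * f \<eta> * D f \<eta>)"
  using deriv_mult[of f f] by (simp add: power2_eq_square algebra_simps)

lemma deriv_prod_zero:
  assumes "\<And>i. i \<in> I \<Longrightarrow> C1 (f i)" "\<And>i. i \<in> I \<Longrightarrow> D (f i) = (\<lambda>_. 0)"
  shows "D (\<lambda>\<eta>. \<Prod>i\<in>I. f i \<eta>) = (\<lambda>_. 0)"
  using assms
  by (induction I rule: infinite_finite_induct) (auto simp: deriv_mult deriv_const Ck_prod)

end

section \<open>Polynomial observables\<close>

text \<open>Only coordinates in \<open>A\<close> may occur, which gives measurability for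
  \<open>PiM A\<close> and boundedness on boxes in these coordinates. Closure under
  \<open>pd\<close> makes the divergence of a polynomial field polynomial again.\<close>

inductive_set polys :: "coord set \<Rightarrow> (config \<Rightarrow> real) set" for A where
  const [simp, intro]: "(\<lambda>_. a) \<in> polys A"
| coord [intro]: "c \<in> A \<Longrightarrow> (\<lambda>\<eta>. \<eta> c) \<in> polys A"
| add [intro]: "f \<in> polys A \<Longrightarrow> g \<in> polys A \<Longrightarrow> (\<lambda>\<eta>. f \<eta> + g \<eta>) \<in> polys A"
| mult [intro]: "f \<in> polys A \<Longrightarrow> g \<in> polys A \<Longrightarrow> (\<lambda>\<eta>. f \<eta> * g \<eta>) \<in> polys A"

lemma polys_minus: "f \<in> polys A \<Longrightarrow> (\<lambda>\<eta>. - f \<eta>) \<in> polys A"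
  using polys.mult[of "\<lambda>_. -1" A f] by simp

lemma polys_diff: "f \<in> polys A \<Longrightarrow> g \<in> polys A \<Longrightarrow> (\<lambda>\<eta>. f \<eta> - g \<eta>) \<in> polys A"
  using polys.add[of f A "\<lambda>\<eta>. - g \<eta>"] by (simp add: polys_minus)

lemma polys_power: "f \<in> polys A \<Longrightarrow> (\<lambda>\<eta>. f \<eta> ^ n) \<in> polys A"
  by (induction n) auto

lemma polys_sum: "(\<And>i. i \<in> I \<Longrightarrow> f i \<in> polys A) \<Longrightarrow> (\<lambda>\<eta>. \<Sum>i\<in>I. f i \<eta>) \<in> polys A"
  by (induction I rule: infinite_finite_induct) auto

lemmas polys_intros = polys.intros polys_minus polys_diff polys_power polys_sum

lemma polys_Ck: "f \<in> polys A \<Longrightarrow> Ck n f"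
  by (induction rule: polys.induct) auto

lemma polys_pd: "f \<in> polys A \<Longrightarrow> pd c f \<in> polys A"
  by (induction rule: polys.induct) (auto simp: pd_add pd_mult polys_Ck)

lemma polys_measurable:
  assumes "f \<in> polys A"
  shows "f \<in> borel_measurable (PiM A (\<lambda>_. lborel))"
  using assms by (induction rule: polys.induct) auto

lemma polys_bounded:
  assumes "f \<in> polys A"
  shows "\<exists>K. \<forall>\<eta>. (\<forall>c\<in>A. \<bar>\<eta> c\<bar> \<le> R) \<longrightarrow> \<bar>f \<eta>\<bar> \<le> K"
  using assms
proof (induction rule: polys.induct)
  case (add f g)
  then obtain K L where "\<forall>\<eta>. (\<forall>c\<in>A. \<bar>\<eta> c\<bar> \<le> R) \<longrightarrow> \<bar>f \<eta>\<bar> \<le> K" "\<forall>\<eta>. (\<forall>c\<in>A. \<bar>\<eta> c\<bar> \<le> R) \<longrightarrow> \<bar>g \<eta>\<bar> \<le> L"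
    by blast
  then show ?case by (intro exI[of _ "K + L"]) (smt (verit))
next
  case (mult f g)
  then obtain K L where *: "\<forall>\<eta>. (\<forall>c\<in>A. \<bar>\<eta> c\<bar> \<le> R) \<longrightarrow> \<bar>f \<eta>\<bar> \<le> K" "\<forall>\<eta>. (\<forall>c\<in>A. \<bar>\<eta> c\<bar> \<le> R) \<longrightarrow> \<bar>g \<eta>\<bar> \<le> L"
    by blast
  show ?case
  proof (intro exI[of _ "\<bar>K\<bar> * \<bar>L\<bar>"] allI impI)
    fix \<eta> :: config assume "\<forall>c\<in>A. \<bar>\<eta> c\<bar> \<le> R"
    then have "\<bar>f \<eta>\<bar> \<le> \<bar>K\<bar>" "\<bar>g \<eta>\<bar> \<le> \<bar>L\<bar>" using * by (smt (verit))+
    then show "\<bar>f \<eta> * g \<eta>\<bar> \<le> \<bar>K\<bar> * \<bar>L\<bar>" unfolding abs_mult by (intro mult_mono) auto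
  qed
qed auto

section \<open>The discrete torus and its Fourier modes\<close>

lemma finite_sites [simp]: "finite (sites d N)"
  unfolding sites_def by (intro finite_PiE) auto

lemma card_sites: "card (sites d N) = N ^ d"
  unfolding sites_def by (simp add: card_PiE)

lemma shift_in_sites:
  assumes "x \<in> sites d N" "i \<in> {1..d}" "N > 0"
  shows "shift N i s x \<in> sites d N"
  using assms by (auto simp: sites_def shift_def PiE_iff extensional_def)

lemma shift_shift: "shift N i s (shift N i t x) = shift N i (s + t) x"
  by (auto simp: shift_def fun_eq_iff mod_simps algebra_simps)

lemma shift_0: "x \<in> sites d N \<Longrightarrow> i \<in> {1..d} \<Longrightarrow> shift N i 0 x = x"
  by (auto simp: shift_def sites_def PiE_iff)

lemma bij_shift:
  assumes "i \<in> {1..d}" "N > 0"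
  shows "bij_betw (shift N i s) (sites d N) (sites d N)"
  by (rule bij_betw_byWitness[where f' = "shift N i (- s)"])
     (use assms in \<open>auto simp: shift_shift shift_0 intro: shift_in_sites\<close>)

lemma sum_shift:
  assumes "i \<in> {1..d}" "N > 0"
  shows "(\<Sum>x\<in>sites d N. f (shift N i s x)) = (\<Sum>x\<in>sites d N. f x)"
  by (rule sum.reindex_bij_betw[OF bij_shift[OF assms]])

definition phase :: "nat \<Rightarrow> nat \<Rightarrow> (nat \<Rightarrow> int) \<Rightarrow> (nat \<Rightarrow> int) \<Rightarrow> real" where
  "phase d N k x = 2 * pi / real N * of_int (\<Sum>j=1..d. k j * x j)"

definition freq :: "nat \<Rightarrow> (nat \<Rightarrow> int) \<Rightarrow> nat \<Rightarrow> real" where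
  "freq N k i = 2 * pi * of_int (k i) / real N"

lemma phase_commute: "phase d N k x = phase d N x k"
  by (simp add: phase_def mult.commute)

lemma phase_diff: "phase d N k y - phase d N k x = phase d N k (\<lambda>j. y j - x j)"
  by (simp add: phase_def algebra_simps sum_subtractf)

text \<open>Reduction modulo \<open>N\<close> changes the phase by an integer multiple of 2 pi, so
  the identity holds for \<open>cis\<close> and not for the phase itself. In the proof
  \<open>q\<close> counts how often the shifted coordinate wraps around.\<close>

lemma cis_phase_shift:
  assumes "i \<in> {1..d}" "N > 0"
  shows "cis (phase d N k (shift N i s x)) = cis (phase d N k x + of_int s * freq N k i)"
proof -
  define q where "q = (x i + s) div int N"
  have xi: "(x i + s) mod int N = x i + s - int N * q"
    by (simp add: q_def minus_mult_div_eq_mod)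
  have "(\<Sum>j=1..d. k j * shift N i s x j) = (\<Sum>j=1..d. k j * x j + (if j = i then k i * (s - int N * q) else 0))"
  proof (rule sum.cong[OF refl])
    fix j
    show "k j * shift N i s x j = k j * x j + (if j = i then k i * (s - int N * q) else 0)"
      by (cases "j = i") (simp_all add: shift_def xi, simp add: algebra_simps)
  qed
  also have "\<dots> = (\<Sum>j=1..d. k j * x j) + k i * (s - int N * q)"
    using assms by (simp add: sum.distrib)
  finally have eq: "(\<Sum>j=1..d. k j * shift N i s x j) = (\<Sum>j=1..d. k j * x j) + k i * (s - int N * q)" .
  have "phase d N k (shift N i s x) = phase d N k x + of_int s * freq N k i + 2 * pi * of_int (- (k i * q))"
    using assms unfolding phase_def freq_def eq of_int_add by (simp add: field_simps del: of_int_sum)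
  then have "cis (phase d N k (shift N i s x)) = cis (phase d N k x + of_int s * freq N k i) * cis (2 * pi * of_int (- (k i * q)))"
    by (simp add: cis_mult)
  also have "cis (2 * pi * of_int (- (k i * q))) = 1" by (rule cis_multiple_2pi) simp
  finally show ?thesis by simp
qed

lemma
  assumes "i \<in> {1..d}" "N > 0"
  shows cos_phase_shift: "cos (phase d N k (shift N i s x)) = cos (phase d N k x + of_int s * freq N k i)"
    and sin_phase_shift: "sin (phase d N k (shift N i s x)) = sin (phase d N k x + of_int s * freq N k i)"
  using cis_phase_shift[OF assms, of k s x] by (simp_all add: complex_eq_iff)

lemma cis_sum: "cis (\<Sum>i\<in>I. f i) = (\<Prod>i\<in>I. cis (f i))"
  by (induction I rule: infinite_finite_induct) (auto simp: cis_mult[symmetric])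

text \<open>A geometric sum over the powers of an \<open>N\<close>-th root of unity
  \<open>w\<close>, where \<open>w = 1\<close> exactly if \<open>N\<close> divides
  \<open>z\<close>.\<close>

lemma sum_cis_residues:
  assumes "N > 0"
  shows "(\<Sum>m\<in>{0..<int N}. cis (2 * pi / real N * of_int (m * z))) = (if int N dvd z then of_nat N else 0)"
proof -
  define w where "w = cis (2 * pi * of_int z / real N)"
  have "(\<Sum>m\<in>{0..<int N}. cis (2 * pi / real N * of_int (m * z))) = (\<Sum>m\<in>int ` {0..<N}. cis (2 * pi / real N * of_int (m * z)))"
    by (simp add: image_int_atLeastLessThan)
  also have "\<dots> = (\<Sum>m<N. w ^ m)"
  proof (subst sum.reindex)
    have "cis (2 * pi / real N * of_int (int m * z)) = w ^ m" for m
      by (simp add: w_def Complex.DeMoivre mult.assoc) (simp add: ac_simps)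
    then show "sum ((\<lambda>m. cis (2 * pi / real N * of_int (m * z))) \<circ> int) {0..<N} = (\<Sum>m<N. w ^ m)"
      by (simp add: lessThan_atLeast0)
  qed simp
  finally have *: "(\<Sum>m\<in>{0..<int N}. cis (2 * pi / real N * of_int (m * z))) = (\<Sum>m<N. w ^ m)" .
  have wN: "w ^ N = 1"
    using assms cis_multiple_2pi[of "of_int z"] by (simp add: w_def Complex.DeMoivre)
  have w1: "w = 1 \<longleftrightarrow> int N dvd z"
  proof
    assume "w = 1"
    then have "exp (\<i> * (2 * pi * of_int z / real N)) = 1" by (simp add: w_def cis_conv_exp)
    then obtain n :: int where "2 * pi * of_int z / real N = of_int (2 * n) * pi"
      unfolding exp_eq_1 by auto
    then have "of_int z = (of_int (int N * n) :: real)" using assms by (simp add: field_simps)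
    then have "z = int N * n" by (simp only: of_int_eq_iff)
    then show "int N dvd z" by simp
  next
    assume "int N dvd z"
    then obtain n where "z = int N * n" by (auto simp: dvd_def)
    then have "w = cis (2 * pi * of_int n)" using assms by (simp add: w_def field_simps)
    then show "w = 1" by (simp add: cis_multiple_2pi)
  qed
  show ?thesis
  proof (cases "w = 1")
    case True then show ?thesis unfolding * using w1 by simp
  next
    case False
    then have "(\<Sum>m<N. w ^ m) = 0" using wN by (simp add: geometric_sum)
    then show ?thesis unfolding * using w1 False by simp
  qed
qed

lemma sum_cis_phase:
  assumes "N > 0"
  shows "(\<Sum>k\<in>sites d N. cis (phase d N k z)) = (if \<forall>j\<in>{1..d}. int N dvd z j then of_nat (N ^ d) else 0)"
proof -
  have "(\<Sum>k\<in>sites d N. cis (phase d N k z)) = (\<Sum>k\<in>sites d N. \<Prod>j=1..d. cis (2 * pi / real N * of_int (k j * z j)))"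
    by (simp add: phase_def sum_distrib_left cis_sum)
  also have "\<dots> = (\<Prod>j=1..d. \<Sum>m\<in>{0..<int N}. cis (2 * pi / real N * of_int (m * z j)))"
    unfolding sites_def by (rule prod_sum_PiE[symmetric]) auto
  also have "\<dots> = (\<Prod>j=1..d. if int N dvd z j then of_nat N else 0)"
    by (simp only: sum_cis_residues[OF assms])
  also have "\<dots> = (if \<forall>j\<in>{1..d}. int N dvd z j then of_nat (N ^ d) else 0)"
    by auto
  finally show ?thesis .
qed

lemma sum_cos_phase:
  assumes "N > 0"
  shows "(\<Sum>k\<in>sites d N. cos (phase d N k z)) = (if \<forall>j\<in>{1..d}. int N dvd z j then real (N ^ d) else 0)"
proof -
  have "(\<Sum>k\<in>sites d N. cos (phase d N k z)) = Re (\<Sum>k\<in>sites d N. cis (phase d N k z))"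
    by simp
  then show ?thesis unfolding sum_cis_phase[OF assms] by simp
qed

lemma sum_sin_phase:
  assumes "N > 0"
  shows "(\<Sum>k\<in>sites d N. sin (phase d N k z)) = 0"
proof -
  have "(\<Sum>k\<in>sites d N. sin (phase d N k z)) = Im (\<Sum>k\<in>sites d N. cis (phase d N k z))"
    by simp
  then show ?thesis unfolding sum_cis_phase[OF assms] by simp
qed

lemma sites_dvd_iff:
  assumes "x \<in> sites d N" "y \<in> sites d N"
  shows "(\<forall>j\<in>{1..d}. int N dvd y j - x j) \<longleftrightarrow> y = x"
proof
  assume *: "\<forall>j\<in>{1..d}. int N dvd y j - x j"
  show "y = x"
  proof (rule PiE_ext)
    show "x \<in> {1..d} \<rightarrow>\<^sub>E {0..<int N}" "y \<in> {1..d} \<rightarrow>\<^sub>E {0..<int N}" using assms by (auto simp: sites_def)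
    fix j assume j: "j \<in> {1..d}"
    then have "y j mod int N = x j mod int N" using * by (simp add: mod_eq_dvd_iff)
    then show "y j = x j" using assms j by (auto simp: sites_def PiE_iff)
  qed
qed auto

text \<open>The product of sines is half a difference of cosines of phases at the two shifted sites;
  orthogonality turns each into a Kronecker delta. This inverts the Fourier transform of the central
  difference.\<close>

lemma sum_freq_sin_phase:
  assumes "x \<in> sites d N" "y \<in> sites d N" "i \<in> {1..d}" "N > 0"
  shows "(\<Sum>k\<in>sites d N. sin (freq N k i) * sin (phase d N k y - phase d N k x))
    = real (N ^ d) / 2 * (of_bool (y = shift N i 1 x) - of_bool (y = shift N i (-1) x))"
proof -
  have "(\<Sum>k\<in>sites d N. sin (freq N k i) * sin (phase d N k y - phase d N k x))
      = (\<Sum>k\<in>sites d N. 1/2 * (cos (phase d N k y - phase d N k (shift N i 1 x)) - cos (phase d N k y - phase d N k (shift N i (-1) x))))"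
  proof (rule sum.cong[OF refl])
    fix k
    have "cos (phase d N k y - phase d N k (shift N i 1 x)) = cos (phase d N k y - phase d N k x - freq N k i)"
      "cos (phase d N k y - phase d N k (shift N i (-1) x)) = cos (phase d N k y - phase d N k x + freq N k i)"
      by (simp_all only: cos_diff cos_phase_shift[OF assms(3,4)] sin_phase_shift[OF assms(3,4)])
         (simp_all add: cos_add sin_add cos_diff sin_diff algebra_simps)
    then show "sin (freq N k i) * sin (phase d N k y - phase d N k x)
      = 1/2 * (cos (phase d N k y - phase d N k (shift N i 1 x)) - cos (phase d N k y - phase d N k (shift N i (-1) x)))"
      by (simp only:) (simp add: cos_add cos_diff)
  qed
  also have "\<dots> = 1/2 * ((\<Sum>k\<in>sites d N. cos (phase d N k y - phase d N k (shift N i 1 x)))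
      - (\<Sum>k\<in>sites d N. cos (phase d N k y - phase d N k (shift N i (-1) x))))"
    by (simp only: sum_distrib_left[symmetric] sum_subtractf)
  also have "\<dots> = 1/2 * (real (N ^ d) * of_bool (y = shift N i 1 x) - real (N ^ d) * of_bool (y = shift N i (-1) x))"
    unfolding phase_diff sum_cos_phase[OF assms(4)]
    using sites_dvd_iff[OF shift_in_sites[OF assms(1,3,4)] assms(2)] by simp
  finally show ?thesis by (simp add: algebra_simps)
qed

text \<open>The phase is symmetric in site and wave number, so orthogonality over wave numbers also
  serves for sums over sites.\<close>

lemma sum_sites_cos_phase:
  assumes "k \<in> sites d N" "\<exists>i\<in>{1..d}. k i \<noteq> 0" "N > 0"
  shows "(\<Sum>x\<in>sites d N. cos (phase d N k x)) = 0"
proof -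
  have "\<not> (\<forall>j\<in>{1..d}. int N dvd k j)"
    using assms by (auto simp: sites_def PiE_iff) (metis atLeastAtMost_iff zdvd_not_zless order_le_less)
  then show ?thesis
    unfolding phase_commute[of d N k] sum_cos_phase[OF assms(3)] by (rule if_not_P)
qed

lemma sum_sites_sin_phase: "N > 0 \<Longrightarrow> (\<Sum>x\<in>sites d N. sin (phase d N k x)) = 0"
  using sum_sin_phase[of N d k] by (simp add: phase_commute[of d N k])

text \<open>Two distinct unit steps in one direction differ by 2 in absolute value, and a step
  differs from none by 1; for \<open>N \<ge> 3\<close> neither is divisible by \<open>N\<close>. On
  smaller tori the two neighbours in a direction coincide.\<close>

lemma shift_eq_iff:
  assumes "x \<in> sites d N" "i \<in> {1..d}" "j \<in> {1..d}" "s \<in> {-1,1}" "t \<in> {-1,1}" "N \<ge> 3"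
  shows "shift N i s x = shift N j t x \<longleftrightarrow> i = j \<and> s = t"
proof
  assume eq: "shift N i s x = shift N j t x"
  have *: "\<not> int N dvd r" if "r \<in> {-2,-1,1,2}" for r
  proof
    assume "int N dvd r"
    then have "\<bar>int N\<bar> \<le> \<bar>r\<bar>" using that by (intro dvd_imp_le_int) auto
    then show False using that assms(6) by auto
  qed
  have xi: "x l = x l mod int N" if "l \<in> {1..d}" for l
    using assms(1) that by (auto simp: sites_def PiE_iff)
  have ne: "(x l + r) mod int N \<noteq> x l" if "l \<in> {1..d}" "r \<in> {-1,1}" for l r
  proof
    assume "(x l + r) mod int N = x l"
    then have "(x l + r) mod int N = x l mod int N" using xi[OF that(1)] by simp
    then have "int N dvd r" by (simp add: mod_eq_dvd_iff)
    then show False using * that by auto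
  qed
  have "i = j"
  proof (rule ccontr)
    assume "i \<noteq> j"
    then have "shift N j t x i = x i" by (simp add: shift_def)
    then have "(x i + s) mod int N = x i" using fun_cong[OF eq, of i] by (simp add: shift_def)
    then show False using ne[OF assms(2,4)] by simp
  qed
  moreover have "s = t"
  proof (rule ccontr)
    assume "s \<noteq> t"
    have "(x i + s) mod int N = (x i + t) mod int N"
      using fun_cong[OF eq, of i] \<open>i = j\<close> by (simp add: shift_def)
    then have "int N dvd s - t" by (simp add: mod_eq_dvd_iff)
    moreover have "s - t \<in> {-2,-1,1,2}" using \<open>s \<noteq> t\<close> assms(4,5) by auto
    ultimately show False using * by blast
  qed
  ultimately show "i = j \<and> s = t" ..
qed auto

lemma sum_neighbours:
  assumes "x \<in> sites d N" "N \<ge> 3"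
  shows "(\<Sum>y\<in>neighbours d N x. f y) = (\<Sum>i=1..d. f (shift N i 1 x) + f (shift N i (-1) x))"
proof -
  let ?g = "\<lambda>(i, s). shift N i s x" and ?I = "{1..d} \<times> {1, -1}"
  have N: "N > 0" using assms(2) by simp
  have inj: "inj_on ?g ?I"
    by (rule inj_onI) (use shift_eq_iff[OF assms(1) _ _ _ _ assms(2)] in \<open>clarsimp, blast\<close>)
  have img: "neighbours d N x = ?g ` ?I"
    using shift_in_sites[OF assms(1) _ N] unfolding neighbours_def by force
  have "(\<Sum>y\<in>neighbours d N x. f y) = (\<Sum>p\<in>?I. f (?g p))"
    unfolding img by (rule sum.reindex[OF inj, unfolded comp_def])
  also have "\<dots> = (\<Sum>i=1..d. \<Sum>s\<in>{1,-1}. f (shift N i s x))"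
    unfolding sum.cartesian_product by (rule sum.cong) auto
  also have "\<dots> = (\<Sum>i=1..d. f (shift N i 1 x) + f (shift N i (-1) x))" by simp
  finally show ?thesis .
qed

lemma Ck_cdivide [simp]: "Ck n f \<Longrightarrow> Ck n (\<lambda>\<eta>. f \<eta> / a)"
  using Ck_mult[of n f "\<lambda>_. 1 / a"] by simp

lemma deriv_cdivide: "derivation D \<Longrightarrow> C1 f \<Longrightarrow> D (\<lambda>\<eta>. f \<eta> / a) = (\<lambda>\<eta>. D f \<eta> / a)"
  using deriv_cmult[of D f "1 / a"] by simp

lemmas deriv_simps = deriv_add deriv_mult deriv_diff deriv_minus deriv_const deriv_sum deriv_square deriv_cdivide

section \<open>The harmonic Hamiltonian\<close>

text \<open>The first-order operator of the vector field with components \<open>b c\<close>.\<close>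

definition dv :: "coord set \<Rightarrow> (coord \<Rightarrow> config \<Rightarrow> real) \<Rightarrow> (config \<Rightarrow> real) \<Rightarrow> config \<Rightarrow> real" where
  "dv A b f \<eta> = (\<Sum>c\<in>A. b c \<eta> * pd c f \<eta>)"

lemma derivation_dv: "derivation (dv A b)"
proof -
  have "derivation (\<lambda>f \<eta>. \<Sum>c\<in>A. b c \<eta> * pd c f \<eta>)"
    by (intro derivation_sum derivation_cmult derivation_pd)
  then show ?thesis by (simp add: dv_def[abs_def])
qed

lemma dv_coord: "finite A \<Longrightarrow> c \<in> A \<Longrightarrow> dv A b (\<lambda>\<eta>. \<eta> c) = b c"
  by (rule ext) (simp add: dv_def if_distrib cong: if_cong)

lemma finite_coords [simp]: "finite (coords d N)"
  by (simp add: coords_def)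

lemma Pos_in_coords: "x \<in> sites d N \<Longrightarrow> j \<in> {1..d} \<Longrightarrow> Pos x j \<in> coords d N"
  and Mom_in_coords: "x \<in> sites d N \<Longrightarrow> j \<in> {1..d} \<Longrightarrow> Mom x j \<in> coords d N"
  by (auto simp: coords_def)

lemma sum_coords:
  "(\<Sum>c\<in>coords d N. g c) = (\<Sum>j=1..d. \<Sum>x\<in>sites d N. g (Pos x j) + g (Mom x j))"
proof -
  let ?X = "sites d N \<times> {1..d}"
  have "(\<Sum>c\<in>coords d N. g c) = (\<Sum>c\<in>(\<lambda>(x, j). Pos x j) ` ?X. g c) + (\<Sum>c\<in>(\<lambda>(x, j). Mom x j) ` ?X. g c)"
    unfolding coords_def by (rule sum.union_disjoint) auto
  also have "(\<Sum>c\<in>(\<lambda>(x, j). Pos x j) ` ?X. g c) = (\<Sum>(x, j)\<in>?X. g (Pos x j))"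
    by (subst sum.reindex) (auto simp: inj_on_def intro!: sum.cong)
  also have "(\<Sum>c\<in>(\<lambda>(x, j). Mom x j) ` ?X. g c) = (\<Sum>(x, j)\<in>?X. g (Mom x j))"
    by (subst sum.reindex) (auto simp: inj_on_def intro!: sum.cong)
  also have "(\<Sum>(x, j)\<in>?X. g (Pos x j)) + (\<Sum>(x, j)\<in>?X. g (Mom x j)) = (\<Sum>x\<in>sites d N. \<Sum>j=1..d. g (Pos x j) + g (Mom x j))"
    by (simp add: sum.cartesian_product sum.distrib)
  also have "\<dots> = (\<Sum>j=1..d. \<Sum>x\<in>sites d N. g (Pos x j) + g (Mom x j))" by (rule sum.swap)
  finally show ?thesis .
qed

definition lin :: "nat \<Rightarrow> nat \<Rightarrow> (site \<Rightarrow> real) \<Rightarrow> (site \<Rightarrow> coord) \<Rightarrow> config \<Rightarrow> real" where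
  "lin d N a C \<eta> = (\<Sum>x\<in>sites d N. a x * \<eta> (C x))"

lemma Ck_lin [simp]: "Ck n (lin d N a C)"
  unfolding lin_def[abs_def] by simp

lemma deriv_lin:
  assumes D: "derivation D"
  shows "D (lin d N a C) = (\<lambda>\<eta>. \<Sum>x\<in>sites d N. a x * D (\<lambda>\<eta>. \<eta> (C x)) \<eta>)"
  unfolding lin_def[abs_def] by (simp add: deriv_simps[OF D])

lemma lin_polys: "(\<And>x. x \<in> sites d N \<Longrightarrow> C x \<in> A) \<Longrightarrow> lin d N a C \<in> polys A"
  unfolding lin_def[abs_def] by (intro polys_intros) auto

locale chain =
  fixes d N :: nat and \<alpha> \<nu> :: real
  assumes d: "d \<ge> 1" and N: "N \<ge> 3" and \<alpha>: "\<alpha> > 0" and \<nu>: "\<nu> \<ge> 0"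
begin

abbreviation "S \<equiv> sites d N"
abbreviation "A \<equiv> coords d N"
abbreviation "H \<equiv> hamiltonian d N \<alpha> \<nu>"
abbreviation "P j \<equiv> lin d N (\<lambda>_. 1) (\<lambda>x. Mom x j)"
abbreviation "Q j \<equiv> lin d N (\<lambda>_. 1) (\<lambda>x. Pos x j)"
abbreviation "cosf k x \<equiv> cos (phase d N k x)"
abbreviation "sinf k x \<equiv> sin (phase d N k x)"
abbreviation "cq k j \<equiv> lin d N (cosf k) (\<lambda>x. Pos x j)"
abbreviation "sq k j \<equiv> lin d N (sinf k) (\<lambda>x. Pos x j)"
abbreviation "cp k j \<equiv> lin d N (cosf k) (\<lambda>x. Mom x j)"
abbreviation "sp k j \<equiv> lin d N (sinf k) (\<lambda>x. Mom x j)"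

lemma N_pos: "N > 0" using N by simp

text \<open>The squared dispersion relation: the eigenvalue of pinning plus lattice Laplacian on the
  Fourier mode \<open>k\<close>.\<close>

definition om2 :: "site \<Rightarrow> real" where
  "om2 k = \<nu> + 4 * \<alpha> * (\<Sum>i=1..d. (sin (freq N k i / 2))\<^sup>2)"

text \<open>The position gradient of the Hamiltonian, by \<open>pd_Pos_H\<close>; the force is its
  negative.\<close>

definition W :: "site \<Rightarrow> nat \<Rightarrow> config \<Rightarrow> real" where
  "W x j \<eta> = \<nu> * \<eta> (Pos x j)
    + \<alpha> * (\<Sum>i=1..d. 2 * \<eta> (Pos x j) - \<eta> (Pos (shift N i 1 x) j) - \<eta> (Pos (shift N i (-1) x) j))"

lemma sum_by_parts:
  assumes "i \<in> {1..d}"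
  shows "(\<Sum>x\<in>S. (f (shift N i 1 x) - f x) * (g (shift N i 1 x) - g x))
       = (\<Sum>x\<in>S. (2 * f x - f (shift N i 1 x) - f (shift N i (-1) x)) * g x :: real)"
proof -
  have "(\<Sum>x\<in>S. (f (shift N i 1 x) - f x) * (g (shift N i 1 x) - g x))
      = (\<Sum>x\<in>S. (f (shift N i 1 x) - f x) * g (shift N i 1 x)) - (\<Sum>x\<in>S. (f (shift N i 1 x) - f x) * g x)"
    by (simp add: sum_subtractf[symmetric] algebra_simps)
  also have "(\<Sum>x\<in>S. (f (shift N i 1 x) - f x) * g (shift N i 1 x))
     = (\<Sum>x\<in>S. (f (shift N i 1 (shift N i (-1) x)) - f (shift N i (-1) x)) * g (shift N i 1 (shift N i (-1) x)))"
    by (rule sum_shift[OF assms N_pos, symmetric])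
  also have "\<dots> = (\<Sum>x\<in>S. (f x - f (shift N i (-1) x)) * g x)"
    by (intro sum.cong) (auto simp: shift_shift shift_0[OF _ assms])
  finally show ?thesis by (simp add: sum_subtractf[symmetric] algebra_simps)
qed

lemma W_adjoint:
  assumes "\<And>x i. x \<in> S \<Longrightarrow> i \<in> {1..d} \<Longrightarrow> a (shift N i 1 x) + a (shift N i (-1) x) = 2 * c i * a x"
  shows "(\<Sum>x\<in>S. a x * W x j \<eta>) = (\<nu> + 2 * \<alpha> * (\<Sum>i=1..d. 1 - c i)) * lin d N a (\<lambda>x. Pos x j) \<eta>"
proof -
  let ?q = "\<lambda>x. \<eta> (Pos x j)"
  have *: "(\<Sum>x\<in>S. a x * (2 * ?q x - ?q (shift N i 1 x) - ?q (shift N i (-1) x))) = 2 * (1 - c i) * (\<Sum>x\<in>S. a x * ?q x)"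
    if i: "i \<in> {1..d}" for i
  proof -
    have "(\<Sum>x\<in>S. a x * (2 * ?q x - ?q (shift N i 1 x) - ?q (shift N i (-1) x)))
        = (\<Sum>x\<in>S. (?q (shift N i 1 x) - ?q x) * (a (shift N i 1 x) - a x))"
      by (subst sum_by_parts[OF i]) (simp add: mult.commute)
    also have "\<dots> = (\<Sum>x\<in>S. (a (shift N i 1 x) - a x) * (?q (shift N i 1 x) - ?q x))"
      by (simp add: mult.commute)
    also have "\<dots> = (\<Sum>x\<in>S. (2 * a x - a (shift N i 1 x) - a (shift N i (-1) x)) * ?q x)"
      by (rule sum_by_parts[OF i])
    also have "\<dots> = (\<Sum>x\<in>S. 2 * (1 - c i) * (a x * ?q x))"
    proof (intro sum.cong refl)
      fix x assume x: "x \<in> S"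
      have "2 * a x - a (shift N i 1 x) - a (shift N i (-1) x) = 2 * (1 - c i) * a x"
        using assms[OF x i] by (simp add: algebra_simps)
      then show "(2 * a x - a (shift N i 1 x) - a (shift N i (-1) x)) * ?q x = 2 * (1 - c i) * (a x * ?q x)" by simp
    qed
    finally show ?thesis by (simp add: sum_distrib_left)
  qed
  have "(\<Sum>x\<in>S. a x * W x j \<eta>) = \<nu> * (\<Sum>x\<in>S. a x * ?q x)
     + \<alpha> * (\<Sum>x\<in>S. \<Sum>i=1..d. a x * (2 * ?q x - ?q (shift N i 1 x) - ?q (shift N i (-1) x)))"
    by (simp add: W_def algebra_simps sum.distrib sum_distrib_left)
  also have "(\<Sum>x\<in>S. \<Sum>i=1..d. a x * (2 * ?q x - ?q (shift N i 1 x) - ?q (shift N i (-1) x)))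
      = (\<Sum>i=1..d. 2 * (1 - c i) * (\<Sum>x\<in>S. a x * ?q x))"
    by (subst sum.swap) (intro sum.cong refl *)
  also have "\<dots> = 2 * (\<Sum>i=1..d. 1 - c i) * (\<Sum>x\<in>S. a x * ?q x)"
    unfolding sum_distrib_left[of 2] sum_distrib_right[of _ "{1..d}"] ..
  finally show ?thesis by (simp add: lin_def algebra_simps)
qed

lemma cosf_harmonic: "i \<in> {1..d} \<Longrightarrow> cosf k (shift N i 1 x) + cosf k (shift N i (-1) x) = 2 * cos (freq N k i) * cosf k x"
  and sinf_harmonic: "i \<in> {1..d} \<Longrightarrow> sinf k (shift N i 1 x) + sinf k (shift N i (-1) x) = 2 * cos (freq N k i) * sinf k x"
  by (simp_all add: cos_phase_shift[OF _ N_pos] sin_phase_shift[OF _ N_pos] cos_add sin_add cos_diff sin_diff)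

lemma om2_alt: "om2 k = \<nu> + 2 * \<alpha> * (\<Sum>i=1..d. 1 - cos (freq N k i))"
proof -
  have "1 - cos (freq N k i) = 2 * (sin (freq N k i / 2))\<^sup>2" for i
    using cos_double_sin[of "freq N k i / 2"] by simp
  then show ?thesis by (simp add: om2_def sum_distrib_left[symmetric])
qed

lemma sum_W: "(\<Sum>x\<in>S. W x j \<eta>) = \<nu> * Q j \<eta>"
  using W_adjoint[of "\<lambda>_. 1" "\<lambda>_. 1" j \<eta>] by simp

lemma sum_cosf_W: "(\<Sum>x\<in>S. cosf k x * W x j \<eta>) = om2 k * cq k j \<eta>"
  and sum_sinf_W: "(\<Sum>x\<in>S. sinf k x * W x j \<eta>) = om2 k * sq k j \<eta>"
  unfolding om2_alt by (intro W_adjoint cosf_harmonic sinf_harmonic; assumption)+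

text \<open>The sum over sites and neighbours meets every bond twice, so its weight 1/4 becomes 1/2
  once each bond is kept only in its positive direction.\<close>

lemma hamiltonian_bonds:
  "H \<eta> = (\<Sum>j=1..d. \<Sum>x\<in>S. 1/2 * (\<eta> (Mom x j))\<^sup>2 + \<nu>/2 * (\<eta> (Pos x j))\<^sup>2
      + \<alpha>/2 * (\<Sum>i=1..d. (\<eta> (Pos (shift N i 1 x) j) - \<eta> (Pos x j))\<^sup>2))"
proof -
  define b where "b x y = (\<Sum>j=1..d. (\<eta> (Pos x j) - \<eta> (Pos y j))\<^sup>2)" for x y
  have "(\<Sum>x\<in>S. \<Sum>y\<in>neighbours d N x. b x y) = (\<Sum>x\<in>S. \<Sum>i=1..d. b x (shift N i 1 x) + b x (shift N i (-1) x))"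
    using N by (intro sum.cong refl sum_neighbours) auto
  also have "\<dots> = (\<Sum>i=1..d. (\<Sum>x\<in>S. b x (shift N i 1 x)) + (\<Sum>x\<in>S. b x (shift N i (-1) x)))"
    by (subst sum.swap) (simp add: sum.distrib)
  also have "\<dots> = (\<Sum>i=1..d. 2 * (\<Sum>x\<in>S. b (shift N i 1 x) x))"
  proof (intro sum.cong refl)
    fix i assume i: "i \<in> {1..d}"
    have "(\<Sum>x\<in>S. b x (shift N i (-1) x)) = (\<Sum>x\<in>S. b (shift N i 1 x) (shift N i (-1) (shift N i 1 x)))"
      by (rule sum_shift[OF i N_pos, symmetric])
    also have "\<dots> = (\<Sum>x\<in>S. b (shift N i 1 x) x)"
      by (intro sum.cong refl) (simp add: shift_shift shift_0[OF _ i])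
    finally show "(\<Sum>x\<in>S. b x (shift N i 1 x)) + (\<Sum>x\<in>S. b x (shift N i (-1) x)) = 2 * (\<Sum>x\<in>S. b (shift N i 1 x) x)"
      by (simp add: b_def power2_commute)
  qed
  also have "\<dots> = 2 * (\<Sum>x\<in>S. \<Sum>i=1..d. b (shift N i 1 x) x)"
    by (subst sum.swap) (simp add: sum_distrib_left)
  also have "(\<Sum>x\<in>S. \<Sum>i=1..d. b (shift N i 1 x) x)
      = (\<Sum>j=1..d. \<Sum>x\<in>S. \<Sum>i=1..d. (\<eta> (Pos (shift N i 1 x) j) - \<eta> (Pos x j))\<^sup>2)"
    unfolding b_def by (subst (2) sum.swap, subst sum.swap) (rule refl)
  finally have bonds: "(\<Sum>x\<in>S. \<Sum>y\<in>neighbours d N x. b x y)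
      = 2 * (\<Sum>j=1..d. \<Sum>x\<in>S. \<Sum>i=1..d. (\<eta> (Pos (shift N i 1 x) j) - \<eta> (Pos x j))\<^sup>2)" .
  have "H \<eta> = (\<Sum>x\<in>S. \<Sum>j=1..d. 1/2 * (\<eta> (Mom x j))\<^sup>2) + (\<Sum>x\<in>S. \<Sum>j=1..d. \<nu>/2 * (\<eta> (Pos x j))\<^sup>2)
     + \<alpha>/4 * (\<Sum>x\<in>S. \<Sum>y\<in>neighbours d N x. b x y)"
    unfolding hamiltonian_def b_def by (simp add: sum.distrib sum_distrib_left)
  also have "(\<Sum>x\<in>S. \<Sum>j=1..d. 1/2 * (\<eta> (Mom x j))\<^sup>2) = (\<Sum>j=1..d. \<Sum>x\<in>S. 1/2 * (\<eta> (Mom x j))\<^sup>2)" by (rule sum.swap)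
  also have "(\<Sum>x\<in>S. \<Sum>j=1..d. \<nu>/2 * (\<eta> (Pos x j))\<^sup>2) = (\<Sum>j=1..d. \<Sum>x\<in>S. \<nu>/2 * (\<eta> (Pos x j))\<^sup>2)" by (rule sum.swap)
  finally show ?thesis unfolding bonds by (simp add: sum.distrib sum_distrib_left)
qed

lemma H_polys [simp, intro]: "H \<in> polys A"
proof -
  have "(\<lambda>\<eta>. \<Sum>j=1..d. \<Sum>x\<in>S. 1/2 * (\<eta> (Mom x j))\<^sup>2 + \<nu>/2 * (\<eta> (Pos x j))\<^sup>2
      + \<alpha>/2 * (\<Sum>i=1..d. (\<eta> (Pos (shift N i 1 x) j) - \<eta> (Pos x j))\<^sup>2)) \<in> polys A"
    by (intro polys_intros Pos_in_coords Mom_in_coords shift_in_sites N_pos)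
  then show ?thesis by (simp add: hamiltonian_bonds[abs_def])
qed

lemma P_polys [simp]: "j \<in> {1..d} \<Longrightarrow> P j \<in> polys A"
  and Q_polys [simp]: "j \<in> {1..d} \<Longrightarrow> Q j \<in> polys A"
  and four_polys [simp]: "j \<in> {1..d} \<Longrightarrow> cq k j \<in> polys A" "j \<in> {1..d} \<Longrightarrow> sq k j \<in> polys A"
    "j \<in> {1..d} \<Longrightarrow> cp k j \<in> polys A" "j \<in> {1..d} \<Longrightarrow> sp k j \<in> polys A"
  by (auto intro!: lin_polys Pos_in_coords Mom_in_coords)

lemma Ck_H [simp]: "Ck n H" by (rule polys_Ck[OF H_polys])

text \<open>Stated for an arbitrary derivation, so that conservation of energy and tangency of a
  field both reduce to the values of the field on the coordinates.\<close>

lemma deriv_H: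
  assumes D: "derivation D"
  shows "D H \<eta> = (\<Sum>j=1..d. \<Sum>x\<in>S. \<eta> (Mom x j) * D (\<lambda>\<eta>. \<eta> (Mom x j)) \<eta> + W x j \<eta> * D (\<lambda>\<eta>. \<eta> (Pos x j)) \<eta>)"
proof -
  let ?q = "\<lambda>j x. \<eta> (Pos x j)" and ?Dq = "\<lambda>j x. D (\<lambda>\<eta>. \<eta> (Pos x j)) \<eta>"
  have "D H \<eta> = (\<Sum>j=1..d. \<Sum>x\<in>S. \<eta> (Mom x j) * D (\<lambda>\<eta>. \<eta> (Mom x j)) \<eta> + \<nu> * ?q j x * ?Dq j x
      + \<alpha> * (\<Sum>i=1..d. (?q j (shift N i 1 x) - ?q j x) * (?Dq j (shift N i 1 x) - ?Dq j x)))"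
    unfolding hamiltonian_bonds[abs_def]
    by (simp add: deriv_simps[OF D] sum_distrib_left algebra_simps diff_divide_distrib add_divide_distrib)
  also have "\<dots> = (\<Sum>j=1..d. (\<Sum>x\<in>S. \<eta> (Mom x j) * D (\<lambda>\<eta>. \<eta> (Mom x j)) \<eta> + \<nu> * ?q j x * ?Dq j x)
      + \<alpha> * (\<Sum>i=1..d. \<Sum>x\<in>S. (?q j (shift N i 1 x) - ?q j x) * (?Dq j (shift N i 1 x) - ?Dq j x)))"
    by (simp add: sum.distrib sum_distrib_left[symmetric] sum.swap[of _ S])
  also have "\<dots> = (\<Sum>j=1..d. (\<Sum>x\<in>S. \<eta> (Mom x j) * D (\<lambda>\<eta>. \<eta> (Mom x j)) \<eta> + \<nu> * ?q j x * ?Dq j x)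
      + \<alpha> * (\<Sum>i=1..d. \<Sum>x\<in>S. (2 * ?q j x - ?q j (shift N i 1 x) - ?q j (shift N i (-1) x)) * ?Dq j x))"
    by (intro sum.cong refl arg_cong2[where f="(+)"] arg_cong2[where f="(*)"] sum_by_parts)
  also have "\<dots> = (\<Sum>j=1..d. \<Sum>x\<in>S. \<eta> (Mom x j) * D (\<lambda>\<eta>. \<eta> (Mom x j)) \<eta> + \<nu> * ?q j x * ?Dq j x
      + \<alpha> * (\<Sum>i=1..d. (2 * ?q j x - ?q j (shift N i 1 x) - ?q j (shift N i (-1) x)) * ?Dq j x))"
    by (simp add: sum.distrib sum_distrib_left[symmetric] sum.swap[of _ S])
  also have "\<dots> = (\<Sum>j=1..d. \<Sum>x\<in>S. \<eta> (Mom x j) * D (\<lambda>\<eta>. \<eta> (Mom x j)) \<eta> + W x j \<eta> * ?Dq j x)"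
    by (simp add: W_def sum_distrib_left sum_distrib_right algebra_simps)
  finally show ?thesis .
qed

lemma pd_Pos_H: "x \<in> S \<Longrightarrow> j \<in> {1..d} \<Longrightarrow> pd (Pos x j) H = W x j"
proof
  fix \<eta> assume *: "x \<in> S" "j \<in> {1..d}"
  have "pd (Pos x j) H \<eta> = (\<Sum>i=1..d. \<Sum>y\<in>S. if y = x \<and> i = j then W x j \<eta> else 0)"
    unfolding deriv_H[OF derivation_pd] by (intro sum.cong refl) auto
  also have "\<dots> = (\<Sum>i=1..d. if i = j then W x j \<eta> else 0)"
    using * by (intro sum.cong refl) auto
  also have "\<dots> = W x j \<eta>" using * by simp
  finally show "pd (Pos x j) H \<eta> = W x j \<eta>" .
qed

section \<open>The Liouville operator and the quadratic mode observables\<close>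

definition liouville_field :: "coord \<Rightarrow> config \<Rightarrow> real" where
  "liouville_field c = (case c of Pos x j \<Rightarrow> (\<lambda>\<eta>. \<eta> (Mom x j)) | Mom x j \<Rightarrow> (\<lambda>\<eta>. - W x j \<eta>))"

lemma liouville_op_dv: "liouville_op d N \<alpha> \<nu> = dv A liouville_field"
proof (intro ext)
  fix f \<eta>
  show "liouville_op d N \<alpha> \<nu> f \<eta> = dv A liouville_field f \<eta>"
    unfolding liouville_op_def dv_def sum_coords
    by (subst sum.swap) (simp add: liouville_field_def pd_Pos_H)
qed

lemma derivation_liouville: "derivation (liouville_op d N \<alpha> \<nu>)"
  unfolding liouville_op_dv by (rule derivation_dv)

lemma liouville_Pos: "x \<in> S \<Longrightarrow> j \<in> {1..d} \<Longrightarrow> liouville_op d N \<alpha> \<nu> (\<lambda>\<eta>. \<eta> (Pos x j)) = (\<lambda>\<eta>. \<eta> (Mom x j))"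
  and liouville_Mom: "x \<in> S \<Longrightarrow> j \<in> {1..d} \<Longrightarrow> liouville_op d N \<alpha> \<nu> (\<lambda>\<eta>. \<eta> (Mom x j)) = (\<lambda>\<eta>. - W x j \<eta>)"
  unfolding liouville_op_dv by (simp_all add: dv_coord Pos_in_coords Mom_in_coords, simp_all add: liouville_field_def)

lemma liouville_H: "liouville_op d N \<alpha> \<nu> H = (\<lambda>_. 0)"
  by (rule ext) (simp add: deriv_H[OF derivation_liouville] liouville_Pos liouville_Mom)

lemma liouville_lin:
  assumes "j \<in> {1..d}"
  shows "liouville_op d N \<alpha> \<nu> (lin d N a (\<lambda>x. Pos x j)) = lin d N a (\<lambda>x. Mom x j)"
    and "liouville_op d N \<alpha> \<nu> (lin d N a (\<lambda>x. Mom x j)) = (\<lambda>\<eta>. - (\<Sum>x\<in>S. a x * W x j \<eta>))"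
  using assms by (auto simp: fun_eq_iff deriv_lin[OF derivation_liouville] liouville_Pos liouville_Mom lin_def sum_negf)

text \<open>With complex Fourier modes \<open>cp k j + i sp k j\<close> and
  \<open>cq k j + i sq k j\<close> this is the imaginary part of the conjugate momentum mode times
  the position mode, summed over components; \<open>BB k\<close> below is the squared modulus of the
  position mode.\<close>

definition JJ :: "site \<Rightarrow> config \<Rightarrow> real" where
  "JJ k \<eta> = (\<Sum>j=1..d. cp k j \<eta> * sq k j \<eta> - sp k j \<eta> * cq k j \<eta>)"

definition BB :: "site \<Rightarrow> config \<Rightarrow> real" where
  "BB k \<eta> = (\<Sum>j=1..d. (cq k j \<eta>)\<^sup>2 + (sq k j \<eta>)\<^sup>2)"

lemma JJ_polys [simp]: "JJ k \<in> polys A"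
  unfolding JJ_def[abs_def] by (intro polys_intros) simp_all

lemma BB_polys [simp]: "BB k \<in> polys A"
  unfolding BB_def[abs_def] by (intro polys_intros) simp_all

lemma Ck_JJ [simp]: "Ck n (JJ k)" and Ck_BB [simp]: "Ck n (BB k)"
  by (auto intro: polys_Ck JJ_polys BB_polys)

text \<open>Differentiating the positions leaves an antisymmetric form in the momentum modes, which
  vanishes. Differentiating the momenta multiplies the position modes by the common scalar
  \<open>- om2 k\<close> and leaves an antisymmetric form in them, which vanishes too.\<close>

lemma liouville_JJ: "liouville_op d N \<alpha> \<nu> (JJ k) = (\<lambda>_. 0)"
  unfolding JJ_def[abs_def]
  by (simp add: deriv_simps[OF derivation_liouville] liouville_lin sum_cosf_W sum_sinf_W algebra_simps)

text \<open>In the sum of the bond currents the products at equal sites cancel by translation, and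
  the cross terms combine into a central difference of the positions.\<close>

lemma total_current_eq:
  "total_current d N \<alpha> \<eta> = (\<Sum>j=1..d. \<Sum>x\<in>S. \<eta> (Mom x j) * (- (\<alpha>/2) * (\<eta> (Pos (shift N 1 1 x) j) - \<eta> (Pos (shift N 1 (-1) x) j))))"
proof -
  have i: "(1::nat) \<in> {1..d}" using d by simp
  have *: "(\<Sum>x\<in>S. (q (shift N 1 1 x) - q x) * (p (shift N 1 1 x) + p x)) = (\<Sum>x\<in>S. p x * (q (shift N 1 1 x) - q (shift N 1 (-1) x)))"
    for p q :: "site \<Rightarrow> real"
  proof -
    have "(\<Sum>x\<in>S. (q (shift N 1 1 x) - q x) * (p (shift N 1 1 x) + p x))
      = (\<Sum>x\<in>S. q (shift N 1 1 x) * p (shift N 1 1 x)) - (\<Sum>x\<in>S. q x * p x)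
      + (\<Sum>x\<in>S. p x * q (shift N 1 1 x)) - (\<Sum>x\<in>S. p (shift N 1 1 x) * q x)"
      by (simp add: sum.distrib[symmetric] sum_subtractf[symmetric] algebra_simps)
    also have "(\<Sum>x\<in>S. q (shift N 1 1 x) * p (shift N 1 1 x)) = (\<Sum>x\<in>S. q x * p x)"
      by (rule sum_shift[OF i N_pos])
    also have "(\<Sum>x\<in>S. p (shift N 1 1 x) * q x) = (\<Sum>x\<in>S. p (shift N 1 1 (shift N 1 (-1) x)) * q (shift N 1 (-1) x))"
      by (rule sum_shift[OF i N_pos, symmetric])
    also have "\<dots> = (\<Sum>x\<in>S. p x * q (shift N 1 (-1) x))"
      by (intro sum.cong refl) (simp add: shift_shift shift_0[OF _ i, unfolded One_nat_def])
    finally show ?thesis by (simp add: sum_subtractf[symmetric] algebra_simps)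
  qed
  have "total_current d N \<alpha> \<eta> = (\<Sum>j=1..d. - (\<alpha>/2) * (\<Sum>x\<in>S. (\<eta> (Pos (shift N 1 1 x) j) - \<eta> (Pos x j)) * (\<eta> (Mom (shift N 1 1 x) j) + \<eta> (Mom x j))))"
    unfolding total_current_def current_def sum_distrib_left by (rule sum.swap)
  also have "\<dots> = (\<Sum>j=1..d. - (\<alpha>/2) * (\<Sum>x\<in>S. \<eta> (Mom x j) * (\<eta> (Pos (shift N 1 1 x) j) - \<eta> (Pos (shift N 1 (-1) x) j))))"
    by (rule sum.cong[OF refl], rule arg_cong[where f="(*) (- (\<alpha>/2))"]) (rule *)
  finally show ?thesis by (simp add: sum_distrib_left algebra_simps)
qed

lemma total_current_polys [simp]: "total_current d N \<alpha> \<in> polys A"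
proof -
  have "(\<lambda>\<eta>. \<Sum>j=1..d. \<Sum>x\<in>S. \<eta> (Mom x j) * (- (\<alpha>/2) * (\<eta> (Pos (shift N 1 1 x) j) - \<eta> (Pos (shift N 1 (-1) x) j)))) \<in> polys A"
    using d by (intro polys_intros Pos_in_coords Mom_in_coords shift_in_sites N_pos) auto
  then show ?thesis by (simp add: total_current_eq[abs_def])
qed

lemma JJ_double_sum: "JJ k \<eta> = (\<Sum>j=1..d. \<Sum>x\<in>S. \<Sum>y\<in>S. \<eta> (Mom x j) * \<eta> (Pos y j) * sin (phase d N k y - phase d N k x))"
  unfolding JJ_def
proof (intro sum.cong refl)
  fix j
  have "cp k j \<eta> * sq k j \<eta> - sp k j \<eta> * cq k j \<eta>
     = (\<Sum>x\<in>S. \<Sum>y\<in>S. cosf k x * \<eta> (Mom x j) * (sinf k y * \<eta> (Pos y j)) - sinf k x * \<eta> (Mom x j) * (cosf k y * \<eta> (Pos y j)))"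
    unfolding lin_def sum_product sum_subtractf ..
  also have "\<dots> = (\<Sum>x\<in>S. \<Sum>y\<in>S. \<eta> (Mom x j) * \<eta> (Pos y j) * sin (phase d N k y - phase d N k x))"
    by (simp add: sin_diff algebra_simps)
  finally show "cp k j \<eta> * sq k j \<eta> - sp k j \<eta> * cq k j \<eta> = \<dots>" .
qed

text \<open>Fourier inversion: the current has an antisymmetric translation-invariant kernel, hence
  is a combination of the sine kernels of \<open>JJ_double_sum\<close>.\<close>

lemma total_current_modes:
  "total_current d N \<alpha> \<eta> = - \<alpha> / real (N ^ d) * (\<Sum>k\<in>S. sin (freq N k 1) * JJ k \<eta>)"
proof -
  have i: "(1::nat) \<in> {1..d}" using d by simp
  have pos: "real (N ^ d) > 0" using N by simp
  have "(\<Sum>k\<in>S. sin (freq N k 1) * JJ k \<eta>)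
     = (\<Sum>k\<in>S. \<Sum>j=1..d. \<Sum>x\<in>S. \<Sum>y\<in>S. \<eta> (Mom x j) * \<eta> (Pos y j) * (sin (freq N k 1) * sin (phase d N k y - phase d N k x)))"
    unfolding JJ_double_sum sum_distrib_left by (simp add: algebra_simps)
  also have "\<dots> = (\<Sum>j=1..d. \<Sum>x\<in>S. \<Sum>y\<in>S. \<Sum>k\<in>S. \<eta> (Mom x j) * \<eta> (Pos y j) * (sin (freq N k 1) * sin (phase d N k y - phase d N k x)))"
    by (rule trans[OF sum.swap], rule sum.cong[OF refl], rule trans[OF sum.swap], rule sum.cong[OF refl], rule sum.swap)
  also have "\<dots> = (\<Sum>j=1..d. \<Sum>x\<in>S. \<Sum>y\<in>S. \<eta> (Mom x j) * \<eta> (Pos y j) *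
      (real (N ^ d) / 2 * (of_bool (y = shift N 1 1 x) - of_bool (y = shift N 1 (-1) x))))"
    unfolding sum_distrib_left[symmetric]
    by (intro sum.cong refl arg_cong2[where f="(*)"] sum_freq_sin_phase[OF _ _ i N_pos])
  also have "\<dots> = (\<Sum>j=1..d. \<Sum>x\<in>S. real (N ^ d) / 2 * (\<eta> (Mom x j) * (\<eta> (Pos (shift N 1 1 x) j) - \<eta> (Pos (shift N 1 (-1) x) j))))"
  proof (intro sum.cong refl)
    fix j x assume x: "x \<in> S"
    have sh: "shift N 1 1 x \<in> S" "shift N 1 (-1) x \<in> S" using shift_in_sites[OF x i N_pos] by auto
    have *: "(\<Sum>y\<in>S. \<eta> (Pos y j) * of_bool (y = z)) = \<eta> (Pos z j)" if "z \<in> S" for z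
    proof -
      have "(\<Sum>y\<in>S. \<eta> (Pos y j) * of_bool (y = z)) = (\<Sum>y\<in>S. if y = z then \<eta> (Pos z j) else 0)"
        by (intro sum.cong) auto
      then show ?thesis using that by simp
    qed
    have "(\<Sum>y\<in>S. \<eta> (Mom x j) * \<eta> (Pos y j) * (real (N ^ d) / 2 * (of_bool (y = shift N 1 1 x) - of_bool (y = shift N 1 (-1) x))))
      = real (N ^ d) / 2 * (\<eta> (Mom x j) * ((\<Sum>y\<in>S. \<eta> (Pos y j) * of_bool (y = shift N 1 1 x)) - (\<Sum>y\<in>S. \<eta> (Pos y j) * of_bool (y = shift N 1 (-1) x))))"
      unfolding sum_subtractf[symmetric] sum_distrib_left by (intro sum.cong refl) (simp add: algebra_simps)
    then show "(\<Sum>y\<in>S. \<eta> (Mom x j) * \<eta> (Pos y j) * (real (N ^ d) / 2 * (of_bool (y = shift N 1 1 x) - of_bool (y = shift N 1 (-1) x))))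
      = real (N ^ d) / 2 * (\<eta> (Mom x j) * (\<eta> (Pos (shift N 1 1 x) j) - \<eta> (Pos (shift N 1 (-1) x) j)))"
      unfolding *[OF sh(1)] *[OF sh(2)] .
  qed
  finally have eq: "(\<Sum>k\<in>S. sin (freq N k 1) * JJ k \<eta>)
      = (\<Sum>j=1..d. \<Sum>x\<in>S. real (N ^ d) / 2 * (\<eta> (Mom x j) * (\<eta> (Pos (shift N 1 1 x) j) - \<eta> (Pos (shift N 1 (-1) x) j))))" .
  have "- \<alpha> / m * (m / 2 * u) = - (\<alpha>/2) * u" if "m > 0" for m u :: real
    using that by simp
  note cancel = this[OF pos]
  show ?thesis
    unfolding eq total_current_eq sum_distrib_left cancel by (intro sum.cong refl) (simp add: algebra_simps)
qed

end

text \<open>A crude bound that is linear in \<open>K\<close> and so keeps square roots out of the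
  estimates below.\<close>

lemma abs_le_of_square_le:
  fixes y :: real
  assumes "y\<^sup>2 \<le> K"
  shows "\<bar>y\<bar> \<le> K + 1"
proof -
  have "0 \<le> (\<bar>y\<bar> - 1/2)\<^sup>2" by simp
  also have "(\<bar>y\<bar> - 1/2)\<^sup>2 = y\<^sup>2 - \<bar>y\<bar> + 1/4" by (simp add: power2_diff) (simp add: power2_eq_square)
  finally show ?thesis using assms by linarith
qed

lemma shift_neq:
  assumes "x \<in> sites d N" "i \<in> {1..d}" "s \<in> {-1,1}" "N \<ge> 3"
  shows "shift N i s x \<noteq> x"
proof
  assume "shift N i s x = x"
  then have "shift N i s (shift N i s x) = x" by simp
  then have "shift N i s x = shift N i (-s) x"
    by (metis assms(1,2) shift_shift shift_0 add.right_inverse add.commute)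
  then show False using shift_eq_iff[OF assms(1,2,2), of s "- s"] assms(3,4) by auto
qed

context chain
begin

section \<open>Compactness of the energy shells\<close>

lemma H_bounds:
  assumes "x \<in> S" "j \<in> {1..d}"
  shows "(\<eta> (Mom x j))\<^sup>2 \<le> 2 * H \<eta>" "\<nu> * (\<eta> (Pos x j))\<^sup>2 \<le> 2 * H \<eta>"
    "i \<in> {1..d} \<Longrightarrow> \<alpha> * (\<eta> (Pos (shift N i 1 x) j) - \<eta> (Pos x j))\<^sup>2 \<le> 2 * H \<eta>" "0 \<le> H \<eta>"
proof -
  define b where "b x j i = (\<eta> (Pos (shift N i 1 x) j) - \<eta> (Pos x j))\<^sup>2" for x j i
  define h where "h j x = 1/2 * (\<eta> (Mom x j))\<^sup>2 + \<nu>/2 * (\<eta> (Pos x j))\<^sup>2 + \<alpha>/2 * (\<Sum>i=1..d. b x j i)" for x j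
  have b0: "b x j i \<ge> 0" for x j i by (simp add: b_def)
  have h0: "h j x \<ge> 0" for x j unfolding h_def using \<nu> \<alpha> by (intro add_nonneg_nonneg mult_nonneg_nonneg sum_nonneg b0) auto
  have H: "H \<eta> = (\<Sum>j=1..d. \<Sum>x\<in>S. h j x)" unfolding hamiltonian_bonds h_def b_def ..
  have "h j x \<le> (\<Sum>x\<in>S. h j x)" using assms h0 by (intro member_le_sum) auto
  also have "\<dots> \<le> H \<eta>" unfolding H using assms h0
    by (intro member_le_sum[of j "{1..d}" "\<lambda>j. \<Sum>x\<in>S. h j x"]) (auto intro: sum_nonneg)
  finally have hH: "h j x \<le> H \<eta>" .
  show "0 \<le> H \<eta>" using h0[of j x] hH by linarith
  have nn: "\<nu>/2 * (\<eta> (Pos x j))\<^sup>2 \<ge> 0" "\<alpha>/2 * (\<Sum>i=1..d. b x j i) \<ge> 0" "1/2 * (\<eta> (Mom x j))\<^sup>2 \<ge> 0"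
    using \<nu> \<alpha> b0 by (auto intro!: mult_nonneg_nonneg sum_nonneg)
  show "(\<eta> (Mom x j))\<^sup>2 \<le> 2 * H \<eta>" "\<nu> * (\<eta> (Pos x j))\<^sup>2 \<le> 2 * H \<eta>"
    using nn hH unfolding h_def by linarith+
  show "\<alpha> * (\<eta> (Pos (shift N i 1 x) j) - \<eta> (Pos x j))\<^sup>2 \<le> 2 * H \<eta>" if "i \<in> {1..d}"
  proof -
    have "b x j i \<le> (\<Sum>i=1..d. b x j i)" using that b0 by (intro member_le_sum) auto
    then have "\<alpha>/2 * b x j i \<le> \<alpha>/2 * (\<Sum>i=1..d. b x j i)" using \<alpha> by simp
    then have "\<alpha>/2 * b x j i \<le> H \<eta>" using nn hH unfolding h_def by linarith
    then show ?thesis by (simp add: b_def)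
  qed
qed

text \<open>Lowering a positive coordinate by one walks from \<open>x\<close> to the origin in
  \<open>n\<close> steps without ever wrapping around; each step costs at most
  \<open>m\<close>.\<close>

lemma Pos_diff_bound:
  assumes step: "\<And>x i. x \<in> S \<Longrightarrow> i \<in> {1..d} \<Longrightarrow> \<bar>q (shift N i 1 x) - q x\<bar> \<le> (m::real)"
    and x: "x \<in> S" "(\<Sum>i=1..d. x i) = int n"
  shows "\<bar>q x - q (\<lambda>i\<in>{1..d}. 0)\<bar> \<le> m * real n"
  using x
proof (induction n arbitrary: x)
  case 0
  have "x i = 0" if "i \<in> {1..d}" for i
    using 0 that sum_nonneg_eq_0_iff[of "{1..d}" x] by (auto simp: sites_def PiE_iff)
  then have "x = (\<lambda>i\<in>{1..d}. 0)" using 0(1) by (auto simp: sites_def PiE_iff extensional_def fun_eq_iff)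
  then show ?case by simp
next
  case (Suc n)
  have "\<exists>i\<in>{1..d}. x i > 0"
  proof (rule ccontr)
    assume "\<not> ?thesis"
    then have "(\<Sum>i=1..d. x i) \<le> 0" by (intro sum_nonpos) force
    then show False using Suc.prems by simp
  qed
  then obtain i where i: "i \<in> {1..d}" "x i > 0" by blast
  let ?y = "shift N i (-1) x"
  have y: "?y \<in> S" by (rule shift_in_sites[OF Suc.prems(1) i(1) N_pos])
  have "x i < int N" using Suc.prems(1) i(1) by (auto simp: sites_def PiE_iff)
  then have yi: "?y i = x i - 1" using i(2) by (simp add: shift_def)
  have "(\<Sum>j=1..d. ?y j) = (\<Sum>j=1..d. x j - (if j = i then 1 else 0))"
    using yi by (intro sum.cong refl) (auto simp: shift_def)
  also have "\<dots> = (\<Sum>j=1..d. x j) - 1" using i(1) by (simp add: sum_subtractf)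
  finally have "(\<Sum>j=1..d. ?y j) = int n" using Suc.prems(2) by simp
  then have "\<bar>q ?y - q (\<lambda>i\<in>{1..d}. 0)\<bar> \<le> m * real n" by (rule Suc.IH[OF y])
  moreover have "\<bar>q x - q ?y\<bar> \<le> m"
    using step[OF y i(1)] by (simp add: shift_shift shift_0[OF Suc.prems(1) i(1)])
  ultimately show ?case unfolding of_nat_Suc distrib_left mult_1_right by linarith
qed

text \<open>With pinning the energy bounds every coordinate. Without pinning it bounds only
  differences of positions, and a bound on the total position is needed to exclude
  translations.\<close>

lemma coercive:
  "\<exists>R. \<forall>\<eta>. H \<eta> \<le> e \<longrightarrow> (\<nu> = 0 \<longrightarrow> (\<forall>j\<in>{1..d}. \<bar>Q j \<eta>\<bar> \<le> 1)) \<longrightarrow> (\<forall>c\<in>A. \<bar>\<eta> c\<bar> \<le> R)"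
proof -
  define R1 where "R1 = 2 * e + 1"
  define m where "m = 2 * e / \<alpha> + 1"
  \<comment> \<open>Without pinning, 1 plus one path length bounds the position at the origin, and a
    second path leads to an arbitrary site.\<close>
  define R2 where "R2 = (if \<nu> = 0 then 1 + 2 * (m * real (d * N)) else 2 * e / \<nu> + 1)"
  have "\<bar>\<eta> c\<bar> \<le> max R1 R2"
    if H: "H \<eta> \<le> e" and Q: "\<nu> = 0 \<Longrightarrow> \<forall>j\<in>{1..d}. \<bar>Q j \<eta>\<bar> \<le> 1" and c: "c \<in> A" for \<eta> c
  proof -
    have Mom: "\<bar>\<eta> (Mom x j)\<bar> \<le> R1" if "x \<in> S" "j \<in> {1..d}" for x j
      unfolding R1_def using H_bounds(1)[OF that, of \<eta>] H by (intro abs_le_of_square_le) simp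
    have Pos: "\<bar>\<eta> (Pos x j)\<bar> \<le> R2" if x: "x \<in> S" and j: "j \<in> {1..d}" for x j
    proof (cases "\<nu> = 0")
      case False
      then have "\<nu> > 0" using \<nu> by simp
      then show ?thesis unfolding R2_def using H_bounds(2)[OF x j, of \<eta>] H False
        by (simp only: if_False) (intro abs_le_of_square_le, simp add: field_simps)
    next
      case True
      let ?q = "\<lambda>x. \<eta> (Pos x j)" and ?o = "\<lambda>i\<in>{1..d}. 0::int"
      have step: "\<bar>?q (shift N i 1 y) - ?q y\<bar> \<le> m" if "y \<in> S" "i \<in> {1..d}" for y i
        unfolding m_def using H_bounds(3)[OF that(1) j that(2), of \<eta>] H \<alpha>
        by (intro abs_le_of_square_le) (simp add: field_simps)
      have o: "?o \<in> S" using N_pos by (auto simp: sites_def)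
      have "0 \<le> \<bar>?q (shift N 1 1 x) - ?q x\<bar>" by simp
      also have "\<dots> \<le> m" using step[OF x, of 1] d by simp
      finally have m0: "0 \<le> m" .
      have diff: "\<bar>?q y - ?q ?o\<bar> \<le> m * real (d * N)" if y: "y \<in> S" for y
      proof -
        have y0: "0 \<le> y i" "y i \<le> int N" if "i \<in> {1..d}" for i using y that by (auto simp: sites_def PiE_iff less_imp_le)
        have s0: "0 \<le> (\<Sum>i=1..d. y i)" using y0 by (intro sum_nonneg) auto
        have "(\<Sum>i=1..d. y i) \<le> (\<Sum>i=1..d. int N)" using y0 by (intro sum_mono) auto
        then have "nat (\<Sum>i=1..d. y i) \<le> d * N" by (simp add: nat_le_iff)
        then have "m * real (nat (\<Sum>i=1..d. y i)) \<le> m * real (d * N)" using m0 by (intro mult_left_mono) (simp_all del: of_nat_mult)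
        moreover have "\<bar>?q y - ?q ?o\<bar> \<le> m * real (nat (\<Sum>i=1..d. y i))"
          using s0 by (intro Pos_diff_bound[OF step y]) simp_all
        ultimately show ?thesis by linarith
      qed
      \<comment> \<open>The position at the origin is the mean position minus the mean difference to
        the other sites, and both are under control.\<close>
      have "real (N ^ d) * ?q ?o = Q j \<eta> - (\<Sum>y\<in>S. ?q y - ?q ?o)"
        by (simp add: lin_def sum_subtractf card_sites)
      moreover have "\<bar>\<Sum>y\<in>S. ?q y - ?q ?o\<bar> \<le> (\<Sum>y\<in>S. m * real (d * N))"
        by (rule order_trans[OF sum_abs]) (intro sum_mono diff)
      moreover have "\<bar>Q j \<eta>\<bar> \<le> 1" using Q True j by blast
      moreover have N1: "1 \<le> real (N ^ d)" using N_pos by (simp add: Suc_leI)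
      ultimately have "\<bar>real (N ^ d) * ?q ?o\<bar> \<le> real (N ^ d) * (1 + m * real (d * N))"
        by (simp add: card_sites algebra_simps)
      then have "\<bar>?q ?o\<bar> \<le> 1 + m * real (d * N)"
        unfolding abs_mult using N1 mult_le_cancel_left_pos[of "real (N ^ d)" "\<bar>?q ?o\<bar>"] by (simp only: abs_of_nat)
      then show ?thesis using diff[OF x] True by (simp add: R2_def)
    qed
    from c consider x j where "c = Pos x j" "x \<in> S" "j \<in> {1..d}" | x j where "c = Mom x j" "x \<in> S" "j \<in> {1..d}"
      by (auto simp: coords_def)
    then show ?thesis by cases (use Pos Mom in \<open>fastforce simp: max_def\<close>)+
  qed
  then show ?thesis by blast
qed

section \<open>The noise and the generator\<close>

text \<open>The two formulas reflect the two noises. For \<open>d \<ge> 2\<close> the constant 8 is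
  16 (d - 1) from \<open>noise_JJ\<close> divided by the normalisation 2 (d - 1); for
  \<open>d = 1\<close> the two frequencies come from nearest and next-nearest neighbours.\<close>

definition psi :: "site \<Rightarrow> real" where
  "psi k = (if d = 1 then 1/3 * (4 * (sin (freq N k 1 / 2))\<^sup>2 + 2 * (sin (freq N k 1))\<^sup>2)
            else 8 * (\<Sum>i=1..d. (sin (freq N k i / 2))\<^sup>2))"

lemma derivation_X: "derivation (X_op i j x z)"
  unfolding X_op_def[abs_def] by (intro derivation_diff derivation_cmult derivation_pd)

lemma derivation_Y: "derivation (Y_op N x)"
  unfolding Y_op_def[abs_def] Let_def by (intro derivation_add derivation_cmult derivation_pd)

lemma Ck_X: "Ck (Suc n) f \<Longrightarrow> Ck n (X_op i j x z f)"
  unfolding X_op_def[abs_def] by (simp add: Ck_pd)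

lemma Ck_Y: "Ck (Suc n) f \<Longrightarrow> Ck n (Y_op N x f)"
  unfolding Y_op_def[abs_def] Let_def by (simp add: Ck_pd)

lemma pd_Mom_lin_Pos: "pd (Mom x i) (lin d N a (\<lambda>x. Pos x j)) = (\<lambda>_. 0)"
  by (simp add: deriv_lin[OF derivation_pd])

lemma pd_Mom_lin_Mom: "x \<in> S \<Longrightarrow> pd (Mom x i) (lin d N a (\<lambda>x. Mom x j)) = (\<lambda>_. if j = i then a x else 0)"
  by (auto simp: deriv_lin[OF derivation_pd] if_distrib cong: if_cong)

lemma pd_Mom_H: "x \<in> S \<Longrightarrow> j \<in> {1..d} \<Longrightarrow> pd (Mom x j) H = (\<lambda>\<eta>. \<eta> (Mom x j))"
proof
  fix \<eta> :: config assume *: "x \<in> S" "j \<in> {1..d}"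
  have "pd (Mom x j) H \<eta> = (\<Sum>i=1..d. \<Sum>y\<in>S. if y = x \<and> i = j then \<eta> (Mom x j) else 0)"
    unfolding deriv_H[OF derivation_pd] by (intro sum.cong refl) auto
  also have "\<dots> = (\<Sum>i=1..d. if i = j then \<eta> (Mom x j) else 0)"
    using * by (intro sum.cong refl) auto
  also have "\<dots> = \<eta> (Mom x j)" using * by simp
  finally show "pd (Mom x j) H \<eta> = \<eta> (Mom x j)" .
qed

text \<open>The field rotates the relative momentum of the two sites in the plane of components
  \<open>i\<close> and \<open>j\<close>: the sum of the two momenta and the kinetic energy stay
  fixed, and positions do not move.\<close>

lemma X_conserved:
  assumes "x \<in> S" "z \<in> S" "i \<in> {1..d}" "j \<in> {1..d}"
  shows "X_op i j x z H = (\<lambda>_. 0)" "X_op i j x z (P l) = (\<lambda>_. 0)" "X_op i j x z (Q l) = (\<lambda>_. 0)"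
  using assms by (auto simp: X_op_def[abs_def] pd_Mom_H pd_Mom_lin_Pos pd_Mom_lin_Mom)

text \<open>Here three neighbouring momenta rotate about the diagonal direction, which preserves
  their sum and the sum of their squares.\<close>

lemma Y_conserved:
  assumes "x \<in> S" "d = 1"
  shows "Y_op N x H = (\<lambda>_. 0)" "Y_op N x (P l) = (\<lambda>_. 0)" "Y_op N x (Q l) = (\<lambda>_. 0)"
proof -
  have i: "1 \<in> {1..d}" using assms by simp
  note s = shift_in_sites[OF assms(1) i N_pos]
  note m = pd_Mom_H[OF assms(1) i] pd_Mom_H[OF s i] pd_Mom_lin_Pos pd_Mom_lin_Mom[OF assms(1)] pd_Mom_lin_Mom[OF s]
  show "Y_op N x H = (\<lambda>_. 0)" "Y_op N x (P l) = (\<lambda>_. 0)" "Y_op N x (Q l) = (\<lambda>_. 0)"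
    by (simp_all only: fun_eq_iff Y_op_def Let_def m) (auto simp: algebra_simps)
qed

text \<open>The coefficient of the momentum at \<open>x\<close> in \<open>JJ k\<close>, that is, the
  sum over \<open>y\<close> of the sine of the phase difference times the position at
  \<open>y\<close>. It contains no momenta, so the noise treats it as a constant.\<close>

definition amp :: "site \<Rightarrow> site \<Rightarrow> nat \<Rightarrow> config \<Rightarrow> real" where
  "amp k x j \<eta> = cosf k x * sq k j \<eta> - sinf k x * cq k j \<eta>"

lemma Ck_amp [simp]: "Ck n (amp k x j)"
  unfolding amp_def[abs_def] by simp

lemma JJ_amp: "JJ k \<eta> = (\<Sum>j=1..d. \<Sum>x\<in>S. amp k x j \<eta> * \<eta> (Mom x j))"
  unfolding JJ_def amp_def
proof (intro sum.cong refl)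
  fix j
  have "cp k j \<eta> * sq k j \<eta> - sp k j \<eta> * cq k j \<eta>
     = (\<Sum>x\<in>S. cosf k x * \<eta> (Mom x j) * sq k j \<eta> - sinf k x * \<eta> (Mom x j) * cq k j \<eta>)"
    by (simp add: lin_def[of _ _ _ "\<lambda>x. Mom x j"] sum_distrib_right sum_subtractf)
  then show "cp k j \<eta> * sq k j \<eta> - sp k j \<eta> * cq k j \<eta> = (\<Sum>x\<in>S. (cosf k x * sq k j \<eta> - sinf k x * cq k j \<eta>) * \<eta> (Mom x j))"
    by (simp add: algebra_simps)
qed

lemma pd_JJ:
  assumes "x \<in> S" "i \<in> {1..d}"
  shows "pd (Mom x i) (JJ k) = amp k x i"
proof
  fix \<eta>
  have "pd (Mom x i) (JJ k) \<eta>
    = (\<Sum>j=1..d. (if j = i then cosf k x else 0) * sq k j \<eta> - (if j = i then sinf k x else 0) * cq k j \<eta>)"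
    unfolding JJ_def[abs_def] using assms(1)
    by (simp add: deriv_simps[OF derivation_pd] pd_Mom_lin_Pos pd_Mom_lin_Mom)
  also have "\<dots> = (\<Sum>j=1..d. if j = i then amp k x i \<eta> else 0)"
    by (intro sum.cong refl) (simp add: amp_def)
  finally have "pd (Mom x i) (JJ k) \<eta> = (\<Sum>j=1..d. if j = i then amp k x i \<eta> else 0)" .
  then show "pd (Mom x i) (JJ k) \<eta> = amp k x i \<eta>" using assms(2) by simp
qed

lemma amp_harmonic:
  assumes "i \<in> {1..d}"
  shows "amp k (shift N i s x) j \<eta> + amp k (shift N i (- s) x) j \<eta> = 2 * cos (of_int s * freq N k i) * amp k x j \<eta>"
  unfolding amp_def cos_phase_shift[OF assms N_pos] sin_phase_shift[OF assms N_pos]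
  by (simp add: cos_add sin_add cos_diff sin_diff algebra_simps)

lemma pd_Mom_amp: "pd (Mom x i) (amp k y j) = (\<lambda>_. 0)"
  unfolding amp_def[abs_def] by (simp add: deriv_simps[OF derivation_pd] pd_Mom_lin_Pos)

lemma X_amp: "X_op i j x z (amp k y l) = (\<lambda>_. 0)"
  by (simp add: X_op_def[abs_def] pd_Mom_amp)

lemma Y_amp: "Y_op N x (amp k y l) = (\<lambda>_. 0)"
  by (simp add: Y_op_def[abs_def] pd_Mom_amp Let_def)

text \<open>Applied twice, the rotation multiplies the relative momentum by -4. The bond contributes
  half the product of the difference of amplitudes and the relative momentum, plus a part depending
  on the conserved sum; hence the factor -2.\<close>

lemma X_X_JJ:
  assumes "x \<in> S" "z \<in> S" "i \<in> {1..d}" "j \<in> {1..d}" "x \<noteq> z" "i \<noteq> j"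
  shows "X_op i j x z (X_op i j x z (JJ k)) \<eta>
    = - 2 * ((amp k z i \<eta> - amp k x i \<eta>) * (\<eta> (Mom z i) - \<eta> (Mom x i)) + (amp k z j \<eta> - amp k x j \<eta>) * (\<eta> (Mom z j) - \<eta> (Mom x j)))"
proof -
  have "X_op i j x z (JJ k) = (\<lambda>\<eta>. (\<eta> (Mom z j) - \<eta> (Mom x j)) * (amp k z i \<eta> - amp k x i \<eta>)
      - (\<eta> (Mom z i) - \<eta> (Mom x i)) * (amp k z j \<eta> - amp k x j \<eta>))"
    using assms by (simp add: X_op_def[abs_def] pd_JJ)
  moreover have "X_op i j x z (\<lambda>\<eta>. \<eta> (Mom z j)) \<eta> = - (\<eta> (Mom z i) - \<eta> (Mom x i))"
    "X_op i j x z (\<lambda>\<eta>. \<eta> (Mom x j)) \<eta> = \<eta> (Mom z i) - \<eta> (Mom x i)"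
    "X_op i j x z (\<lambda>\<eta>. \<eta> (Mom z i)) \<eta> = \<eta> (Mom z j) - \<eta> (Mom x j)"
    "X_op i j x z (\<lambda>\<eta>. \<eta> (Mom x i)) \<eta> = - (\<eta> (Mom z j) - \<eta> (Mom x j))"
    using assms by (auto simp: X_op_def)
  ultimately show ?thesis
    by (simp add: deriv_simps[OF derivation_X] X_amp) (simp add: algebra_simps)
qed

lemma X_diag: "X_op i i x z f = (\<lambda>_. 0)"
  by (simp add: X_op_def[abs_def])

lemma sum_amp_by_parts:
  assumes "l \<in> {1..d}"
  shows "(\<Sum>x\<in>S. (amp k (shift N l 1 x) i \<eta> - amp k x i \<eta>) * (\<eta> (Mom (shift N l 1 x) i) - \<eta> (Mom x i)))
    = 4 * (sin (freq N k l / 2))\<^sup>2 * (\<Sum>x\<in>S. amp k x i \<eta> * \<eta> (Mom x i))"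
proof -
  have c: "1 - cos (freq N k l) = 2 * (sin (freq N k l / 2))\<^sup>2"
    using cos_double_sin[of "freq N k l / 2"] by simp
  have "2 * amp k x i \<eta> - amp k (shift N l 1 x) i \<eta> - amp k (shift N l (-1) x) i \<eta> = 2 * (1 - cos (freq N k l)) * amp k x i \<eta>" for x
    using amp_harmonic[OF assms, of k 1 x i \<eta>] by (simp add: algebra_simps)
  then have "(\<Sum>x\<in>S. (2 * amp k x i \<eta> - amp k (shift N l 1 x) i \<eta> - amp k (shift N l (-1) x) i \<eta>) * \<eta> (Mom x i))
    = 4 * (sin (freq N k l / 2))\<^sup>2 * (\<Sum>x\<in>S. amp k x i \<eta> * \<eta> (Mom x i))"
    unfolding c sum_distrib_left by (intro sum.cong refl) simp
  then show ?thesis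
    by (rule trans[OF sum_by_parts[OF assms, where f = "\<lambda>x. amp k x i \<eta>" and g = "\<lambda>x. \<eta> (Mom x i)"]])
qed

text \<open>Every \<open>T i\<close> occurs in 2 (d - 1) ordered pairs of distinct indices; this
  factor cancels the normalisation of the noise.\<close>

lemma sum_offdiag:
  fixes T :: "nat \<Rightarrow> real"
  shows "(\<Sum>i=1..d. \<Sum>j=1..d. if i = j then 0 else T i + T j) = 2 * (real d - 1) * (\<Sum>i=1..d. T i)"
proof -
  have "(\<Sum>i=1..d. \<Sum>j=1..d. if i = j then 0 else T i + T j) = (\<Sum>i=1..d. \<Sum>j=1..d. (T i + T j) - (if j = i then 2 * T i else 0))"
    by (intro sum.cong refl) auto
  also have "\<dots> = (\<Sum>i=1..d. real d * T i + (\<Sum>j=1..d. T j) - 2 * T i)"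
    by (intro sum.cong refl) (simp add: sum_subtractf sum.distrib)
  also have "\<dots> = 2 * (real d - 1) * (\<Sum>i=1..d. T i)"
    unfolding sum_subtractf sum.distrib sum_distrib_left[symmetric] by (simp add: algebra_simps)
  finally show ?thesis .
qed

text \<open>\<open>JJ k\<close> is linear in the momenta and the squared noise fields act on momenta
  as finite differences. These move to the amplitudes, which are eigenfunctions of the lattice
  shifts in the sense of \<open>amp_harmonic\<close>.\<close>

lemma noise_JJ: "noise_op d N (JJ k) \<eta> = - psi k * JJ k \<eta>"
proof (cases "d = 1")
  case False
  define T where "T x l i = (amp k (shift N l 1 x) i \<eta> - amp k x i \<eta>) * (\<eta> (Mom (shift N l 1 x) i) - \<eta> (Mom x i))" for x l i
  have d1: "real d - 1 > 0" using d False by simp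
  have XX: "X_op i j x (shift N l 1 x) (X_op i j x (shift N l 1 x) (JJ k)) \<eta> = - 2 * (if i = j then 0 else T x l i + T x l j)"
    if "x \<in> S" "i \<in> {1..d}" "j \<in> {1..d}" "l \<in> {1..d}" for x i j l
  proof (cases "i = j")
    case True then show ?thesis by (simp add: X_diag)
  next
    case False
    have "shift N l 1 x \<noteq> x" using shift_neq[OF that(1,4) _ N, of 1] by simp
    with False that show ?thesis
      by (subst X_X_JJ) (auto intro: shift_in_sites N_pos simp: T_def)
  qed
  have "(\<Sum>x\<in>S. \<Sum>i=1..d. \<Sum>j=1..d. \<Sum>l=1..d. X_op i j x (shift N l 1 x) (X_op i j x (shift N l 1 x) (JJ k)) \<eta>)
    = (\<Sum>x\<in>S. \<Sum>i=1..d. \<Sum>j=1..d. \<Sum>l=1..d. - 2 * (if i = j then 0 else T x l i + T x l j))"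
    by (intro sum.cong refl XX)
  also have "\<dots> = (\<Sum>x\<in>S. \<Sum>l=1..d. - 2 * (\<Sum>i=1..d. \<Sum>j=1..d. if i = j then 0 else T x l i + T x l j))"
  proof (rule sum.cong[OF refl])
    fix x
    have "(\<Sum>i=1..d. \<Sum>j=1..d. \<Sum>l=1..d. - 2 * (if i = j then 0 else T x l i + T x l j))
      = (\<Sum>i=1..d. \<Sum>l=1..d. \<Sum>j=1..d. - 2 * (if i = j then 0 else T x l i + T x l j))"
      by (rule sum.cong[OF refl]) (rule sum.swap)
    also have "\<dots> = (\<Sum>l=1..d. \<Sum>i=1..d. \<Sum>j=1..d. - 2 * (if i = j then 0 else T x l i + T x l j))"
      by (rule sum.swap)
    finally show "(\<Sum>i=1..d. \<Sum>j=1..d. \<Sum>l=1..d. - 2 * (if i = j then 0 else T x l i + T x l j))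
      = (\<Sum>l=1..d. - 2 * (\<Sum>i=1..d. \<Sum>j=1..d. if i = j then 0 else T x l i + T x l j))"
      by (simp only: sum_distrib_left)
  qed
  also have "\<dots> = (\<Sum>x\<in>S. \<Sum>l=1..d. \<Sum>i=1..d. - 4 * (real d - 1) * T x l i)"
    unfolding sum_offdiag sum_distrib_left by (intro sum.cong refl) (simp add: algebra_simps)
  also have "\<dots> = (\<Sum>l=1..d. \<Sum>i=1..d. \<Sum>x\<in>S. - 4 * (real d - 1) * T x l i)"
    by (rule trans[OF sum.swap], rule sum.cong[OF refl], rule sum.swap)
  also have "\<dots> = (\<Sum>l=1..d. \<Sum>i=1..d. - 4 * (real d - 1) * (\<Sum>x\<in>S. T x l i))"
    by (simp only: sum_distrib_left)
  also have "\<dots> = (\<Sum>l=1..d. \<Sum>i=1..d. - 4 * (real d - 1) * (4 * (sin (freq N k l / 2))\<^sup>2 * (\<Sum>x\<in>S. amp k x i \<eta> * \<eta> (Mom x i))))"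
    by (intro sum.cong refl arg_cong[where f="(*) (- 4 * (real d - 1))"]) (unfold T_def, rule sum_amp_by_parts)
  also have "\<dots> = - 16 * (real d - 1) * ((\<Sum>l=1..d. (sin (freq N k l / 2))\<^sup>2) * JJ k \<eta>)"
    unfolding JJ_amp sum_product by (simp add: sum_distrib_left algebra_simps)
  finally have eq: "(\<Sum>x\<in>S. \<Sum>i=1..d. \<Sum>j=1..d. \<Sum>l=1..d. X_op i j x (shift N l 1 x) (X_op i j x (shift N l 1 x) (JJ k)) \<eta>)
    = - 16 * (real d - 1) * ((\<Sum>l=1..d. (sin (freq N k l / 2))\<^sup>2) * JJ k \<eta>)" .
  show ?thesis
    using d1 False unfolding noise_op_def eq psi_def by (simp add: field_simps)
next
  case True
  have i: "(1::nat) \<in> {1..d}" using True by simp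
  let ?p = "\<lambda>x. \<eta> (Mom x 1)" and ?a = "\<lambda>x. amp k x 1 \<eta>" and ?s = "\<lambda>m x. shift N 1 m x"
  \<comment> \<open>On the three momenta involved, the square of the rotation is the matrix with -2
    on the diagonal and 1 elsewhere.\<close>
  have YY: "Y_op N x (Y_op N x (JJ k)) \<eta>
     = (?p (?s 1 x) + ?p x - 2 * ?p (?s (-1) x)) * ?a (?s (-1) x) + (?p (?s (-1) x) + ?p (?s 1 x) - 2 * ?p x) * ?a x
      + (?p x + ?p (?s (-1) x) - 2 * ?p (?s 1 x)) * ?a (?s 1 x)" if x: "x \<in> S" for x
  proof -
    let ?l = "?s (-1) x" and ?r = "?s 1 x"
    have lr: "?l \<in> S" "?r \<in> S" using shift_in_sites[OF x i N_pos] by auto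
    have ne: "?l \<noteq> x" "?r \<noteq> x" "?l \<noteq> ?r"
      using shift_neq[OF x i _ N] shift_eq_iff[OF x i i _ _ N, of "-1" 1] by auto
    have "Y_op N x (JJ k) = (\<lambda>\<eta>. (\<eta> (Mom x 1) - \<eta> (Mom ?r 1)) * amp k ?l 1 \<eta> + (\<eta> (Mom ?r 1) - \<eta> (Mom ?l 1)) * amp k x 1 \<eta>
        + (\<eta> (Mom ?l 1) - \<eta> (Mom x 1)) * amp k ?r 1 \<eta>)"
      using x lr i by (simp add: Y_op_def[abs_def] pd_JJ Let_def)
    moreover have "Y_op N x (\<lambda>\<eta>. \<eta> (Mom ?l 1)) \<eta> = ?p x - ?p ?r"
      "Y_op N x (\<lambda>\<eta>. \<eta> (Mom x 1)) \<eta> = ?p ?r - ?p ?l"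
      "Y_op N x (\<lambda>\<eta>. \<eta> (Mom ?r 1)) \<eta> = ?p ?l - ?p x"
      using ne ne[symmetric] by (simp_all add: Y_op_def Let_def)
    ultimately show ?thesis
      by (simp add: deriv_simps[OF derivation_Y] Y_amp)
  qed
  \<comment> \<open>The correlation of momenta and amplitudes at lag \<open>s\<close>: by
    translation invariance all nine products depend only on the lag.\<close>
  define U where "U s = (\<Sum>x\<in>S. ?p (?s s x) * ?a x)" for s
  have cen: "(\<Sum>x\<in>S. ?p (?s s x) * ?a (?s t x)) = U (s - t)" for s t
  proof -
    have "(\<Sum>x\<in>S. ?p (?s s x) * ?a (?s t x)) = (\<Sum>x\<in>S. (\<lambda>y. ?p (?s (s - t) y) * ?a y) (?s t x))"
      by (simp add: shift_shift)
    also have "\<dots> = U (s - t)" unfolding U_def by (rule sum_shift[OF i N_pos])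
    finally show ?thesis .
  qed
  have cen0: "(\<Sum>x\<in>S. ?p x * ?a (?s t x)) = U (- t)" for t
  proof -
    have "(\<Sum>x\<in>S. ?p x * ?a (?s t x)) = (\<Sum>x\<in>S. ?p (?s 0 x) * ?a (?s t x))"
      by (intro sum.cong refl) (simp only: shift_0[OF _ i])
    then show ?thesis using cen[of 0 t] by simp
  qed
  have U0: "(\<Sum>x\<in>S. ?p x * ?a x) = U 0"
    unfolding U_def by (intro sum.cong refl) (simp only: shift_0[OF _ i])
  have "U s + U (- s) = 2 * cos (of_int s * freq N k 1) * U 0" for s
  proof -
    have "U s = (\<Sum>x\<in>S. ?p x * ?a (?s (- s) x))" "U (- s) = (\<Sum>x\<in>S. ?p x * ?a (?s s x))"
      using cen0[of s] cen0[of "- s"] by simp_all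
    then have "U s + U (- s) = (\<Sum>x\<in>S. ?p x * (?a (?s s x) + ?a (?s (- s) x)))"
      by (simp add: sum.distrib algebra_simps)
    also have "\<dots> = 2 * cos (of_int s * freq N k 1) * U 0"
      unfolding amp_harmonic[OF i] U0[symmetric] by (simp add: sum_distrib_left algebra_simps)
    finally show ?thesis .
  qed
  from this[of 1] this[of 2] have U: "U 1 + U (-1) = 2 * cos (freq N k 1) * U 0" "U 2 + U (-2) = 2 * cos (2 * freq N k 1) * U 0"
    by simp_all
  have "(\<Sum>x\<in>S. Y_op N x (Y_op N x (JJ k)) \<eta>)
    = (\<Sum>x\<in>S. ?p (?s 1 x) * ?a (?s (-1) x) + ?p x * ?a (?s (-1) x) - 2 * (?p (?s (-1) x) * ?a (?s (-1) x))
      + ?p (?s (-1) x) * ?a x + ?p (?s 1 x) * ?a x - 2 * (?p x * ?a x)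
      + ?p x * ?a (?s 1 x) + ?p (?s (-1) x) * ?a (?s 1 x) - 2 * (?p (?s 1 x) * ?a (?s 1 x)))"
    by (rule sum.cong[OF refl], subst YY) (simp_all add: algebra_simps)
  also have "\<dots> = U 2 + U 1 - 2 * U 0 + U (-1) + U 1 - 2 * U 0 + U (-1) + U (-2) - 2 * U 0"
    unfolding sum.distrib sum_subtractf sum_distrib_left[symmetric] cen cen0 U0 unfolding U_def[symmetric] by simp
  \<comment> \<open>Lags 1 and -1 occur twice each, lags 2 and -2 once each, and lag 0 six times
    with negative sign.\<close>
  also have "\<dots> = (2 * (2 * cos (freq N k 1)) + 2 * cos (2 * freq N k 1) - 6) * U 0"
    using U by (simp add: algebra_simps)
  also have "\<dots> = - 6 * psi k * U 0"
  proof -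
    have "psi k = 1/3 * (4 * (sin (freq N k 1 / 2))\<^sup>2 + 2 * (sin (freq N k 1))\<^sup>2)"
      unfolding psi_def by (rule if_P[OF True])
    moreover have "cos (freq N k 1) = 1 - 2 * (sin (freq N k 1 / 2))\<^sup>2"
      using cos_double_sin[of "freq N k 1 / 2"] by simp
    ultimately have "2 * (2 * cos (freq N k 1)) + 2 * cos (2 * freq N k 1) - 6 = - 6 * psi k"
      unfolding cos_double_sin by simp
    then show ?thesis by (simp only:)
  qed
  also have "U 0 = JJ k \<eta>"
    unfolding JJ_amp U0[symmetric] using True by (simp add: mult.commute)
  finally show ?thesis using True by (simp add: noise_op_def)
qed

end

context chain
begin

section \<open>Cut-off observables\<close>

text \<open>\<open>GG e\<close> vanishes exactly on the microcanonical surface; total momentum and position are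
  constrained only without pinning, which is what \<open>kap\<close> records. The total position is not conserved off
  the surface, but there the Liouville operator changes \<open>GG e\<close> at a rate bounded by \<open>GG e\<close> itself, so
  Gronwall's lemma still keeps the process on the surface.\<close>

definition kap :: real where
  "kap = (if \<nu> = 0 then 1 else 0)"

definition GG :: "real \<Rightarrow> config \<Rightarrow> real" where
  "GG e \<eta> = (H \<eta> - e)\<^sup>2 + kap * (\<Sum>j=1..d. (P j \<eta>)\<^sup>2 + (Q j \<eta>)\<^sup>2)"

text \<open>Its support lies in the bounded set where \<open>GG e\<close> is at most 1. It equals 1
  only on the surface, so the mean of \<open>1 - cut e\<close> detects any departure from the
  surface.\<close>

definition cut :: "real \<Rightarrow> config \<Rightarrow> real" where
  "cut e \<eta> = max 0 (1 - GG e \<eta>) ^ 3"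

lemma kap_nonneg: "kap \<ge> 0" by (simp add: kap_def)

lemma kap_nu: "kap * \<nu> = 0" by (simp add: kap_def)

lemma GG_nonneg: "GG e \<eta> \<ge> 0"
  unfolding GG_def by (intro add_nonneg_nonneg mult_nonneg_nonneg sum_nonneg kap_nonneg) auto

lemma GG_polys [simp]: "GG e \<in> polys A"
  unfolding GG_def[abs_def] by (intro polys_intros) simp_all

lemma Ck_GG [simp]: "Ck n (GG e)" by (rule polys_Ck[OF GG_polys])

lemma GG_le_1D:
  assumes "GG e \<eta> \<le> 1"
  shows "H \<eta> \<le> e + 1" "\<nu> = 0 \<Longrightarrow> j \<in> {1..d} \<Longrightarrow> \<bar>Q j \<eta>\<bar> \<le> 1"
proof -
  have s0: "(\<Sum>j=1..d. (P j \<eta>)\<^sup>2 + (Q j \<eta>)\<^sup>2) \<ge> 0" by (intro sum_nonneg) auto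
  then have "kap * (\<Sum>j=1..d. (P j \<eta>)\<^sup>2 + (Q j \<eta>)\<^sup>2) \<ge> 0" using kap_nonneg by simp
  then have "(H \<eta> - e)\<^sup>2 \<le> 1" using assms unfolding GG_def by linarith
  then show "H \<eta> \<le> e + 1" using abs_square_le_1[of "H \<eta> - e"] by linarith
  show "\<bar>Q j \<eta>\<bar> \<le> 1" if "\<nu> = 0" "j \<in> {1..d}"
  proof -
    have "(P j \<eta>)\<^sup>2 + (Q j \<eta>)\<^sup>2 \<le> (\<Sum>j=1..d. (P j \<eta>)\<^sup>2 + (Q j \<eta>)\<^sup>2)"
      using that by (intro member_le_sum) auto
    moreover have "(H \<eta> - e)\<^sup>2 \<ge> 0" "(P j \<eta>)\<^sup>2 \<ge> 0" by auto
    moreover have k: "kap = 1" unfolding kap_def by (rule if_P[OF that(1)])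
    ultimately have "(Q j \<eta>)\<^sup>2 \<le> 1" using assms unfolding GG_def k mult_1 by linarith
    then show ?thesis by (simp add: abs_square_le_1)
  qed
qed

lemma GG_bounded: "\<exists>R. \<forall>\<eta>. GG e \<eta> \<le> 1 \<longrightarrow> (\<forall>c\<in>A. \<bar>\<eta> c\<bar> \<le> R)"
proof -
  obtain R where R: "\<And>\<eta>. H \<eta> \<le> e + 1 \<Longrightarrow> (\<nu> = 0 \<longrightarrow> (\<forall>j\<in>{1..d}. \<bar>Q j \<eta>\<bar> \<le> 1)) \<Longrightarrow> \<forall>c\<in>A. \<bar>\<eta> c\<bar> \<le> R"
    using coercive[of "e + 1"] by blast
  show ?thesis using R GG_le_1D by blast
qed

lemma polys_bounded_GG:
  assumes "F \<in> polys A"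
  obtains K where "\<And>\<eta>. GG e \<eta> \<le> 1 \<Longrightarrow> \<bar>F \<eta>\<bar> \<le> K"
proof -
  obtain R where "\<And>\<eta>. GG e \<eta> \<le> 1 \<Longrightarrow> \<forall>c\<in>A. \<bar>\<eta> c\<bar> \<le> R" using GG_bounded by blast
  moreover obtain K where "\<And>\<eta>. (\<forall>c\<in>A. \<bar>\<eta> c\<bar> \<le> R) \<Longrightarrow> \<bar>F \<eta>\<bar> \<le> K"
    using polys_bounded[OF assms] by blast
  ultimately show ?thesis using that by blast
qed

lemma cut_bounds: "0 \<le> cut e \<eta>" "cut e \<eta> \<le> 1"
  using GG_nonneg[of e \<eta>] by (auto simp: cut_def intro: power_le_one)

lemma cut_eq_1: "GG e \<eta> = 0 \<Longrightarrow> cut e \<eta> = 1"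
  by (simp add: cut_def)

lemma cut_neq_0: "cut e \<eta> \<noteq> 0 \<Longrightarrow> GG e \<eta> \<le> 1"
  by (auto simp: cut_def max_def split: if_splits)

lemma Ck_cut: "Ck 2 (cut e)"
  using Ck_pospart_power[of 2 "\<lambda>\<eta>. 1 - GG e \<eta>"] unfolding cut_def[abs_def] by (simp add: numeral_3_eq_3 numeral_2_eq_2)

lemma C1_cut: "C1 (cut e)"
  using Ck_mono[OF Ck_cut, of 1] by simp

lemma deriv_GG:
  assumes D: "derivation D"
  shows "D (GG e) \<eta> = 2 * (H \<eta> - e) * D H \<eta> + kap * (\<Sum>j=1..d. 2 * P j \<eta> * D (P j) \<eta> + 2 * Q j \<eta> * D (Q j) \<eta>)"
  unfolding GG_def[abs_def] by (simp add: deriv_simps[OF D])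

lemma deriv_cut:
  assumes D: "derivation D"
  shows "D (cut e) \<eta> = - 3 * (max 0 (1 - GG e \<eta>))\<^sup>2 * D (GG e) \<eta>"
proof -
  have *: "((\<lambda>s. max 0 (1 - s) ^ 3) has_real_derivative - 3 * (max 0 (1 - s))\<^sup>2) (at s)" for s :: real
  proof -
    have "((\<lambda>y. max 0 y ^ 3) has_real_derivative 3 * (max 0 (1 - s))\<^sup>2) (at (1 - s))"
      using DERIV_pospart_power[of 1 "1 - s"] by (simp add: numeral_3_eq_3 numeral_2_eq_2)
    moreover have "((\<lambda>s. 1 - s) has_real_derivative - 1) (at s)" by (auto intro!: derivative_eq_intros)
    ultimately have "((\<lambda>s. max 0 (1 - s) ^ 3) has_real_derivative 3 * (max 0 (1 - s))\<^sup>2 * - 1) (at s)"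
      by (rule DERIV_chain2)
    then show ?thesis by simp
  qed
  show ?thesis unfolding cut_def[abs_def] by (subst deriv_chain[OF D Ck_GG *]) simp
qed

lemma deriv_cut_zero:
  assumes "derivation D" "D H = (\<lambda>_. 0)" "\<And>j. D (P j) = (\<lambda>_. 0)" "\<And>j. D (Q j) = (\<lambda>_. 0)"
  shows "D (cut e) = (\<lambda>_. 0)"
  by (rule ext) (simp add: deriv_cut[OF assms(1)] deriv_GG[OF assms(1)] assms(2-))

text \<open>Energy is conserved and the momentum drift is proportional to \<nu>, which
  \<open>kap\<close> annihilates. What remains is the total position moving with the total
  momentum.\<close>

lemma liouville_GG: "liouville_op d N \<alpha> \<nu> (GG e) \<eta> = 2 * kap * (\<Sum>j=1..d. Q j \<eta> * P j \<eta>)"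
proof -
  have "(\<Sum>j=1..d. 2 * P j \<eta> * liouville_op d N \<alpha> \<nu> (P j) \<eta> + 2 * Q j \<eta> * liouville_op d N \<alpha> \<nu> (Q j) \<eta>)
     = (\<Sum>j=1..d. 2 * (1 - \<nu>) * (Q j \<eta> * P j \<eta>))"
    by (intro sum.cong refl) (simp add: liouville_lin sum_W algebra_simps)
  then show ?thesis
    unfolding deriv_GG[OF derivation_liouville] liouville_H sum_distrib_left[symmetric]
    by (simp add: kap_def)
qed

text \<open>The noise fields annihilate energy, total momentum and total position, hence the
  cut-off, which therefore behaves like a constant factor.\<close>

lemma X_twice_cut:
  assumes F: "Ck 2 F" and "x \<in> S" "z \<in> S" "i \<in> {1..d}" "j \<in> {1..d}"
  shows "X_op i j x z (X_op i j x z (\<lambda>\<eta>. F \<eta> * cut e \<eta>)) \<eta> = X_op i j x z (X_op i j x z F) \<eta> * cut e \<eta>"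
proof -
  have F2: "Ck (Suc (Suc 0)) F" using F by (simp add: numeral_2_eq_2)
  have z: "X_op i j x z (cut e) = (\<lambda>_. 0)"
    by (rule deriv_cut_zero[OF derivation_X]) (simp_all add: X_conserved[OF assms(2-5)])
  have "X_op i j x z (\<lambda>\<eta>. F \<eta> * cut e \<eta>) = (\<lambda>\<eta>. X_op i j x z F \<eta> * cut e \<eta>)"
    using deriv_mult[OF derivation_X Ck_Suc_D[OF F2] C1_cut] z by simp
  then show ?thesis
    using deriv_mult[OF derivation_X Ck_X[OF F2] C1_cut] z by simp
qed

lemma Y_twice_cut:
  assumes F: "Ck 2 F" and "x \<in> S" "d = 1"
  shows "Y_op N x (Y_op N x (\<lambda>\<eta>. F \<eta> * cut e \<eta>)) \<eta> = Y_op N x (Y_op N x F) \<eta> * cut e \<eta>"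
proof -
  have F2: "Ck (Suc (Suc 0)) F" using F by (simp add: numeral_2_eq_2)
  have z: "Y_op N x (cut e) = (\<lambda>_. 0)"
    by (rule deriv_cut_zero[OF derivation_Y]) (simp_all only: Y_conserved[OF assms(2,3)])
  have "Y_op N x (\<lambda>\<eta>. F \<eta> * cut e \<eta>) = (\<lambda>\<eta>. Y_op N x F \<eta> * cut e \<eta>)"
    using deriv_mult[OF derivation_Y Ck_Suc_D[OF F2] C1_cut] z by simp
  then show ?thesis
    using deriv_mult[OF derivation_Y Ck_Y[OF F2] C1_cut] z by simp
qed

lemma noise_cut:
  assumes "Ck 2 F"
  shows "noise_op d N (\<lambda>\<eta>. F \<eta> * cut e \<eta>) \<eta> = noise_op d N F \<eta> * cut e \<eta>"
proof (cases "d = 1")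
  case True
  have "(\<Sum>x\<in>S. Y_op N x (Y_op N x (\<lambda>\<eta>. F \<eta> * cut e \<eta>)) \<eta>) = (\<Sum>x\<in>S. Y_op N x (Y_op N x F) \<eta> * cut e \<eta>)"
    by (intro sum.cong refl Y_twice_cut assms True)
  then show ?thesis using True by (simp add: noise_op_def sum_distrib_right)
next
  case False
  have "(\<Sum>x\<in>S. \<Sum>i=1..d. \<Sum>j=1..d. \<Sum>l=1..d. X_op i j x (shift N l 1 x) (X_op i j x (shift N l 1 x) (\<lambda>\<eta>. F \<eta> * cut e \<eta>)) \<eta>)
     = (\<Sum>x\<in>S. \<Sum>i=1..d. \<Sum>j=1..d. \<Sum>l=1..d. X_op i j x (shift N l 1 x) (X_op i j x (shift N l 1 x) F) \<eta> * cut e \<eta>)"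
    by (intro sum.cong refl X_twice_cut assms shift_in_sites N_pos)
  then show ?thesis using False by (simp add: noise_op_def sum_distrib_right)
qed

text \<open>For an observable conserved by the Hamiltonian flow and an eigenfunction of the noise,
  the only error is the Liouville derivative of the cut-off. The constant 6 is the exponent 3 of
  \<open>cut\<close> times the 2 of \<open>liouville_GG\<close>.\<close>

lemma generator_cut:
  assumes F: "Ck 2 F" and "liouville_op d N \<alpha> \<nu> F = (\<lambda>_. 0)" "\<And>\<eta>. noise_op d N F \<eta> = - c * F \<eta>"
  shows "generator d N \<alpha> \<nu> \<gamma> (\<lambda>\<eta>. F \<eta> * cut e \<eta>) \<eta> = - \<gamma> * c * (F \<eta> * cut e \<eta>)
    - 6 * F \<eta> * (max 0 (1 - GG e \<eta>))\<^sup>2 * (kap * (\<Sum>j=1..d. Q j \<eta> * P j \<eta>))"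
proof -
  have "C1 F" using Ck_mono[OF F, of 1] by simp
  then have "liouville_op d N \<alpha> \<nu> (\<lambda>\<eta>. F \<eta> * cut e \<eta>) \<eta> = F \<eta> * liouville_op d N \<alpha> \<nu> (cut e) \<eta>"
    by (simp add: deriv_mult[OF derivation_liouville] C1_cut assms(2))
  then show ?thesis
    unfolding generator_def noise_cut[OF F] assms(3) deriv_cut[OF derivation_liouville] liouville_GG
    by (simp add: algebra_simps)
qed

lemma noise_const: "noise_op d N (\<lambda>_. a) \<eta> = 0"
  by (simp add: noise_op_def deriv_const[OF derivation_X] deriv_const[OF derivation_Y])

lemma generator_cut_1:
  "generator d N \<alpha> \<nu> \<gamma> (cut e) \<eta> = - 6 * (max 0 (1 - GG e \<eta>))\<^sup>2 * (kap * (\<Sum>j=1..d. Q j \<eta> * P j \<eta>))"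
  using generator_cut[of "\<lambda>_. 1" 0 \<gamma> e \<eta>]
  by (simp add: deriv_const[OF derivation_liouville] noise_const)

lemma generator_cut_JJ:
  "generator d N \<alpha> \<nu> \<gamma> (\<lambda>\<eta>. JJ k \<eta> * cut e \<eta>) \<eta> = - \<gamma> * psi k * (JJ k \<eta> * cut e \<eta>)
    - 6 * JJ k \<eta> * (max 0 (1 - GG e \<eta>))\<^sup>2 * (kap * (\<Sum>j=1..d. Q j \<eta> * P j \<eta>))"
  by (intro generator_cut liouville_JJ) (simp_all add: noise_JJ)

lemma kap_sum_QP_le: "\<bar>kap * (\<Sum>j=1..d. Q j \<eta> * P j \<eta>)\<bar> \<le> GG e \<eta> / 2"
proof -
  have "\<bar>\<Sum>j=1..d. Q j \<eta> * P j \<eta>\<bar> \<le> (\<Sum>j=1..d. ((P j \<eta>)\<^sup>2 + (Q j \<eta>)\<^sup>2) / 2)"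
  proof (rule order_trans[OF sum_abs], rule sum_mono)
    fix j
    have "0 \<le> (\<bar>Q j \<eta>\<bar> - \<bar>P j \<eta>\<bar>)\<^sup>2" by simp
    then show "\<bar>Q j \<eta> * P j \<eta>\<bar> \<le> ((P j \<eta>)\<^sup>2 + (Q j \<eta>)\<^sup>2) / 2" by (simp add: power2_diff abs_mult)
  qed
  then have "kap * \<bar>\<Sum>j=1..d. Q j \<eta> * P j \<eta>\<bar> \<le> kap * ((\<Sum>j=1..d. (P j \<eta>)\<^sup>2 + (Q j \<eta>)\<^sup>2) / 2)"
    using kap_nonneg by (intro mult_left_mono) (simp_all add: sum_divide_distrib)
  also have "\<dots> \<le> GG e \<eta> / 2" by (simp add: GG_def)
  finally show ?thesis using kap_nonneg by (simp add: abs_mult)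
qed

text \<open>The drift of the cut-off is controlled by its own deficit \<open>1 - cut e\<close>. This
  is the differential inequality that Gronwall's lemma needs.\<close>

lemma generator_cut_1_bound: "\<bar>generator d N \<alpha> \<nu> \<gamma> (cut e) \<eta>\<bar> \<le> 3 * (1 - cut e \<eta>)"
proof -
  define g where "g = GG e \<eta>"
  have g0: "0 \<le> g" unfolding g_def by (rule GG_nonneg)
  have "\<bar>generator d N \<alpha> \<nu> \<gamma> (cut e) \<eta>\<bar> \<le> 6 * (max 0 (1 - g))\<^sup>2 * (g / 2)"
    unfolding generator_cut_1 g_def abs_mult using kap_sum_QP_le[of \<eta> e]
    by (intro mult_mono) auto
  also have "\<dots> \<le> 3 * (1 - max 0 (1 - g) ^ 3)"
  proof (cases "g \<le> 1")
    case True
    \<comment> \<open>Both terms contain the square of \<open>1 - g\<close>, and the remaining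
      factors add up to 1.\<close>
    have "(1 - g)\<^sup>2 * g + (1 - g) ^ 3 = (1 - g)\<^sup>2" by (simp add: power2_eq_square power3_eq_cube algebra_simps)
    also have "\<dots> \<le> 1" using g0 True by (intro power_le_one) auto
    finally have le: "(1 - g)\<^sup>2 * g + (1 - g) ^ 3 \<le> 1" .
    have m: "max 0 (1 - g) = 1 - g" "6 * (1 - g)\<^sup>2 * (g / 2) = 3 * ((1 - g)\<^sup>2 * g)" using True by auto
    have "3 * x \<le> 3 * (1 - y)" if "x + y \<le> 1" for x y :: real using that by simp
    from this[OF le] show ?thesis unfolding m .
  qed simp
  finally show ?thesis by (simp add: cut_def g_def)
qed

lemma cut_mult_test_function:
  assumes "F \<in> polys A"
  shows "C2_fun d N (\<lambda>\<eta>. F \<eta> * cut e \<eta>)" "compactly_supported d N (\<lambda>\<eta>. F \<eta> * cut e \<eta>)"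
proof -
  show "C2_fun d N (\<lambda>\<eta>. F \<eta> * cut e \<eta>)" by (intro C2_funI Ck_mult Ck_cut polys_Ck[OF assms])
  obtain R where "\<And>\<eta>. GG e \<eta> \<le> 1 \<Longrightarrow> \<forall>c\<in>A. \<bar>\<eta> c\<bar> \<le> R" using GG_bounded by blast
  then show "compactly_supported d N (\<lambda>\<eta>. F \<eta> * cut e \<eta>)"
    unfolding compactly_supported_def by (intro exI[of _ R]) (auto dest: cut_neq_0)
qed

lemma cut_measurable: "cut e \<in> borel_measurable (phase_lborel d N)"
  unfolding cut_def[abs_def] phase_lborel_def
  by (intro borel_measurable_power borel_measurable_max borel_measurable_diff borel_measurable_const polys_measurable[OF GG_polys])

lemma cut_mult_bounded:
  assumes "F \<in> polys A"
  obtains K where "\<And>\<eta>. \<bar>F \<eta> * cut e \<eta>\<bar> \<le> K" "K \<ge> 0"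
proof -
  obtain K where K: "\<And>\<eta>. GG e \<eta> \<le> 1 \<Longrightarrow> \<bar>F \<eta>\<bar> \<le> K" using polys_bounded_GG[OF assms] by blast
  have "\<bar>F \<eta> * cut e \<eta>\<bar> \<le> \<bar>K\<bar>" for \<eta>
  proof (cases "cut e \<eta> = 0")
    case False
    then have "\<bar>F \<eta>\<bar> * \<bar>cut e \<eta>\<bar> \<le> \<bar>K\<bar> * 1"
      using K[OF cut_neq_0[OF False]] cut_bounds[of e \<eta>] by (intro mult_mono) auto
    then show ?thesis by (simp add: abs_mult)
  qed simp
  then show ?thesis using that by force
qed

end

section \<open>Gronwall's lemma and measurability of continuous processes\<close>

lemma set_integrable_bounded:
  fixes w :: "real \<Rightarrow> real"
  assumes "w \<in> borel_measurable borel" "\<And>t. 0 \<le> t \<Longrightarrow> \<bar>w t\<bar> \<le> B"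
  shows "set_integrable lborel {0..t} w"
proof -
  have [measurable]: "w \<in> borel_measurable borel" by (rule assms)
  have "integrable lborel (\<lambda>s. B * indicator {0..t} s :: real)"
    by (intro integrable_mult_right integrable_real_indicator) (auto simp: emeasure_lborel_Icc_eq)
  then show ?thesis unfolding set_integrable_def
    by (rule Bochner_Integration.integrable_bound) (auto simp: indicator_def intro!: order_trans[OF assms(2) abs_ge_self])
qed

text \<open>Iterating the inequality from the bound \<open>B\<close> gives
  \<open>B * (c * t) ^ n / fact n\<close> for every \<open>n\<close>, a null sequence. Only
  measurability and boundedness enter, so correlation functions qualify before any regularity in
  time is known.\<close>

lemma gronwall_zero:
  fixes w :: "real \<Rightarrow> real"
  assumes w[measurable]: "w \<in> borel_measurable borel" and B: "\<And>t. 0 \<le> t \<Longrightarrow> \<bar>w t\<bar> \<le> B"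
    and c: "c \<ge> 0" and le: "\<And>t. 0 \<le> t \<Longrightarrow> \<bar>w t\<bar> \<le> c * (LBINT s:{0..t}. \<bar>w s\<bar>)" and t: "0 \<le> t"
  shows "w t = 0"
proof -
  have bound: "\<bar>w t\<bar> \<le> B * (c * t) ^ n / fact n" if "0 \<le> t" for t n
    using that
  proof (induction n arbitrary: t)
    case 0 then show ?case using B by simp
  next
    case (Suc n)
    have "(LBINT s:{0..t}. \<bar>w s\<bar>) \<le> (LBINT s:{0..t}. B * (c * s) ^ n / fact n)"
    proof (rule set_integral_mono)
      show "set_integrable lborel {0..t} (\<lambda>s. \<bar>w s\<bar>)"
        by (rule set_integrable_bounded[of _ B]) (use B in auto)
      show "set_integrable lborel {0..t} (\<lambda>s. B * (c * s) ^ n / fact n)"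
        unfolding set_integrable_def by (rule borel_integrable_atLeastAtMost'[unfolded set_integrable_def]) (intro continuous_intros, simp)
      show "\<bar>w s\<bar> \<le> B * (c * s) ^ n / fact n" if "s \<in> {0..t}" for s
        using Suc.IH[of s] that by simp
    qed
    also have "\<dots> = B * c ^ n / fact n * (\<integral>s. s ^ n * indicator {0..t} s \<partial>lborel)"
      unfolding set_lebesgue_integral_def by (subst integral_mult_right_zero[symmetric]) (simp add: power_mult_distrib algebra_simps)
    also have "\<dots> = B * c ^ n / fact n * (t ^ Suc n / Suc n)"
      using Suc.prems by (subst integral_power) auto
    finally have "c * (LBINT s:{0..t}. \<bar>w s\<bar>) \<le> c * (B * c ^ n / fact n * (t ^ Suc n / Suc n))"
      using c by (rule mult_left_mono)
    also have "\<dots> = B * (c * t) ^ Suc n / fact (Suc n)"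
      by (simp add: power_mult_distrib field_simps)
    finally show ?case using le[OF Suc.prems] by linarith
  qed
  have "(\<lambda>n. inverse (fact n) * (c * t) ^ n) \<longlonglongrightarrow> 0"
    by (rule summable_LIMSEQ_zero[OF summable_exp])
  then have "(\<lambda>n. B * (inverse (fact n) * (c * t) ^ n)) \<longlonglongrightarrow> B * 0" by (rule tendsto_mult_left)
  then have "(\<lambda>n. B * (c * t) ^ n / fact n) \<longlonglongrightarrow> 0" by (simp add: field_simps)
  then have "\<bar>w t\<bar> \<le> 0" by (rule LIMSEQ_le_const) (use bound[OF t] in auto)
  then show ?thesis by simp
qed

text \<open>Rounding down to a grid of mesh 1 / (n + 1). It discretises time for joint measurability
  and wave numbers for the infinite-volume limit.\<close>

lemma floor_mult_div_tendsto:
  fixes x :: real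
  shows "(\<lambda>n. of_int \<lfloor>x * real (Suc n)\<rfloor> / real (Suc n)) \<longlonglongrightarrow> x"
proof -
  have "\<bar>of_int \<lfloor>x * real (Suc n)\<rfloor> / real (Suc n) - x\<bar> \<le> inverse (real (Suc n))" for n
  proof -
    have "\<bar>of_int \<lfloor>x * real (Suc n)\<rfloor> - x * real (Suc n)\<bar> \<le> 1" by linarith
    then have "\<bar>of_int \<lfloor>x * real (Suc n)\<rfloor> - x * real (Suc n)\<bar> / real (Suc n) \<le> 1 / real (Suc n)"
      by (intro divide_right_mono) auto
    moreover have "of_int \<lfloor>x * real (Suc n)\<rfloor> / real (Suc n) - x = (of_int \<lfloor>x * real (Suc n)\<rfloor> - x * real (Suc n)) / real (Suc n)"
      by (simp add: field_simps del: of_nat_Suc)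
    ultimately show ?thesis by (simp add: abs_divide inverse_eq_divide del: of_nat_Suc)
  qed
  then have "(\<lambda>n. of_int \<lfloor>x * real (Suc n)\<rfloor> / real (Suc n) - x) \<longlonglongrightarrow> 0"
    by (intro Lim_null_comparison[OF _ LIMSEQ_inverse_real_of_nat]) auto
  then show ?thesis using LIM_zero_iff by blast
qed

text \<open>Rounded to a grid, the process uses countably many times and is jointly measurable;
  continuity of paths gives the limit. Freezing negative times at 0 makes it total in time, as
  Fubini over \<open>lborel\<close> requires.\<close>

lemma measurable_continuous_process:
  fixes X :: "real \<Rightarrow> 'w \<Rightarrow> real"
  assumes meas: "\<And>t. 0 \<le> t \<Longrightarrow> X t \<in> borel_measurable M"
    and cont: "\<And>w. w \<in> space M \<Longrightarrow> continuous_on {0..} (\<lambda>t. X t w)"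
  shows "(\<lambda>(s, w). X (max 0 s) w) \<in> borel_measurable (lborel \<Otimes>\<^sub>M M)"
proof -
  define r where "r n s = real_of_int \<lfloor>max 0 s * real (Suc n)\<rfloor> / real (Suc n)" for n s
  have r0: "0 \<le> r n s" for n s by (simp add: r_def)
  have r_lim: "(\<lambda>n. r n s) \<longlonglongrightarrow> max 0 s" for s
    unfolding r_def by (rule floor_mult_div_tendsto)
  have lim: "(\<lambda>n. (\<lambda>(s, w). X (r n s) w) x) \<longlonglongrightarrow> (\<lambda>(s, w). X (max 0 s) w) x"
    if "x \<in> space (lborel \<Otimes>\<^sub>M M)" for x
  proof - 
    from that obtain s w where x: "x = (s, w)" and w: "w \<in> space M" by (auto simp: space_pair_measure)
    show "(\<lambda>n. (\<lambda>(s, w). X (r n s) w) x) \<longlonglongrightarrow> (\<lambda>(s, w). X (max 0 s) w) x"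
      unfolding x prod.case
      by (rule continuous_on_tendsto_compose[OF cont[OF w] r_lim]) (use r0 in auto)
  qed
  have meas: "(\<lambda>(s, w). X (r n s) w) \<in> borel_measurable (lborel \<Otimes>\<^sub>M M)" for n
  proof -
    have "(\<lambda>x. (\<lambda>i. X (max 0 (real_of_int i / real (Suc n))) (snd x)) \<lfloor>max 0 (fst x) * real (Suc n)\<rfloor>) \<in> borel_measurable (lborel \<Otimes>\<^sub>M M)"
    proof (rule measurable_compose_countable[where
        f = "\<lambda>i x. X (max 0 (real_of_int i / real (Suc n))) (snd x)" and g = "\<lambda>x. \<lfloor>max 0 (fst x) * real (Suc n)\<rfloor>"])
      show "(\<lambda>x. X (max 0 (real_of_int i / real (Suc n))) (snd x)) \<in> borel_measurable (lborel \<Otimes>\<^sub>M M)" for i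
        by (rule measurable_compose[OF measurable_snd meas]) simp
      have [measurable]: "fst \<in> borel_measurable (lborel \<Otimes>\<^sub>M M)"
        using measurable_fst[of lborel M] by simp
      show "(\<lambda>x. \<lfloor>max 0 (fst x) * real (Suc n)\<rfloor>) \<in> measurable (lborel \<Otimes>\<^sub>M M) (count_space UNIV)"
        by measurable
    qed
    moreover have "max 0 (real_of_int \<lfloor>max 0 s * real (Suc n)\<rfloor> / real (Suc n)) = r n s" for s
      using r0[of n s] by (simp add: r_def)
    ultimately show ?thesis
      by (simp add: case_prod_unfold)
  qed
  show ?thesis by (rule borel_measurable_LIMSEQ_real[OF lim meas])
qed

section \<open>Correlations along the diffusion\<close>

text \<open>The initial law enters only through its concentration on the surface of energy
  \<open>e\<close>; which law it is matters later, for the static moments.\<close>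

locale chain_diffusion = chain d N \<alpha> \<nu> for d N \<alpha> \<nu> +
  fixes \<gamma> e :: real and M :: "'w measure" and Z :: "real \<Rightarrow> 'w \<Rightarrow> config"
  assumes diff: "diffusion d N \<alpha> \<nu> \<gamma> M Z"
    and start: "AE w in M. GG e (Z 0 w) = 0"
begin

abbreviation "L \<equiv> generator d N \<alpha> \<nu> \<gamma>"
abbreviation "PL \<equiv> phase_lborel d N"

sublocale prob_space M
  using diff by (simp add: diffusion_def)

lemma Z_measurable: "0 \<le> t \<Longrightarrow> Z t \<in> measurable M PL"
  using diff by (simp add: diffusion_def)

lemma path_continuous: "w \<in> space M \<Longrightarrow> continuous_on UNIV f \<Longrightarrow> continuous_on {0..} (\<lambda>t. f (Z t w) :: real)"
  by (rule continuous_on_compose2[of UNIV f "{0..}" "\<lambda>t. Z t w"]) (use diff in \<open>auto simp: diffusion_def\<close>)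

lemma process_measurable:
  assumes "f \<in> borel_measurable PL" "continuous_on UNIV f"
  shows "(\<lambda>(s, w). f (Z (max 0 s) w) :: real) \<in> borel_measurable (lborel \<Otimes>\<^sub>M M)"
  by (rule measurable_continuous_process) (auto intro: measurable_compose[OF Z_measurable assms(1)] path_continuous assms(2))

lemma bounded_integrable:
  assumes "f \<in> borel_measurable M" "\<And>w. w \<in> space M \<Longrightarrow> \<bar>f w\<bar> \<le> (K::real)"
  shows "integrable M f"
  by (rule integrable_const_bound[of _ K]) (use assms in auto)

text \<open>The martingale property given time 0, integrated against \<open>h (Z 0)\<close>, with
  Fubini used to exchange the time integral and the expectation.\<close>

lemma dynkin:
  fixes f h :: "config \<Rightarrow> real"
  assumes f: "C2_fun d N f" "compactly_supported d N f" "f \<in> borel_measurable PL" "\<And>\<eta>. \<bar>f \<eta>\<bar> \<le> K1"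
    and Lf: "L f \<in> borel_measurable PL" "continuous_on UNIV (L f)" "\<And>\<eta>. \<bar>L f \<eta>\<bar> \<le> K2"
    and h: "h \<in> borel_measurable PL" "\<And>\<eta>. \<bar>h \<eta>\<bar> \<le> K3"
    and t: "0 \<le> t"
  shows "(\<integral>w. h (Z 0 w) * f (Z t w) \<partial>M) = (\<integral>w. h (Z 0 w) * f (Z 0 w) \<partial>M)
       + (LBINT s:{0..t}. (\<integral>w. h (Z 0 w) * L f (Z (max 0 s) w) \<partial>M))"
proof -
  define F where "F = natural_filtration M PL Z"
  define X where "X t w = f (Z t w) - (LBINT s:{0..t}. L f (Z s w))" for t w
  have mart: "martingale M F X"
    using diff f(1,2) unfolding diffusion_def F_def X_def[abs_def] by blast
  have sub: "subalgebra M (F 0)" and Xint: "integrable M (X t)" and Xmeas: "X t \<in> borel_measurable (F t)"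
    and cond: "AE w in M. real_cond_exp M (F 0) (X t) w = X 0 w"
    using mart t unfolding martingale_def by auto
  interpret finite_measure_subalgebra M "F 0" by unfold_locales (rule sub)
  interpret sigma_finite_subalgebra M "F 0"
    by (rule finite_measure_subalgebra_is_sigma_finite) unfold_locales
  have K: "0 \<le> K1" "0 \<le> K2" "0 \<le> K3"
    using f(4)[of undefined] Lf(3)[of undefined] h(2)[of undefined] by linarith+
  \<comment> \<open>This lets \<open>h (Z 0)\<close> pass through the conditional expectation; its
    preimages are themselves generators of the filtration at time 0.\<close>
  have Z0: "Z 0 \<in> measurable (F 0) PL"
  proof (rule measurableI)
    show "Z 0 w \<in> space PL" if "w \<in> space (F 0)" for w
      using that measurable_space[OF Z_measurable[of 0]] by (simp add: F_def natural_filtration_def space_measure_of_conv)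
    show "Z 0 -` B \<inter> space (F 0) \<in> sets (F 0)" if B: "B \<in> sets PL" for B
    proof -
      let ?G = "{Z u -` B \<inter> space M |u B. u \<in> {0..0} \<and> B \<in> sets PL}"
      have "?G \<subseteq> Pow (space M)" by auto
      then have "sets (F 0) = sigma_sets (space M) ?G" "space (F 0) = space M"
        unfolding F_def natural_filtration_def by (rule sets_measure_of, rule space_measure_of)
      then show ?thesis using B by (auto intro: sigma_sets.Basic)
    qed
  qed
  have hF: "(\<lambda>w. h (Z 0 w)) \<in> borel_measurable (F 0)" by (rule measurable_compose[OF Z0 h(1)])
  have hM [measurable]: "(\<lambda>w. h (Z 0 w)) \<in> borel_measurable M" by (rule measurable_from_subalg[OF sub hF])
  have fM [measurable]: "(\<lambda>w. f (Z s w)) \<in> borel_measurable M" if "0 \<le> s" for s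
    by (rule measurable_compose[OF Z_measurable[OF that] f(3)])
  have hX: "integrable M (\<lambda>w. h (Z 0 w) * X t w)"
  proof (rule Bochner_Integration.integrable_bound[of M "\<lambda>w. K3 * X t w"])
    show "integrable M (\<lambda>w. K3 * X t w)" using Xint by simp
    show "(\<lambda>w. h (Z 0 w) * X t w) \<in> borel_measurable M" using Xint by simp
    show "AE w in M. norm (h (Z 0 w) * X t w) \<le> norm (K3 * X t w)"
      using h(2) K(3) by (auto simp: abs_mult intro!: mult_right_mono)
  qed
  have "(\<integral>w. h (Z 0 w) * X t w \<partial>M) = (\<integral>w. h (Z 0 w) * real_cond_exp M (F 0) (X t) w \<partial>M)"
    using real_cond_exp_intg(2)[OF hX hF] Xint by simp
  also have "\<dots> = (\<integral>w. h (Z 0 w) * X 0 w \<partial>M)"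
  proof (rule integral_cong_AE)
    have "X 0 \<in> borel_measurable M" using mart unfolding martingale_def by (meson borel_measurable_integrable order_refl)
    then show "(\<lambda>w. h (Z 0 w) * X 0 w) \<in> borel_measurable M" by simp
    show "AE w in M. h (Z 0 w) * real_cond_exp M (F 0) (X t) w = h (Z 0 w) * X 0 w" using cond by auto
  qed simp
  also have "\<dots> = (\<integral>w. h (Z 0 w) * f (Z 0 w) \<partial>M)"
  proof -
    have "(LBINT s:{0..0}. L f (Z s w)) = 0" for w
      unfolding set_lebesgue_integral_def
      by (rule integral_eq_zero_AE) (use AE_lborel_singleton[of 0] in \<open>auto elim!: eventually_mono\<close>)
    then show ?thesis by (simp add: X_def)
  qed
  finally have eq1: "(\<integral>w. h (Z 0 w) * X t w \<partial>M) = (\<integral>w. h (Z 0 w) * f (Z 0 w) \<partial>M)" .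
  define G where "G s w = indicator {0..t} s * (h (Z 0 w) * L f (Z (max 0 s) w))" for s w
  interpret P: pair_sigma_finite lborel M ..
  have Gint: "integrable (lborel \<Otimes>\<^sub>M M) (case_prod G)"
  proof (rule Bochner_Integration.integrable_bound[of _ "\<lambda>x. K3 * K2 * indicator ({0..t} \<times> space M) x"])
    have "emeasure (lborel \<Otimes>\<^sub>M M) ({0..t} \<times> space M) = ennreal t * 1"
      using t by (subst emeasure_pair_measure_Times) (auto simp: emeasure_space_1)
    then show "integrable (lborel \<Otimes>\<^sub>M M) (\<lambda>x. K3 * K2 * indicator ({0..t} \<times> space M) x :: real)"
      by (intro integrable_mult_right integrable_real_indicator) auto
    have [measurable]: "(\<lambda>x. L f (Z (max 0 (fst x)) (snd x))) \<in> borel_measurable (lborel \<Otimes>\<^sub>M M)"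
      using process_measurable[OF Lf(1,2)] by (simp add: case_prod_unfold)
    have [measurable]: "(\<lambda>x. h (Z 0 (snd x))) \<in> borel_measurable (lborel \<Otimes>\<^sub>M M)"
      by (rule measurable_compose[OF measurable_snd hM])
    have [measurable]: "(\<lambda>x. indicator {0..t} (fst x) :: real) \<in> borel_measurable (lborel \<Otimes>\<^sub>M M)"
      by (rule measurable_compose[OF measurable_fst]) simp
    show "case_prod G \<in> borel_measurable (lborel \<Otimes>\<^sub>M M)"
      unfolding G_def case_prod_unfold by measurable
    show "AE x in lborel \<Otimes>\<^sub>M M. norm (case_prod G x) \<le> norm (K3 * K2 * indicator ({0..t} \<times> space M) x :: real)"
    proof (rule AE_I2)
      fix x :: "real \<times> 'w" assume "x \<in> space (lborel \<Otimes>\<^sub>M M)"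
      then have "snd x \<in> space M" by (auto simp: space_pair_measure)
      then show "norm (case_prod G x) \<le> norm (K3 * K2 * indicator ({0..t} \<times> space M) x :: real)"
        using h(2) Lf(3) K by (cases x) (auto simp: G_def abs_mult indicator_def intro!: mult_mono)
    qed
  qed
  have inner: "(\<integral>s. G s w \<partial>lborel) = h (Z 0 w) * (LBINT s:{0..t}. L f (Z s w))" for w
  proof -
    have "(\<integral>s. G s w \<partial>lborel) = (\<integral>s. h (Z 0 w) * (indicator {0..t} s *\<^sub>R L f (Z s w)) \<partial>lborel)"
      unfolding G_def by (intro Bochner_Integration.integral_cong refl) (auto simp: indicator_def)
    then show ?thesis by (simp add: set_lebesgue_integral_def)
  qed
  have int2: "integrable M (\<lambda>w. h (Z 0 w) * (LBINT s:{0..t}. L f (Z s w)))"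
    using P.integrable_snd[OF Gint] unfolding inner .
  have int1: "integrable M (\<lambda>w. h (Z 0 w) * f (Z t w))"
    by (rule bounded_integrable[of _ "K3 * K1"]) (use h(2) f(4) K t in \<open>auto simp: abs_mult intro!: mult_mono\<close>)
  have "(\<integral>w. h (Z 0 w) * (LBINT s:{0..t}. L f (Z s w)) \<partial>M) = (\<integral>s. (\<integral>w. G s w \<partial>M) \<partial>lborel)"
    using P.Fubini_integral[OF Gint] unfolding inner .
  also have "\<dots> = (LBINT s:{0..t}. (\<integral>w. h (Z 0 w) * L f (Z (max 0 s) w) \<partial>M))"
    unfolding G_def set_lebesgue_integral_def by simp
  finally have eq2: "(\<integral>w. h (Z 0 w) * (LBINT s:{0..t}. L f (Z s w)) \<partial>M)
    = (LBINT s:{0..t}. (\<integral>w. h (Z 0 w) * L f (Z (max 0 s) w) \<partial>M))" .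
  have "(\<integral>w. h (Z 0 w) * X t w \<partial>M) = (\<integral>w. h (Z 0 w) * f (Z t w) \<partial>M) - (\<integral>w. h (Z 0 w) * (LBINT s:{0..t}. L f (Z s w)) \<partial>M)"
    unfolding X_def right_diff_distrib by (rule Bochner_Integration.integral_diff[OF int1 int2])
  then show ?thesis using eq1 eq2 by simp
qed

lemma expectation_measurable:
  fixes f h :: "config \<Rightarrow> real"
  assumes "f \<in> borel_measurable PL" "continuous_on UNIV f" "h \<in> borel_measurable PL"
  shows "(\<lambda>s. \<integral>w. h (Z 0 w) * f (Z (max 0 s) w) \<partial>M) \<in> borel_measurable borel"
proof -
  have [measurable]: "(\<lambda>x. f (Z (max 0 (fst x)) (snd x))) \<in> borel_measurable (lborel \<Otimes>\<^sub>M M)"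
    using process_measurable[OF assms(1,2)] by (simp add: case_prod_unfold)
  have [measurable]: "(\<lambda>x. h (Z 0 (snd x))) \<in> borel_measurable (lborel \<Otimes>\<^sub>M M)"
    by (rule measurable_compose[OF measurable_snd measurable_compose[OF Z_measurable assms(3)]]) simp
  have "(\<lambda>s. \<integral>w. h (Z 0 w) * f (Z (max 0 s) w) \<partial>M) \<in> borel_measurable lborel"
    by (rule borel_measurable_lebesgue_integral) (simp add: case_prod_unfold)
  then show ?thesis by simp
qed

end

text \<open>Keeping the factor \<open>a\<close> inside the integral covers \<open>a = 0\<close> as
  well, where \<open>psi k\<close> or the noise strength vanishes.\<close>

lemma set_integral_exp_decay:
  fixes a :: real
  assumes "0 \<le> t"
  shows "(LBINT s:{0..t}. a * exp (- a * s)) = 1 - exp (- a * t)"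
proof -
  have "(LBINT s:{0..t}. a * exp (- a * s)) = (\<integral>s. (a * exp (- a * s)) * indicator {0..t} s \<partial>lborel)"
    unfolding set_lebesgue_integral_def by (rule Bochner_Integration.integral_cong) auto
  also have "\<dots> = - exp (- a * t) - (- exp (- a * 0))"
    by (rule integral_FTC_Icc_real[OF assms])
       (auto intro!: derivative_eq_intros continuous_intros)
  also have "\<dots> = 1 - exp (- a * t)" by simp
  finally show ?thesis .
qed

section \<open>Confinement to the surface and exponential decay of the modes\<close>

context chain
begin

lemma psi_nonneg: "0 \<le> psi k"
  unfolding psi_def by (auto intro!: add_nonneg_nonneg sum_nonneg)

abbreviation "J \<equiv> total_current d N \<alpha>"

text \<open>The error term left by the cut-off in \<open>generator_cut\<close>. It is bounded by 1
  and vanishes on the surface.\<close>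

definition surf :: "real \<Rightarrow> config \<Rightarrow> real" where
  "surf e \<eta> = (max 0 (1 - GG e \<eta>))\<^sup>2 * (kap * (\<Sum>j=1..d. Q j \<eta> * P j \<eta>))"

lemma QP_polys: "(\<lambda>\<eta>. kap * (\<Sum>j=1..d. Q j \<eta> * P j \<eta>)) \<in> polys A"
  by (intro polys_intros) simp_all

lemma surf_measurable: "surf e \<in> borel_measurable (phase_lborel d N)"
  unfolding surf_def[abs_def] phase_lborel_def
  by (intro borel_measurable_times borel_measurable_power borel_measurable_max borel_measurable_diff
      borel_measurable_const polys_measurable[OF GG_polys] polys_measurable[OF QP_polys])

lemma surf_continuous: "continuous_on UNIV (surf e)"
  unfolding surf_def[abs_def]
  by (rule continuous_on_mult)
     (intro continuous_intros Ck_continuous[OF Ck_GG[of 0]], rule Ck_continuous[OF polys_Ck[OF QP_polys, of 0]])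

lemma surf_bounded: "\<bar>surf e \<eta>\<bar> \<le> 1"
proof (cases "GG e \<eta> \<le> 1")
  case True
  have "\<bar>surf e \<eta>\<bar> \<le> 1 * (GG e \<eta> / 2)"
    unfolding surf_def abs_mult[of "(max 0 (1 - GG e \<eta>))\<^sup>2"]
    using kap_sum_QP_le[of \<eta> e] GG_nonneg[of e \<eta>] True by (intro mult_mono) (auto intro: power_le_one)
  then show ?thesis using True by simp
qed (simp add: surf_def)

lemma surf_support: "surf e \<eta> \<noteq> 0 \<Longrightarrow> GG e \<eta> \<le> 1"
  by (auto simp: surf_def max_def split: if_splits)

lemma surf_zero: "GG e \<eta> = 0 \<Longrightarrow> surf e \<eta> = 0"
  using kap_sum_QP_le[of \<eta> e] by (simp add: surf_def)

lemma cut_continuous: "continuous_on UNIV (cut e)"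
  by (rule Ck_continuous[OF Ck_cut])

end

context chain_diffusion
begin

text \<open>The expected deficit of the cut-off starts at 0 and is at most 3 times its own time
  integral, by Dynkin's formula and \<open>generator_cut_1_bound\<close>. Hence it vanishes, and the
  cut-off is almost surely 1.\<close>

lemma on_surface:
  assumes t: "0 \<le> t"
  shows "AE w in M. GG e (Z t w) = 0"
proof -
  define u where "u s = (\<integral>w. 1 * (1 - cut e (Z (max 0 s) w)) \<partial>M)" for s
  have Lcut: "L (cut e) = (\<lambda>\<eta>. - 6 * surf e \<eta>)"
    by (rule ext) (simp add: generator_cut_1 surf_def)
  have cutM: "(\<lambda>w. cut e (Z s w)) \<in> borel_measurable M" if "0 \<le> s" for s
    by (rule measurable_compose[OF Z_measurable[OF that] cut_measurable])
  have cut_int: "integrable M (\<lambda>w. cut e (Z s w))" if "0 \<le> s" for s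
    by (rule bounded_integrable[of _ 1]) (use cutM[OF that] cut_bounds in auto)
  have u_nonneg: "0 \<le> u s" for s
    unfolding u_def using cut_bounds by (intro Bochner_Integration.integral_nonneg) (simp add: algebra_simps)
  have u_alt: "u s = 1 - (\<integral>w. cut e (Z (max 0 s) w) \<partial>M)" for s
    unfolding u_def using cut_int[of "max 0 s"] by (simp add: Bochner_Integration.integral_diff prob_space)
  have u_le: "u s \<le> 1" for s
    unfolding u_alt using cut_bounds by (simp add: Bochner_Integration.integral_nonneg)
  have u_meas [measurable]: "u \<in> borel_measurable borel"
    unfolding u_def
  proof (rule expectation_measurable)
    show "(\<lambda>\<eta>. 1 - cut e \<eta>) \<in> borel_measurable PL" using cut_measurable[of e] by simp
    show "continuous_on UNIV (\<lambda>\<eta>. 1 - cut e \<eta>)" by (intro continuous_intros cut_continuous)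
  qed simp
  define g where "g s = (\<integral>w. 1 * L (cut e) (Z (max 0 s) w) \<partial>M)" for s
  have g_meas [measurable]: "g \<in> borel_measurable borel"
    unfolding g_def Lcut
    by (rule expectation_measurable)
       (intro borel_measurable_times borel_measurable_const surf_measurable continuous_intros surf_continuous)+
  have LM: "(\<lambda>w. L (cut e) (Z s w)) \<in> borel_measurable M" if "0 \<le> s" for s
    unfolding Lcut using measurable_compose[OF Z_measurable[OF that] surf_measurable[of e]] by simp
  have g_le: "\<bar>g s\<bar> \<le> 3 * u s" for s
  proof -
    have "\<bar>g s\<bar> \<le> (\<integral>w. \<bar>1 * L (cut e) (Z (max 0 s) w)\<bar> \<partial>M)"
      unfolding g_def using integral_norm_bound[of M "\<lambda>w. 1 * L (cut e) (Z (max 0 s) w)"] by simp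
    also have "\<dots> \<le> (\<integral>w. 3 * (1 - cut e (Z (max 0 s) w)) \<partial>M)"
    proof (rule integral_mono)
      show "integrable M (\<lambda>w. \<bar>1 * L (cut e) (Z (max 0 s) w)\<bar>)"
      proof (rule bounded_integrable[of _ 6])
        show "(\<lambda>w. \<bar>1 * L (cut e) (Z (max 0 s) w)\<bar>) \<in> borel_measurable M" using LM[of "max 0 s"] by simp
        show "\<bar>\<bar>1 * L (cut e) (Z (max 0 s) w)\<bar>\<bar> \<le> 6" for w
          using surf_bounded[of e "Z (max 0 s) w"] by (simp add: Lcut)
      qed
      show "integrable M (\<lambda>w. 3 * (1 - cut e (Z (max 0 s) w)))" using cut_int[of "max 0 s"] by simp
      show "\<bar>1 * L (cut e) (Z (max 0 s) w)\<bar> \<le> 3 * (1 - cut e (Z (max 0 s) w))" for w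
        using generator_cut_1_bound by simp
    qed
    also have "\<dots> = 3 * u s" unfolding u_def mult_1 by (rule integral_mult_right_zero)
    finally show ?thesis .
  qed
  have g3: "\<bar>g s\<bar> \<le> 3" for s using g_le[of s] u_le[of s] by linarith
  have u_eq: "u t = - (LBINT s:{0..t}. g s)" if t: "0 \<le> t" for t
  proof -
    have "(\<integral>w. 1 * cut e (Z t w) \<partial>M) = (\<integral>w. 1 * cut e (Z 0 w) \<partial>M) + (LBINT s:{0..t}. g s)"
      unfolding g_def
    proof (rule dynkin[where h = "\<lambda>_. 1" and ?K1.0 = 1 and ?K2.0 = 6 and ?K3.0 = 1])
      show "C2_fun d N (cut e)" "compactly_supported d N (cut e)"
        using cut_mult_test_function[of "\<lambda>_. 1" e] by simp_all
      show "L (cut e) \<in> borel_measurable PL" "continuous_on UNIV (L (cut e))"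
        unfolding Lcut using surf_measurable[of e] by (auto intro!: continuous_intros surf_continuous)
      show "\<bar>L (cut e) \<eta>\<bar> \<le> 6" for \<eta> unfolding Lcut using surf_bounded[of e \<eta>] by simp
      show "\<bar>cut e \<eta>\<bar> \<le> 1" for \<eta> using cut_bounds[of e \<eta>] by simp
    qed (use cut_measurable t in auto)
    moreover have "(\<integral>w. cut e (Z 0 w) \<partial>M) = (\<integral>w. 1 \<partial>M)"
    proof (rule integral_cong_AE)
      show "AE w in M. cut e (Z 0 w) = 1" using start by eventually_elim (rule cut_eq_1)
    qed (use cutM[of 0] in auto)
    ultimately show ?thesis using t by (simp add: u_alt prob_space)
  qed
  have "u t = 0"
  proof (rule gronwall_zero[of u 1 3])
    fix t :: real assume t: "0 \<le> t"
    have "\<bar>u t\<bar> = norm (LBINT s:{0..t}. g s)" unfolding u_eq[OF t] by simp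
    also have "\<dots> \<le> (LBINT s:{0..t}. norm (g s))"
      by (rule set_integral_norm_bound) (rule set_integrable_bounded[of _ 3], use g3 in auto)
    also have "\<dots> \<le> (LBINT s:{0..t}. 3 * \<bar>u s\<bar>)"
    proof (rule set_integral_mono)
      show "set_integrable lborel {0..t} (\<lambda>s. norm (g s))"
        by (rule set_integrable_bounded[of _ 3]) (use g3 in auto)
      show "set_integrable lborel {0..t} (\<lambda>s. 3 * \<bar>u s\<bar>)"
        by (rule set_integrable_bounded[of _ 3]) (use u_le u_nonneg in auto)
      show "norm (g s) \<le> 3 * \<bar>u s\<bar>" for s using g_le[of s] u_nonneg[of s] by simp
    qed
    also have "\<dots> = 3 * (LBINT s:{0..t}. \<bar>u s\<bar>)" by simp
    finally show "\<bar>u t\<bar> \<le> 3 * (LBINT s:{0..t}. \<bar>u s\<bar>)" .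
  qed (use u_le u_nonneg t in auto)
  then have "(\<integral>w. 1 - cut e (Z t w) \<partial>M) = 0" using t by (simp add: u_def)
  moreover have "integrable M (\<lambda>w. 1 - cut e (Z t w))" using cut_int[OF t] by simp
  ultimately have "AE w in M. 1 - cut e (Z t w) = 0"
    using integral_nonneg_eq_0_iff_AE[of M "\<lambda>w. 1 - cut e (Z t w)"] cut_bounds by simp
  then show ?thesis
  proof eventually_elim
    fix w assume "1 - cut e (Z t w) = 0"
    then have c: "max 0 (1 - GG e (Z t w)) ^ 3 = 1" by (simp add: cut_def)
    have "1 \<le> max 0 (1 - GG e (Z t w))"
    proof (rule ccontr)
      assume "\<not> ?thesis"
      then have "max 0 (1 - GG e (Z t w)) ^ 3 < 1 ^ 3" by (intro power_strict_mono) auto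
      with c show False by simp
    qed
    then show "GG e (Z t w) = 0" using GG_nonneg[of e "Z t w"] by simp
  qed
qed

text \<open>On the bounded surface, to which the process is confined, polynomials are almost surely
  bounded.\<close>

lemma poly_integrable:
  assumes "F \<in> polys A" "G \<in> polys A" "0 \<le> t"
  shows "integrable M (\<lambda>w. F (Z t w) * G (Z 0 w))"
proof -
  obtain K1 where K1: "\<And>\<eta>. GG e \<eta> \<le> 1 \<Longrightarrow> \<bar>F \<eta>\<bar> \<le> K1" using polys_bounded_GG[OF assms(1)] by blast
  obtain K2 where K2: "\<And>\<eta>. GG e \<eta> \<le> 1 \<Longrightarrow> \<bar>G \<eta>\<bar> \<le> K2" using polys_bounded_GG[OF assms(2)] by blast
  have F: "(\<lambda>w. F (Z t w)) \<in> borel_measurable M"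
    by (rule measurable_compose[OF Z_measurable[OF assms(3)]]) (simp add: phase_lborel_def polys_measurable assms(1))
  have G: "(\<lambda>w. G (Z 0 w)) \<in> borel_measurable M"
    by (rule measurable_compose[OF Z_measurable]) (simp_all add: phase_lborel_def polys_measurable assms(2))
  show ?thesis
  proof (rule integrable_const_bound)
    show "AE w in M. norm (F (Z t w) * G (Z 0 w)) \<le> \<bar>K1\<bar> * \<bar>K2\<bar>"
      using on_surface[OF assms(3)] start
    proof eventually_elim
      fix w assume "GG e (Z t w) = 0" "GG e (Z 0 w) = 0"
      then have "\<bar>F (Z t w)\<bar> \<le> \<bar>K1\<bar>" "\<bar>G (Z 0 w)\<bar> \<le> \<bar>K2\<bar>"
        using K1[of "Z t w"] K2[of "Z 0 w"] by auto
      then show "norm (F (Z t w) * G (Z 0 w)) \<le> \<bar>K1\<bar> * \<bar>K2\<bar>" by (auto simp: abs_mult intro!: mult_mono)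
    qed
  qed (use F G in simp)
qed

text \<open>Both factors are cut off so that \<open>dynkin\<close> applies; on the surface the
  cut-off is 1 and the error \<open>surf\<close> is 0, leaving the integral equation of an
  exponential.\<close>

lemma mode_correlation:
  assumes t: "0 \<le> t" and \<gamma>: "0 \<le> \<gamma>"
  shows "(\<integral>w. JJ k (Z t w) * J (Z 0 w) \<partial>M) = exp (- \<gamma> * psi k * t) * (\<integral>w. JJ k (Z 0 w) * J (Z 0 w) \<partial>M)"
proof -
  define h where "h \<eta> = J \<eta> * cut e \<eta>" for \<eta>
  define f where "f \<eta> = JJ k \<eta> * cut e \<eta>" for \<eta>
  define lam where "lam = \<gamma> * psi k"
  have lam: "0 \<le> lam" unfolding lam_def using \<gamma> psi_nonneg by simp
  obtain Kh where Kh: "\<And>\<eta>. \<bar>h \<eta>\<bar> \<le> Kh" "0 \<le> Kh" unfolding h_def using cut_mult_bounded[OF total_current_polys] by blast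
  obtain Kf where Kf: "\<And>\<eta>. \<bar>f \<eta>\<bar> \<le> Kf" "0 \<le> Kf" unfolding f_def using cut_mult_bounded[OF JJ_polys] by blast
  obtain Kj where Kj: "\<And>\<eta>. GG e \<eta> \<le> 1 \<Longrightarrow> \<bar>JJ k \<eta>\<bar> \<le> Kj" using polys_bounded_GG[OF JJ_polys] by blast
  have JM: "JJ k \<in> borel_measurable PL" "J \<in> borel_measurable PL"
    by (simp_all add: phase_lborel_def polys_measurable)
  have hM: "h \<in> borel_measurable PL" unfolding h_def[abs_def] using JM(2) cut_measurable[of e] by simp
  have fM: "f \<in> borel_measurable PL" unfolding f_def[abs_def] using JM(1) cut_measurable[of e] by simp
  have fc: "continuous_on UNIV f"
    unfolding f_def[abs_def] by (intro continuous_on_mult cut_continuous Ck_continuous[OF Ck_JJ])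
  have Lf: "L f = (\<lambda>\<eta>. - lam * f \<eta> - 6 * (JJ k \<eta> * surf e \<eta>))"
    unfolding f_def[abs_def] by (rule ext) (simp add: generator_cut_JJ surf_def lam_def)
  have JS: "\<bar>JJ k \<eta> * surf e \<eta>\<bar> \<le> \<bar>Kj\<bar>" for \<eta>
  proof (cases "surf e \<eta> = 0")
    case False
    then have "\<bar>JJ k \<eta>\<bar> * \<bar>surf e \<eta>\<bar> \<le> \<bar>Kj\<bar> * 1"
      using Kj[OF surf_support[OF False]] surf_bounded[of e \<eta>] by (intro mult_mono) auto
    then show ?thesis by (simp add: abs_mult)
  qed simp
  have LfM: "L f \<in> borel_measurable PL"
    unfolding Lf using fM JM(1) surf_measurable[of e] by simp
  define r where "r s = (\<integral>w. h (Z 0 w) * f (Z (max 0 s) w) \<partial>M)" for s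
  have r_meas [measurable]: "r \<in> borel_measurable borel"
    unfolding r_def by (rule expectation_measurable[OF fM fc hM])
  \<comment> \<open>Confinement is used here: the eigenvalue equation fails pointwise for the
    cut-off observable but holds almost surely along the process.\<close>
  have drift: "(\<integral>w. h (Z 0 w) * L f (Z s w) \<partial>M) = - lam * (\<integral>w. h (Z 0 w) * f (Z s w) \<partial>M)" if s: "0 \<le> s" for s
  proof -
    have [measurable]: "(\<lambda>w. h (Z 0 w)) \<in> borel_measurable M" "(\<lambda>w. f (Z s w)) \<in> borel_measurable M" "(\<lambda>w. L f (Z s w)) \<in> borel_measurable M"
      by (rule measurable_compose[OF Z_measurable hM] measurable_compose[OF Z_measurable fM] measurable_compose[OF Z_measurable LfM], simp add: s)+
    have "(\<integral>w. h (Z 0 w) * L f (Z s w) \<partial>M) = (\<integral>w. - lam * (h (Z 0 w) * f (Z s w)) \<partial>M)"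
    proof (rule integral_cong_AE)
      show "AE w in M. h (Z 0 w) * L f (Z s w) = - lam * (h (Z 0 w) * f (Z s w))"
        using on_surface[OF s] by eventually_elim (simp add: Lf surf_zero)
    qed simp_all
    then show ?thesis by simp
  qed
  have r_eq: "r t = r 0 - lam * (LBINT s:{0..t}. r s)" if t: "0 \<le> t" for t
  proof -
    have "(\<integral>w. h (Z 0 w) * f (Z t w) \<partial>M) = (\<integral>w. h (Z 0 w) * f (Z 0 w) \<partial>M)
       + (LBINT s:{0..t}. (\<integral>w. h (Z 0 w) * L f (Z (max 0 s) w) \<partial>M))"
    proof (rule dynkin[OF _ _ fM Kf(1) LfM _ _ hM Kh(1) t])
      show "C2_fun d N f" "compactly_supported d N f"
        unfolding f_def[abs_def] by (intro cut_mult_test_function JJ_polys)+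
      show "continuous_on UNIV (L f)"
        unfolding Lf by (intro continuous_intros fc surf_continuous Ck_continuous[OF Ck_JJ])
      show "\<bar>L f \<eta>\<bar> \<le> lam * Kf + 6 * \<bar>Kj\<bar>" for \<eta>
      proof -
        have "\<bar>lam * f \<eta>\<bar> \<le> lam * Kf" using Kf(1)[of \<eta>] lam by (simp add: abs_mult mult_left_mono)
        then show ?thesis unfolding Lf using JS[of \<eta>] by linarith
      qed
    qed
    also have "(LBINT s:{0..t}. (\<integral>w. h (Z 0 w) * L f (Z (max 0 s) w) \<partial>M)) = (LBINT s:{0..t}. - lam * r s)"
      unfolding r_def drift[OF max.cobounded1] ..
    also have "\<dots> = - lam * (LBINT s:{0..t}. r s)" by (rule set_integral_mult_right)
    finally show ?thesis using t by (simp add: r_def)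
  qed
  have r_bound: "\<bar>r s\<bar> \<le> Kh * Kf" for s
  proof -
    have "\<bar>r s\<bar> \<le> (\<integral>w. \<bar>h (Z 0 w) * f (Z (max 0 s) w)\<bar> \<partial>M)"
      unfolding r_def using integral_norm_bound[of M "\<lambda>w. h (Z 0 w) * f (Z (max 0 s) w)"] by simp
    also have "\<dots> \<le> Kh * Kf"
    proof (rule integral_le_const)
      have "(\<lambda>w. h (Z 0 w)) \<in> borel_measurable M" "(\<lambda>w. f (Z (max 0 s) w)) \<in> borel_measurable M"
        by (rule measurable_compose[OF Z_measurable hM] measurable_compose[OF Z_measurable fM], simp)+
      then show "integrable M (\<lambda>w. \<bar>h (Z 0 w) * f (Z (max 0 s) w)\<bar>)"
        by (intro bounded_integrable[of _ "Kh * Kf"]) (use Kh Kf in \<open>auto simp: abs_mult intro!: mult_mono\<close>)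
      show "AE w in M. \<bar>h (Z 0 w) * f (Z (max 0 s) w)\<bar> \<le> Kh * Kf"
        using Kh Kf by (auto simp: abs_mult intro!: mult_mono)
    qed
    finally show ?thesis .
  qed
  \<comment> \<open>The difference from the expected exponential satisfies the homogeneous integral
    equation, so Gronwall gives uniqueness.\<close>
  define v where "v s = r s - r 0 * exp (- lam * s)" for s
  have v_meas [measurable]: "v \<in> borel_measurable borel" unfolding v_def by measurable
  have v_bound: "\<bar>v s\<bar> \<le> 2 * (Kh * Kf)" if "0 \<le> s" for s
  proof -
    have "\<bar>r 0 * exp (- lam * s)\<bar> \<le> (Kh * Kf) * 1"
      unfolding abs_mult using r_bound[of 0] lam that Kh(2) Kf(2) by (intro mult_mono) auto
    then show ?thesis unfolding v_def using r_bound[of s] by linarith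
  qed
  have v_int: "set_integrable lborel {0..t} v" for t
    by (rule set_integrable_bounded[OF v_meas v_bound])
  have v_eq: "v t = - lam * (LBINT s:{0..t}. v s)" if t: "0 \<le> t" for t
  proof -
    have ri: "set_integrable lborel {0..t} r" by (rule set_integrable_bounded[OF r_meas r_bound])
    have "set_integrable lborel {0..t} (\<lambda>s. r 0 * exp (- lam * s))"
      by (rule borel_integrable_atLeastAtMost') (intro continuous_intros)
    then have "(LBINT s:{0..t}. v s) = (LBINT s:{0..t}. r s) - (LBINT s:{0..t}. r 0 * exp (- lam * s))"
      unfolding v_def using ri by (intro set_integral_diff)
    then have "lam * (LBINT s:{0..t}. v s) = lam * (LBINT s:{0..t}. r s) - r 0 * (lam * (LBINT s:{0..t}. exp (- lam * s)))"
      unfolding set_integral_mult_right by (simp only: right_diff_distrib mult.left_commute)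
    also have "lam * (LBINT s:{0..t}. exp (- lam * s)) = 1 - exp (- lam * t)"
      using set_integral_exp_decay[OF t, of lam] unfolding set_integral_mult_right .
    finally show ?thesis using r_eq[OF t] by (simp add: v_def algebra_simps)
  qed
  have "v t = 0"
  proof (rule gronwall_zero[OF v_meas v_bound lam])
    fix t :: real assume t: "0 \<le> t"
    have "\<bar>v t\<bar> = lam * norm (LBINT s:{0..t}. v s)" unfolding v_eq[OF t] using lam by (simp add: abs_mult)
    also have "\<dots> \<le> lam * (LBINT s:{0..t}. norm (v s))"
      by (intro mult_left_mono set_integral_norm_bound v_int lam)
    finally show "\<bar>v t\<bar> \<le> lam * (LBINT s:{0..t}. \<bar>v s\<bar>)" by simp
  qed (use t in auto)
  then have main: "r t = r 0 * exp (- lam * t)" by (simp add: v_def)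
  have "(\<integral>w. JJ k (Z s w) * J (Z 0 w) \<partial>M) = r s" if s: "0 \<le> s" for s
    unfolding r_def
  proof (rule integral_cong_AE)
    show "AE w in M. JJ k (Z s w) * J (Z 0 w) = h (Z 0 w) * f (Z (max 0 s) w)"
      using on_surface[OF s] start by eventually_elim (use s in \<open>simp add: h_def f_def cut_eq_1\<close>)
    show "(\<lambda>w. JJ k (Z s w) * J (Z 0 w)) \<in> borel_measurable M"
      using poly_integrable[OF JJ_polys total_current_polys s] by simp
    have "(\<lambda>w. h (Z 0 w)) \<in> borel_measurable M" "(\<lambda>w. f (Z (max 0 s) w)) \<in> borel_measurable M"
      by (rule measurable_compose[OF Z_measurable hM] measurable_compose[OF Z_measurable fM], simp)+
    then show "(\<lambda>w. h (Z 0 w) * f (Z (max 0 s) w)) \<in> borel_measurable M" by simp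
  qed
  from this[OF t] this[of 0] show ?thesis unfolding main by (simp add: lam_def mult.commute)
qed

text \<open>Only the current at time \<open>t\<close> is expanded in modes; the one at time 0 stays
  whole, so a single sum and static moments with the full current suffice.\<close>

lemma current_correlation:
  assumes t: "0 \<le> t" and \<gamma>: "0 \<le> \<gamma>"
  shows "(\<integral>w. J (Z t w) * J (Z 0 w) \<partial>M)
    = - \<alpha> / real (N ^ d) * (\<Sum>k\<in>S. sin (freq N k 1) * (exp (- \<gamma> * psi k * t) * (\<integral>\<eta>. JJ k \<eta> * J \<eta> \<partial>distr M PL (Z 0))))"
proof -
  have "(\<integral>w. J (Z t w) * J (Z 0 w) \<partial>M)
    = (\<integral>w. (\<Sum>k\<in>S. (- \<alpha> / real (N ^ d) * sin (freq N k 1)) * (JJ k (Z t w) * J (Z 0 w))) \<partial>M)"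
    unfolding total_current_modes[of "Z t _"] by (simp only: sum_distrib_left sum_distrib_right mult.assoc)
  also have "\<dots> = (\<Sum>k\<in>S. (- \<alpha> / real (N ^ d) * sin (freq N k 1)) * (\<integral>w. JJ k (Z t w) * J (Z 0 w) \<partial>M))"
    by (subst Bochner_Integration.integral_sum)
       (intro integrable_mult_right poly_integrable JJ_polys total_current_polys t, simp)
  also have "\<dots> = (\<Sum>k\<in>S. (- \<alpha> / real (N ^ d) * sin (freq N k 1)) * (exp (- \<gamma> * psi k * t) * (\<integral>\<eta>. JJ k \<eta> * J \<eta> \<partial>distr M PL (Z 0))))"
  proof (intro sum.cong refl arg_cong2[where f="(*)"])
    fix k
    have "(\<integral>\<eta>. JJ k \<eta> * J \<eta> \<partial>distr M PL (Z 0)) = (\<integral>w. JJ k (Z 0 w) * J (Z 0 w) \<partial>M)"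
      by (rule integral_distr[OF Z_measurable])
         (simp_all add: phase_lborel_def polys_measurable[OF polys.mult[OF JJ_polys total_current_polys]])
    then show "(\<integral>w. JJ k (Z t w) * J (Z 0 w) \<partial>M) = exp (- \<gamma> * psi k * t) * (\<integral>\<eta>. JJ k \<eta> * J \<eta> \<partial>distr M PL (Z 0))"
      using mode_correlation[OF t \<gamma>] by simp
  qed
  finally show ?thesis by (simp only: sum_distrib_left mult.assoc)
qed

end

section \<open>The divergence theorem on thin shells\<close>

text \<open>The class of integrands that become Lebesgue integrable once their support is bounded;
  unlike \<open>polys\<close> it admits the cut-offs and their derivatives.\<close>

definition tame :: "coord set \<Rightarrow> (config \<Rightarrow> real) \<Rightarrow> bool" where
  "tame A f \<longleftrightarrow> f \<in> borel_measurable (PiM A (\<lambda>_. lborel)) \<and>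
     (\<forall>R. \<exists>K. \<forall>\<eta>. (\<forall>c\<in>A. \<bar>\<eta> c\<bar> \<le> R) \<longrightarrow> \<bar>f \<eta>\<bar> \<le> K)"

definition tame_C1 :: "coord set \<Rightarrow> (config \<Rightarrow> real) \<Rightarrow> bool" where
  "tame_C1 A f \<longleftrightarrow> C1 f \<and> tame A f \<and> (\<forall>c. tame A (pd c f))"

lemma tame_polys: "f \<in> polys A \<Longrightarrow> tame A f"
  unfolding tame_def using polys_measurable polys_bounded by blast

lemma tame_add:
  assumes "tame A f" "tame A g"
  shows "tame A (\<lambda>\<eta>. f \<eta> + g \<eta>)"
  unfolding tame_def
proof (intro conjI allI)
  show "(\<lambda>\<eta>. f \<eta> + g \<eta>) \<in> borel_measurable (PiM A (\<lambda>_. lborel))"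
    using assms unfolding tame_def by (intro borel_measurable_add) auto
  fix R
  obtain K L where "\<And>\<eta>. (\<forall>c\<in>A. \<bar>\<eta> c\<bar> \<le> R) \<Longrightarrow> \<bar>f \<eta>\<bar> \<le> K" "\<And>\<eta>. (\<forall>c\<in>A. \<bar>\<eta> c\<bar> \<le> R) \<Longrightarrow> \<bar>g \<eta>\<bar> \<le> L"
    using assms unfolding tame_def by metis
  then show "\<exists>K. \<forall>\<eta>. (\<forall>c\<in>A. \<bar>\<eta> c\<bar> \<le> R) \<longrightarrow> \<bar>f \<eta> + g \<eta>\<bar> \<le> K"
    by (intro exI[of _ "K + L"] allI impI order_trans[OF abs_triangle_ineq] add_mono) auto
qed

lemma tame_mult:
  assumes "tame A f" "tame A g"
  shows "tame A (\<lambda>\<eta>. f \<eta> * g \<eta>)"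
  unfolding tame_def
proof (intro conjI allI)
  show "(\<lambda>\<eta>. f \<eta> * g \<eta>) \<in> borel_measurable (PiM A (\<lambda>_. lborel))"
    using assms unfolding tame_def by (intro borel_measurable_times) auto
  fix R
  obtain K L where "\<And>\<eta>. (\<forall>c\<in>A. \<bar>\<eta> c\<bar> \<le> R) \<Longrightarrow> \<bar>f \<eta>\<bar> \<le> K" "\<And>\<eta>. (\<forall>c\<in>A. \<bar>\<eta> c\<bar> \<le> R) \<Longrightarrow> \<bar>g \<eta>\<bar> \<le> L"
    using assms unfolding tame_def by metis
  then have "\<And>\<eta>. (\<forall>c\<in>A. \<bar>\<eta> c\<bar> \<le> R) \<Longrightarrow> \<bar>f \<eta>\<bar> * \<bar>g \<eta>\<bar> \<le> \<bar>K\<bar> * \<bar>L\<bar>"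
    by (intro mult_mono) (auto intro: order_trans[OF _ abs_ge_self])
  then show "\<exists>K. \<forall>\<eta>. (\<forall>c\<in>A. \<bar>\<eta> c\<bar> \<le> R) \<longrightarrow> \<bar>f \<eta> * g \<eta>\<bar> \<le> K"
    unfolding abs_mult by blast
qed

lemma tame_const: "tame A (\<lambda>_. a)"
  by (rule tame_polys) simp

lemma tame_power: "tame A f \<Longrightarrow> tame A (\<lambda>\<eta>. f \<eta> ^ n)"
  by (induction n) (auto intro: tame_mult tame_const)

lemma tame_pospart:
  assumes "tame A f"
  shows "tame A (\<lambda>\<eta>. max 0 (f \<eta>))"
  unfolding tame_def
proof (intro conjI allI)
  show "(\<lambda>\<eta>. max 0 (f \<eta>)) \<in> borel_measurable (PiM A (\<lambda>_. lborel))"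
    using assms unfolding tame_def by (intro borel_measurable_max) auto
  fix R
  obtain K where "\<And>\<eta>. (\<forall>c\<in>A. \<bar>\<eta> c\<bar> \<le> R) \<Longrightarrow> \<bar>f \<eta>\<bar> \<le> K" using assms unfolding tame_def by metis
  then show "\<exists>K. \<forall>\<eta>. (\<forall>c\<in>A. \<bar>\<eta> c\<bar> \<le> R) \<longrightarrow> \<bar>max 0 (f \<eta>)\<bar> \<le> K"
    by (intro exI[of _ K] allI impI) (force simp: max_def abs_if split: if_splits)
qed

lemma tame_C1_polys: "f \<in> polys A \<Longrightarrow> tame_C1 A f"
  unfolding tame_C1_def by (auto intro: tame_polys polys_Ck polys_pd)

lemma tame_C1_mult: "tame_C1 A f \<Longrightarrow> tame_C1 A g \<Longrightarrow> tame_C1 A (\<lambda>\<eta>. f \<eta> * g \<eta>)"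
  unfolding tame_C1_def by (auto simp: pd_mult intro!: tame_add tame_mult)

lemma tame_C1_add: "tame_C1 A f \<Longrightarrow> tame_C1 A g \<Longrightarrow> tame_C1 A (\<lambda>\<eta>. f \<eta> + g \<eta>)"
  unfolding tame_C1_def by (auto simp: pd_add intro!: tame_add)

lemma tame_C1_const: "tame_C1 A (\<lambda>_. a)"
  by (rule tame_C1_polys) simp

lemma tame_C1_diff: "tame_C1 A f \<Longrightarrow> tame_C1 A g \<Longrightarrow> tame_C1 A (\<lambda>\<eta>. f \<eta> - g \<eta>)"
  using tame_C1_add[of A f "\<lambda>\<eta>. -1 * g \<eta>"] tame_C1_mult[of A "\<lambda>_. -1" g] tame_C1_const by simp

lemma tame_C1_power: "tame_C1 A f \<Longrightarrow> tame_C1 A (\<lambda>\<eta>. f \<eta> ^ n)"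
  by (induction n) (auto intro: tame_C1_mult tame_C1_const)

lemma tame_C1_prod: "(\<And>i. i \<in> I \<Longrightarrow> tame_C1 A (f i)) \<Longrightarrow> tame_C1 A (\<lambda>\<eta>. \<Prod>i\<in>I. f i \<eta>)"
  by (induction I rule: infinite_finite_induct) (auto intro: tame_C1_mult tame_C1_const)

lemma DERIV_pospart_square: "((\<lambda>y::real. (max 0 y)\<^sup>2) has_real_derivative 2 * max 0 y) (at y)"
  using DERIV_pospart_power[of 0 y] by (simp add: numeral_2_eq_2)

lemma tame_C1_pospart_square:
  assumes "tame_C1 A f"
  shows "tame_C1 A (\<lambda>\<eta>. (max 0 (f \<eta>))\<^sup>2)"
  unfolding tame_C1_def
proof (intro conjI allI)
  have f: "C1 f" "tame A f" "\<And>c. tame A (pd c f)" using assms by (auto simp: tame_C1_def)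
  show "C1 (\<lambda>\<eta>. (max 0 (f \<eta>))\<^sup>2)" using Ck_pospart_power[OF f(1)] by (simp add: numeral_2_eq_2)
  show "tame A (\<lambda>\<eta>. (max 0 (f \<eta>))\<^sup>2)" by (intro tame_power tame_pospart f)
  show "tame A (pd c (\<lambda>\<eta>. (max 0 (f \<eta>))\<^sup>2))" for c
    unfolding pd_chain[OF f(1) DERIV_pospart_square] by (intro tame_mult tame_const tame_pospart f)
qed

lemma tame_integrable:
  assumes "finite A" "tame A f" and supp: "\<And>\<eta>. f \<eta> \<noteq> 0 \<Longrightarrow> \<forall>c\<in>A. \<bar>\<eta> c\<bar> \<le> R"
  shows "integrable (PiM A (\<lambda>_. lborel)) f"
proof -
  let ?M = "PiM A (\<lambda>_. lborel :: real measure)" and ?B = "A \<rightarrow>\<^sub>E {-R..R}"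
  interpret product_sigma_finite "\<lambda>_. lborel :: real measure" ..
  obtain K where K: "\<And>\<eta>. (\<forall>c\<in>A. \<bar>\<eta> c\<bar> \<le> R) \<Longrightarrow> \<bar>f \<eta>\<bar> \<le> K" using assms(2) unfolding tame_def by metis
  have B: "?B \<in> sets ?M" by (intro sets_PiM_I_finite assms(1)) auto
  have "emeasure ?M ?B = (\<Prod>i\<in>A. emeasure lborel {-R..R})" by (rule emeasure_PiM[OF assms(1)]) auto
  also have "\<dots> < \<top>" by (auto simp: emeasure_lborel_Icc_eq power_eq_top_ennreal less_top[symmetric])
  finally have "integrable ?M (\<lambda>\<eta>. \<bar>K\<bar> * indicator ?B \<eta> :: real)"
    using B by (intro integrable_mult_right integrable_real_indicator) auto
  then show ?thesis
  proof (rule Bochner_Integration.integrable_bound)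
    show "f \<in> borel_measurable ?M" using assms(2) by (simp add: tame_def)
    show "AE \<eta> in ?M. norm (f \<eta>) \<le> norm (\<bar>K\<bar> * indicator ?B \<eta> :: real)"
    proof (rule AE_I2)
      fix \<eta> assume "\<eta> \<in> space ?M"
      then have "\<eta> \<in> ?B" if "f \<eta> \<noteq> 0" using supp[OF that] by (auto simp: space_PiM PiE_iff abs_le_iff)
      then show "norm (f \<eta>) \<le> norm (\<bar>K\<bar> * indicator ?B \<eta> :: real)"
        using K[of \<eta>] supp[of \<eta>] by (cases "f \<eta> = 0") auto
    qed
  qed
qed

text \<open>A zero of a nonnegative function is a minimum. Thus the derivatives of a cut-off vanish
  wherever the cut-off does, so they have no larger support.\<close>

lemma pd_zero_at_min:
  assumes "C1 f" "\<And>\<eta>. 0 \<le> f \<eta>" "f \<eta> = 0"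
  shows "pd c f \<eta> = 0"
proof (rule DERIV_local_min[of "\<lambda>s. f (\<eta>(c := s))" _ "\<eta> c" 1])
  show "((\<lambda>s. f (\<eta>(c := s))) has_real_derivative pd c f \<eta>) (at (\<eta> c))"
    using Ck_has_pd[OF assms(1), of c] by (simp add: has_pd_def)
qed (use assms in auto)

text \<open>Fubini isolates the coordinate \<open>c\<close>, and the fundamental theorem of calculus
  leaves boundary values outside the support.\<close>

lemma integral_pd_zero:
  assumes A: "finite A" "c \<in> A" and f: "C1 f" and int: "integrable (PiM A (\<lambda>_. lborel)) (pd c f)"
    and supp: "\<And>\<eta>. f \<eta> \<noteq> 0 \<Longrightarrow> \<bar>\<eta> c\<bar> \<le> R"
  shows "(\<integral>\<eta>. pd c f \<eta> \<partial>PiM A (\<lambda>_. lborel)) = 0"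
proof -
  interpret product_sigma_finite "\<lambda>_. lborel :: real measure" ..
  define B where "B = A - {c}"
  have AB: "A = insert c B" "c \<notin> B" "finite B" using A by (auto simp: B_def)
  have "(\<integral>s. pd c f (\<eta>(c := s)) \<partial>lborel) = 0" for \<eta>
  proof -
    \<comment> \<open>Strictly larger than \<open>R\<close>, so that the function vanishes at both
      end points and its derivative beyond them.\<close>
    define r where "r = \<bar>R\<bar> + 1"
    have deriv: "((\<lambda>s. f (\<eta>(c := s))) has_real_derivative pd c f (\<eta>(c := s))) (at s)" for s
      by (rule has_pd_at[OF Ck_has_pd[OF f]])
    have zero: "f (\<eta>(c := s)) = 0" if "\<bar>s\<bar> > R" for s using supp[of "\<eta>(c := s)"] that by force
    have dzero: "pd c f (\<eta>(c := s)) = 0" if s: "\<bar>s\<bar> > R" for s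
    proof (rule DERIV_unique[OF deriv])
      have "open {s::real. \<bar>s\<bar> > R}" by (intro open_Collect_less continuous_intros)
      then have "eventually (\<lambda>s. \<bar>s\<bar> > R) (nhds s)" using s eventually_nhds_in_open[of "{s. \<bar>s\<bar> > R}" s] by simp
      then have ev: "eventually (\<lambda>s. f (\<eta>(c := s)) = 0) (nhds s)" by eventually_elim (rule zero)
      show "((\<lambda>s. f (\<eta>(c := s))) has_real_derivative 0) (at s)"
        using DERIV_cong_ev[OF refl ev refl] by simp
    qed
    have cont: "continuous_on UNIV (\<lambda>s. pd c f (\<eta>(c := s)))"
    proof (rule continuous_on_compose2[OF Ck_continuous[OF Ck_pd[OF f]]])
      show "continuous_on UNIV (\<lambda>s. \<eta>(c := s))"
      proof (rule continuous_on_coordinatewise_then_product)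
        fix i show "continuous_on UNIV (\<lambda>s. (\<eta>(c := s)) i)" by (cases "i = c") simp_all
      qed
    qed auto
    have "(\<integral>s. pd c f (\<eta>(c := s)) \<partial>lborel) = (\<integral>s. pd c f (\<eta>(c := s)) * indicator {-r..r} s \<partial>lborel)"
    proof (intro Bochner_Integration.integral_cong refl)
      fix s
      have "pd c f (\<eta>(c := s)) = 0" if "s \<notin> {-r..r}" using dzero[of s] that by (auto simp: r_def)
      then show "pd c f (\<eta>(c := s)) = pd c f (\<eta>(c := s)) * indicator {-r..r} s"
        by (cases "s \<in> {-r..r}") auto
    qed
    also have "\<dots> = f (\<eta>(c := r)) - f (\<eta>(c := - r))"
      by (rule integral_FTC_Icc_real[OF _ deriv]) (use cont in \<open>auto simp: r_def continuous_on_eq_continuous_at\<close>)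
    also have "\<dots> = 0" using zero[of r] zero[of "- r"] by (simp add: r_def)
    finally show ?thesis .
  qed
  then show ?thesis
    using product_integral_insert[OF AB(3,2) int[unfolded AB(1)]] unfolding AB(1) by simp
qed

section \<open>Divergence, bump functions and integration over shells\<close>

definition dvg :: "coord set \<Rightarrow> (coord \<Rightarrow> config \<Rightarrow> real) \<Rightarrow> config \<Rightarrow> real" where
  "dvg A V \<eta> = (\<Sum>c\<in>A. pd c (V c) \<eta>)"

definition bump :: "real \<Rightarrow> real \<Rightarrow> real" where
  "bump \<delta> s = (max 0 (1 - (s / \<delta>)\<^sup>2))\<^sup>2"

lemma bump_bounds: "0 \<le> bump \<delta> s" "bump \<delta> s \<le> 1"
  by (auto simp: bump_def intro: power_le_one)

lemma bump_eq_0_iff: "0 < \<delta> \<Longrightarrow> bump \<delta> s = 0 \<longleftrightarrow> \<delta> \<le> \<bar>s\<bar>"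
proof -
  assume \<delta>: "0 < \<delta>"
  have "bump \<delta> s = 0 \<longleftrightarrow> 1 \<le> (s / \<delta>)\<^sup>2" by (simp add: bump_def max_def)
  also have "\<dots> \<longleftrightarrow> 1 \<le> \<bar>s / \<delta>\<bar>" using abs_le_square_iff[of 1 "s / \<delta>"] by simp
  also have "\<dots> \<longleftrightarrow> \<delta> \<le> \<bar>s\<bar>" using \<delta> by (simp add: abs_divide)
  finally show ?thesis .
qed

lemma tame_C1_bump: "f \<in> polys A \<Longrightarrow> tame_C1 A (\<lambda>\<eta>. bump \<delta> (f \<eta>))"
  unfolding bump_def
  by (intro tame_C1_pospart_square tame_C1_polys polys_diff polys_power polys.const)
     (use polys.mult[OF polys.const[of "1 / \<delta>"]] in simp)

lemma deriv_bump:
  assumes D: "derivation D" and "C1 f" "D f = (\<lambda>_. 0)"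
  shows "D (\<lambda>\<eta>. bump \<delta> (f \<eta>)) = (\<lambda>_. 0)"
proof -
  have "((\<lambda>s. bump \<delta> s) has_real_derivative 2 * max 0 (1 - (s / \<delta>)\<^sup>2) * (- 2 * s / \<delta>\<^sup>2)) (at s)" for s
  proof -
    have "((\<lambda>s. 1 - (s / \<delta>)\<^sup>2) has_real_derivative (- 2 * s / \<delta>\<^sup>2)) (at s)"
    proof -
      have "((\<lambda>s. s\<^sup>2 / \<delta>\<^sup>2) has_real_derivative 2 * s / \<delta>\<^sup>2) (at s)"
        by (rule DERIV_cdivide) (auto intro!: derivative_eq_intros)
      then have "((\<lambda>s. 1 - s\<^sup>2 / \<delta>\<^sup>2) has_real_derivative 0 - 2 * s / \<delta>\<^sup>2) (at s)"
        by (intro DERIV_diff DERIV_const)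
      then show ?thesis by (simp add: power_divide)
    qed
    from DERIV_chain2[OF DERIV_pospart_square this] show ?thesis by (simp add: bump_def)
  qed
  from deriv_chain[OF D assms(2) this] show ?thesis by (simp add: assms(3))
qed

context chain
begin

text \<open>A C1 function of the conserved quantities whose nonzero set is exactly the open shell
  (\<open>shell_eq\<close>). With pinning the product is empty, in accordance with the missing
  constraints.\<close>

definition weight :: "real \<Rightarrow> real \<Rightarrow> config \<Rightarrow> real" where
  "weight e \<delta> \<eta> = bump \<delta> (H \<eta> - e) * (\<Prod>j\<in>(if \<nu> = 0 then {1..d} else {}). bump \<delta> (P j \<eta>) * bump \<delta> (Q j \<eta>))"

lemma weight_bounds: "0 \<le> weight e \<delta> \<eta>" "weight e \<delta> \<eta> \<le> 1"
proof -
  have "0 \<le> (\<Prod>j\<in>I. bump \<delta> (P j \<eta>) * bump \<delta> (Q j \<eta>))" "(\<Prod>j\<in>I. bump \<delta> (P j \<eta>) * bump \<delta> (Q j \<eta>)) \<le> 1" for I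
    using bump_bounds by (auto intro!: prod_nonneg prod_le_1 mult_le_one)
  then show "0 \<le> weight e \<delta> \<eta>" "weight e \<delta> \<eta> \<le> 1"
    unfolding weight_def using bump_bounds by (auto intro!: mult_le_one mult_nonneg_nonneg simp del: if_split)
qed

lemma weight_neq_0_iff:
  assumes "0 < \<delta>"
  shows "weight e \<delta> \<eta> \<noteq> 0 \<longleftrightarrow> \<bar>H \<eta> - e\<bar> < \<delta> \<and> (\<nu> = 0 \<longrightarrow> (\<forall>j\<in>{1..d}. \<bar>P j \<eta>\<bar> < \<delta> \<and> \<bar>Q j \<eta>\<bar> < \<delta>))"
  unfolding weight_def using bump_eq_0_iff[OF assms] by (auto simp: not_le)

lemma shell_eq: "0 < \<delta> \<Longrightarrow> micro_shell d N \<alpha> \<nu> \<E> \<delta> = {\<eta> \<in> phase_space d N. weight (real N ^ d * \<E>) \<delta> \<eta> \<noteq> 0}"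
  unfolding weight_neq_0_iff micro_shell_def lin_def by auto

lemma tame_C1_weight: "tame_C1 A (weight e \<delta>)"
  unfolding weight_def[abs_def]
  by (intro tame_C1_mult tame_C1_prod tame_C1_bump polys_diff H_polys polys.const P_polys Q_polys)
     (auto split: if_splits)

lemma weight_support:
  assumes "0 < \<delta>" "\<delta> \<le> 1"
  obtains R where "\<And>\<eta>. weight e \<delta> \<eta> \<noteq> 0 \<Longrightarrow> \<forall>c\<in>A. \<bar>\<eta> c\<bar> \<le> R"
proof -
  obtain R where R: "\<And>\<eta>. H \<eta> \<le> e + 1 \<Longrightarrow> (\<nu> = 0 \<longrightarrow> (\<forall>j\<in>{1..d}. \<bar>Q j \<eta>\<bar> \<le> 1)) \<Longrightarrow> \<forall>c\<in>A. \<bar>\<eta> c\<bar> \<le> R"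
    using coercive[of "e + 1"] by blast
  have "\<forall>c\<in>A. \<bar>\<eta> c\<bar> \<le> R" if "weight e \<delta> \<eta> \<noteq> 0" for \<eta>
    using that assms unfolding weight_neq_0_iff[OF assms(1)] by (intro R) force+
  then show ?thesis using that by blast
qed

lemma space_PL: "space (phase_lborel d N) = phase_space d N"
  by (simp add: phase_lborel_def phase_space_def space_PiM)

lemma shell_integrable:
  assumes "F \<in> polys A" "0 < \<delta>" "\<delta> \<le> 1"
  shows "integrable (phase_lborel d N) (\<lambda>\<eta>. indicator (micro_shell d N \<alpha> \<nu> \<E> \<delta>) \<eta> * F \<eta>)"
proof -
  let ?e = "real N ^ d * \<E>"
  have wm: "weight ?e \<delta> \<in> borel_measurable (PiM A (\<lambda>_. lborel))"
    using tame_C1_weight[of ?e \<delta>] by (simp add: tame_C1_def tame_def)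
  obtain R where R: "\<And>\<eta>. weight ?e \<delta> \<eta> \<noteq> 0 \<Longrightarrow> \<forall>c\<in>A. \<bar>\<eta> c\<bar> \<le> R" using weight_support[OF assms(2,3)] by blast
  have Fm: "F \<in> borel_measurable (PiM A (\<lambda>_. lborel))" by (rule polys_measurable[OF assms(1)])
  have "integrable (PiM A (\<lambda>_. lborel)) (\<lambda>\<eta>. of_bool (weight ?e \<delta> \<eta> \<noteq> 0) * F \<eta>)"
  proof (rule tame_integrable)
    show "tame A (\<lambda>\<eta>. of_bool (weight ?e \<delta> \<eta> \<noteq> 0) * F \<eta>)"
    proof (rule tame_mult[OF _ tame_polys[OF assms(1)]])
      have "(\<lambda>\<eta>. if weight ?e \<delta> \<eta> \<noteq> 0 then 1 else 0 :: real) \<in> borel_measurable (PiM A (\<lambda>_. lborel))"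
        using wm by measurable
      then show "tame A (\<lambda>\<eta>. of_bool (weight ?e \<delta> \<eta> \<noteq> 0))"
        unfolding tame_def by (auto simp: of_bool_def intro!: exI[of _ 1])
    qed
  qed (use R in auto)
  then show ?thesis unfolding phase_lborel_def
    by (rule Bochner_Integration.integrable_cong[THEN iffD1, OF refl, rotated])
       (use assms(2) in \<open>auto simp: shell_eq space_PL[unfolded phase_lborel_def] indicator_def\<close>)
qed

text \<open>A tangent field annihilates every function of the constrained quantities, so a smooth
  cut-off can be carried through the divergence theorem without boundary terms; the indicator of the
  shell is reached by dominated convergence.\<close>

lemma shell_divergence:
  assumes K: "\<And>c. c \<in> A \<Longrightarrow> K c \<in> polys A" and \<delta>: "0 < \<delta>" "\<delta> \<le> 1"
    and tangent: "dv A K H = (\<lambda>_. 0)"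
      "\<And>j. \<nu> = 0 \<Longrightarrow> j \<in> {1..d} \<Longrightarrow> dv A K (P j) = (\<lambda>_. 0)" "\<And>j. \<nu> = 0 \<Longrightarrow> j \<in> {1..d} \<Longrightarrow> dv A K (Q j) = (\<lambda>_. 0)"
  shows "(\<integral>\<eta>. indicator (micro_shell d N \<alpha> \<nu> \<E> \<delta>) \<eta> * dvg A K \<eta> \<partial>phase_lborel d N) = 0"
proof -
  let ?M = "PiM A (\<lambda>_. lborel :: real measure)"
  define v where "v = weight (real N ^ d * \<E>) \<delta>"
  \<comment> \<open>As \<open>m\<close> grows these functions increase to the indicator of the set
    where \<open>v\<close> is nonzero, while remaining functions of \<open>v\<close>.\<close>
  define w where "w m \<eta> = 1 - (1 - v \<eta>) ^ m" for m \<eta>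
  have vt: "tame_C1 A v" unfolding v_def by (rule tame_C1_weight)
  have v01: "0 \<le> v \<eta>" "v \<eta> \<le> 1" for \<eta> unfolding v_def by (rule weight_bounds)+
  have C1v: "C1 v" using vt by (simp add: tame_C1_def)
  have w01: "0 \<le> w m \<eta>" "w m \<eta> \<le> 1" for m \<eta> unfolding w_def using v01[of \<eta>] by (auto intro: power_le_one)
  have w0: "w m \<eta> = 0" if "v \<eta> = 0" for m \<eta> using that by (simp add: w_def)
  have wt: "tame_C1 A (w m)" for m unfolding w_def[abs_def] by (intro tame_C1_diff tame_C1_power tame_C1_const vt)
  have C1w: "C1 (w m)" for m using wt by (simp add: tame_C1_def)
  have dv_v: "dv A K v = (\<lambda>_. 0)"
  proof -
    have "dv A K (\<lambda>\<eta>. bump \<delta> (H \<eta> - real N ^ d * \<E>)) = (\<lambda>_. 0)"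
      by (rule deriv_bump[OF derivation_dv]) (simp_all add: deriv_diff[OF derivation_dv] deriv_const[OF derivation_dv] tangent)
    moreover have "dv A K (\<lambda>\<eta>. \<Prod>j\<in>(if \<nu> = 0 then {1..d} else {}). bump \<delta> (P j \<eta>) * bump \<delta> (Q j \<eta>)) = (\<lambda>_. 0)"
    proof (rule deriv_prod_zero[OF derivation_dv])
      fix j assume "j \<in> (if \<nu> = 0 then {1..d} else {})"
      then have j: "\<nu> = 0" "j \<in> {1..d}" by (auto split: if_splits)
      have C: "C1 (\<lambda>\<eta>. bump \<delta> (P j \<eta>))" "C1 (\<lambda>\<eta>. bump \<delta> (Q j \<eta>))"
        using tame_C1_bump[OF P_polys[OF j(2)]] tame_C1_bump[OF Q_polys[OF j(2)]] by (auto simp: tame_C1_def)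
      then show "C1 (\<lambda>\<eta>. bump \<delta> (P j \<eta>) * bump \<delta> (Q j \<eta>))" by simp
      show "dv A K (\<lambda>\<eta>. bump \<delta> (P j \<eta>) * bump \<delta> (Q j \<eta>)) = (\<lambda>_. 0)"
        unfolding deriv_mult[OF derivation_dv C]
        by (simp add: deriv_bump[OF derivation_dv] tangent(2,3)[OF j])
    qed
    moreover have "C1 (\<lambda>\<eta>. bump \<delta> (H \<eta> - real N ^ d * \<E>))"
      using tame_C1_bump[OF polys_diff[OF H_polys polys.const]] by (simp add: tame_C1_def)
    moreover have "C1 (\<lambda>\<eta>. \<Prod>j\<in>(if \<nu> = 0 then {1..d} else {}). bump \<delta> (P j \<eta>) * bump \<delta> (Q j \<eta>))"
    proof (rule Ck_prod)
      fix j assume "j \<in> (if \<nu> = 0 then {1..d} else {})"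
      then have j: "j \<in> {1..d}" by (auto split: if_splits)
      show "C1 (\<lambda>\<eta>. bump \<delta> (P j \<eta>) * bump \<delta> (Q j \<eta>))"
        using tame_C1_bump[OF P_polys[OF j]] tame_C1_bump[OF Q_polys[OF j]] by (simp add: tame_C1_def)
    qed
    ultimately show ?thesis unfolding v_def weight_def[abs_def] by (simp add: deriv_mult[OF derivation_dv])
  qed
  have dv_w: "dv A K (w m) = (\<lambda>_. 0)" for m
  proof -
    have "((\<lambda>s. 1 - (1 - s) ^ m) has_real_derivative real m * (1 - s) ^ (m - 1)) (at s)" for s :: real
      by (auto intro!: derivative_eq_intros)
    from deriv_chain[OF derivation_dv C1v this] show ?thesis unfolding w_def[abs_def] by (simp add: dv_v)
  qed
  obtain R where R: "\<And>\<eta>. v \<eta> \<noteq> 0 \<Longrightarrow> \<forall>c\<in>A. \<bar>\<eta> c\<bar> \<le> R" unfolding v_def using weight_support[OF \<delta>] by blast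
  have KC1: "C1 (K c)" if "c \<in> A" for c by (rule polys_Ck[OF K[OF that]])
  have pdKw: "pd c (\<lambda>\<eta>. K c \<eta> * w m \<eta>) = (\<lambda>\<eta>. pd c (K c) \<eta> * w m \<eta> + K c \<eta> * pd c (w m) \<eta>)" if "c \<in> A" for c m
    by (rule pd_mult[OF KC1[OF that] C1w])
  have pdw0: "pd c (w m) \<eta> = 0" if "v \<eta> = 0" for c m \<eta>
    by (rule pd_zero_at_min[OF C1w w01(1) w0[OF that]])
  have int: "integrable ?M (pd c (\<lambda>\<eta>. K c \<eta> * w m \<eta>))" if c: "c \<in> A" for c m
  proof (rule tame_integrable)
    have "tame_C1 A (\<lambda>\<eta>. K c \<eta> * w m \<eta>)" by (intro tame_C1_mult tame_C1_polys K c wt)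
    then show "tame A (pd c (\<lambda>\<eta>. K c \<eta> * w m \<eta>))" by (simp add: tame_C1_def)
    show "\<forall>c\<in>A. \<bar>\<eta> c\<bar> \<le> R" if "pd c (\<lambda>\<eta>. K c \<eta> * w m \<eta>) \<eta> \<noteq> 0" for \<eta>
    proof (rule R, rule notI)
      assume "v \<eta> = 0"
      then show False using that w0 pdw0 unfolding pdKw[OF c] by simp
    qed
  qed simp
  have zero: "(\<integral>\<eta>. w m \<eta> * dvg A K \<eta> \<partial>?M) = 0" for m
  proof -
    have "w m \<eta> * dvg A K \<eta> = (\<Sum>c\<in>A. pd c (\<lambda>\<eta>. K c \<eta> * w m \<eta>) \<eta>)" for \<eta>
    proof -
      have "(\<Sum>c\<in>A. pd c (\<lambda>\<eta>. K c \<eta> * w m \<eta>) \<eta>) = (\<Sum>c\<in>A. pd c (K c) \<eta> * w m \<eta> + K c \<eta> * pd c (w m) \<eta>)"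
        by (intro sum.cong refl) (simp only: pdKw)
      also have "\<dots> = dvg A K \<eta> * w m \<eta> + dv A K (w m) \<eta>"
        by (simp add: sum.distrib dvg_def dv_def sum_distrib_right)
      finally show ?thesis by (simp add: dv_w)
    qed
    then have "(\<integral>\<eta>. w m \<eta> * dvg A K \<eta> \<partial>?M) = (\<integral>\<eta>. (\<Sum>c\<in>A. pd c (\<lambda>\<eta>. K c \<eta> * w m \<eta>) \<eta>) \<partial>?M)" by simp
    also have "\<dots> = (\<Sum>c\<in>A. \<integral>\<eta>. pd c (\<lambda>\<eta>. K c \<eta> * w m \<eta>) \<eta> \<partial>?M)"
      by (rule Bochner_Integration.integral_sum) (rule int)
    also have "\<dots> = 0"
    proof (intro sum.neutral ballI integral_pd_zero int)
      fix c assume c: "c \<in> A"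
      show "C1 (\<lambda>\<eta>. K c \<eta> * w m \<eta>)" using KC1[OF c] C1w by simp
      show "\<bar>\<eta> c\<bar> \<le> R" if "K c \<eta> * w m \<eta> \<noteq> 0" for \<eta> using that w0[of \<eta> m] R[of \<eta>] c by force
    qed simp_all
    finally show ?thesis .
  qed
  have div_polys: "dvg A K \<in> polys A"
    unfolding dvg_def[abs_def] by (intro polys_sum polys_pd K)
  define ind where "ind \<eta> = (of_bool (v \<eta> \<noteq> 0) :: real)" for \<eta>
  have ind_int: "integrable ?M (\<lambda>\<eta>. ind \<eta> * dvg A K \<eta>)"
    by (rule Bochner_Integration.integrable_cong[THEN iffD1, OF refl _ shell_integrable[OF div_polys \<delta>, of \<E>, unfolded phase_lborel_def]])
       (use \<delta> in \<open>auto simp: shell_eq ind_def v_def space_PL[unfolded phase_lborel_def] indicator_def\<close>)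
  have "(\<lambda>m. \<integral>\<eta>. w m \<eta> * dvg A K \<eta> \<partial>?M) \<longlonglongrightarrow> (\<integral>\<eta>. ind \<eta> * dvg A K \<eta> \<partial>?M)"
  proof (rule integral_dominated_convergence[where w = "\<lambda>\<eta>. \<bar>ind \<eta> * dvg A K \<eta>\<bar>"])
    show "(\<lambda>\<eta>. ind \<eta> * dvg A K \<eta>) \<in> borel_measurable ?M" using ind_int by simp
    show "(\<lambda>\<eta>. w m \<eta> * dvg A K \<eta>) \<in> borel_measurable ?M" for m
      using tame_mult[of A "w m" "dvg A K"] wt[of m] tame_polys[OF div_polys] by (simp add: tame_C1_def) (simp add: tame_def)
    show "integrable ?M (\<lambda>\<eta>. \<bar>ind \<eta> * dvg A K \<eta>\<bar>)" using ind_int by simp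
    show "AE \<eta> in ?M. (\<lambda>m. w m \<eta> * dvg A K \<eta>) \<longlonglongrightarrow> ind \<eta> * dvg A K \<eta>"
    proof (rule AE_I2)
      fix \<eta>
      show "(\<lambda>m. w m \<eta> * dvg A K \<eta>) \<longlonglongrightarrow> ind \<eta> * dvg A K \<eta>"
      proof (cases "v \<eta> = 0")
        case False
        then have "(\<lambda>m. (1 - v \<eta>) ^ m) \<longlonglongrightarrow> 0" using v01[of \<eta>] by (intro LIMSEQ_power_zero) auto
        then have "(\<lambda>m. w m \<eta>) \<longlonglongrightarrow> 1 - 0" unfolding w_def by (intro tendsto_diff tendsto_const)
        then show ?thesis using False by (auto simp: ind_def intro!: tendsto_eq_intros)
      qed (simp add: w0 ind_def)
    qed
    show "AE \<eta> in ?M. norm (w m \<eta> * dvg A K \<eta>) \<le> \<bar>ind \<eta> * dvg A K \<eta>\<bar>" for m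
    proof (rule AE_I2)
      fix \<eta>
      show "norm (w m \<eta> * dvg A K \<eta>) \<le> \<bar>ind \<eta> * dvg A K \<eta>\<bar>"
        using w01[of m \<eta>] w0[of \<eta> m] by (cases "v \<eta> = 0") (auto simp: abs_mult ind_def intro!: mult_left_le_one_le)
    qed
  qed
  then have "(\<integral>\<eta>. ind \<eta> * dvg A K \<eta> \<partial>?M) = 0" unfolding zero by (simp add: LIMSEQ_const_iff)
  moreover have "(\<integral>\<eta>. ind \<eta> * dvg A K \<eta> \<partial>?M) = (\<integral>\<eta>. indicator (micro_shell d N \<alpha> \<nu> \<E> \<delta>) \<eta> * dvg A K \<eta> \<partial>phase_lborel d N)"
    unfolding phase_lborel_def
    by (rule Bochner_Integration.integral_cong[OF refl])
       (use \<delta> in \<open>auto simp: shell_eq ind_def v_def space_PL[unfolded phase_lborel_def] indicator_def\<close>)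
  ultimately show ?thesis by simp
qed

end

section \<open>Microcanonical correlations of the Fourier modes\<close>

lemma dv_comb: "dv A (\<lambda>c \<eta>. (a \<eta> * V c \<eta> - b \<eta> * W c \<eta>) * g \<eta>) f \<eta> = g \<eta> * (a \<eta> * dv A V f \<eta> - b \<eta> * dv A W f \<eta>)"
  by (simp add: dv_def sum_distrib_left sum_subtractf[symmetric] algebra_simps)

lemma dvg_comb:
  assumes "C1 a" "C1 b" "C1 g" "\<And>c. c \<in> A \<Longrightarrow> C1 (V c)" "\<And>c. c \<in> A \<Longrightarrow> C1 (W c)"
  shows "dvg A (\<lambda>c \<eta>. (a \<eta> * V c \<eta> - b \<eta> * W c \<eta>) * g \<eta>) \<eta>
    = g \<eta> * (a \<eta> * dvg A V \<eta> + dv A V a \<eta> - b \<eta> * dvg A W \<eta> - dv A W b \<eta>)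
      + (a \<eta> * dv A V g \<eta> - b \<eta> * dv A W g \<eta>)"
proof -
  have "pd c (\<lambda>\<eta>. (a \<eta> * V c \<eta> - b \<eta> * W c \<eta>) * g \<eta>) \<eta>
    = g \<eta> * (a \<eta> * pd c (V c) \<eta> + V c \<eta> * pd c a \<eta> - b \<eta> * pd c (W c) \<eta> - W c \<eta> * pd c b \<eta>)
      + (a \<eta> * (V c \<eta> * pd c g \<eta>) - b \<eta> * (W c \<eta> * pd c g \<eta>))" if "c \<in> A" for c
    using assms(1-3) assms(4,5)[OF that] by (simp add: pd_mult pd_diff algebra_simps)
  then have "dvg A (\<lambda>c \<eta>. (a \<eta> * V c \<eta> - b \<eta> * W c \<eta>) * g \<eta>) \<eta>
    = (\<Sum>c\<in>A. g \<eta> * (a \<eta> * pd c (V c) \<eta> + V c \<eta> * pd c a \<eta> - b \<eta> * pd c (W c) \<eta> - W c \<eta> * pd c b \<eta>)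
      + (a \<eta> * (V c \<eta> * pd c g \<eta>) - b \<eta> * (W c \<eta> * pd c g \<eta>)))"
    unfolding dvg_def by (intro sum.cong refl)
  also have "\<dots> = g \<eta> * (a \<eta> * dvg A V \<eta> + dv A V a \<eta> - b \<eta> * dvg A W \<eta> - dv A W b \<eta>)
      + (a \<eta> * dv A V g \<eta> - b \<eta> * dv A W g \<eta>)"
    by (simp add: dvg_def dv_def sum.distrib sum_subtractf sum_distrib_left algebra_simps)
  finally show ?thesis .
qed

context chain
begin

text \<open>On the hyperplane of vanishing total momentum this is \<open>2 H\<close>; it is the derivative of \<open>H\<close>
  along the Euler field of the centred coordinates.\<close>

definition HH :: "config \<Rightarrow> real" where
  "HH \<eta> = 2 * H \<eta> - kap / real (N ^ d) * (\<Sum>j=1..d. (P j \<eta>)\<^sup>2)"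

text \<open>Scaling of the coordinates, centred when there is no pinning. Centring makes the field
  annihilate total momentum and total position instead of scaling them, so that it can be used on
  the constrained shell.\<close>

definition euler :: "coord \<Rightarrow> config \<Rightarrow> real" where
  "euler c = (case c of Pos x j \<Rightarrow> (\<lambda>\<eta>. \<eta> (Pos x j) - kap / real (N ^ d) * Q j \<eta>)
     | Mom x j \<Rightarrow> (\<lambda>\<eta>. \<eta> (Mom x j) - kap / real (N ^ d) * P j \<eta>))"

text \<open>The momentum gradient of the current. Since the kinetic energy is quadratic, the
  derivative of \<open>H\<close> along this field is the current itself
  (\<open>field1_H\<close>).\<close>

definition field1 :: "coord \<Rightarrow> config \<Rightarrow> real" where
  "field1 c = (case c of Pos x j \<Rightarrow> (\<lambda>_. 0)
     | Mom x j \<Rightarrow> (\<lambda>\<eta>. - (\<alpha>/2) * (\<eta> (Pos (shift N 1 1 x) j) - \<eta> (Pos (shift N 1 (-1) x) j))))"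

text \<open>Half the position gradient of \<open>BB k\<close>; its derivative of \<open>H\<close> is
  \<open>om2 k * BB k\<close>.\<close>

definition field2 :: "site \<Rightarrow> coord \<Rightarrow> config \<Rightarrow> real" where
  "field2 k c = (case c of Pos x j \<Rightarrow> (\<lambda>\<eta>. cosf k x * cq k j \<eta> + sinf k x * sq k j \<eta>) | Mom x j \<Rightarrow> (\<lambda>_. 0))"

text \<open>The number of degrees of freedom, less the constrained momentum and position in each
  component when \<nu> = 0. It is the divergence of the Euler field.\<close>

definition nn :: real where
  "nn = 2 * real d * (real (N ^ d) - kap)"

lemma Nd_ge: "real (N ^ d) \<ge> 3"
proof -
  have "N ^ 1 \<le> N ^ d" using d N by (intro power_increasing) auto
  then have "3 \<le> N ^ d" using N by simp
  then show ?thesis by (metis of_nat_le_iff of_nat_numeral)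
qed

lemma nn_pos: "nn > 0"
proof -
  have "kap \<le> 1" by (simp add: kap_def)
  then have "real (N ^ d) - kap > 0" using Nd_ge by linarith
  then show ?thesis unfolding nn_def using d by (intro mult_pos_pos) auto
qed

lemma HH_polys [simp]: "HH \<in> polys A"
  unfolding HH_def[abs_def] by (intro polys_intros) simp_all

lemma Ck_HH [simp]: "Ck n HH" by (rule polys_Ck[OF HH_polys])

lemma coords_cases:
  assumes "c \<in> A"
  obtains x j where "c = Pos x j" "x \<in> S" "j \<in> {1..d}" | x j where "c = Mom x j" "x \<in> S" "j \<in> {1..d}"
  using assms by (auto simp: coords_def)

lemma field_polys:
  assumes "c \<in> A"
  shows "euler c \<in> polys A" "field1 c \<in> polys A" "field2 k c \<in> polys A"
proof -
  have d1: "1 \<in> {1..d}" using d by simp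
  have "euler c \<in> polys A \<and> field1 c \<in> polys A \<and> field2 k c \<in> polys A"
    using assms
  proof (cases rule: coords_cases)
    case (1 x j)
    show ?thesis unfolding 1(1) euler_def field1_def field2_def coord.case using 1(2,3)
      by (intro conjI polys_intros Pos_in_coords) (simp_all add: four_polys Q_polys)
  next
    case (2 x j)
    show ?thesis unfolding 2(1) euler_def field1_def field2_def coord.case using 2(2,3)
      by (intro conjI polys_intros Pos_in_coords Mom_in_coords shift_in_sites[OF _ d1 N_pos]) (simp_all add: P_polys)
  qed
  then show "euler c \<in> polys A" "field1 c \<in> polys A" "field2 k c \<in> polys A" by auto
qed

lemma euler_lin:
  assumes "j \<in> {1..d}"
  shows "dv A euler (lin d N a (\<lambda>x. Pos x j)) \<eta> = lin d N a (\<lambda>x. Pos x j) \<eta> - kap / real (N ^ d) * (\<Sum>x\<in>S. a x) * Q j \<eta>"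
    "dv A euler (lin d N a (\<lambda>x. Mom x j)) \<eta> = lin d N a (\<lambda>x. Mom x j) \<eta> - kap / real (N ^ d) * (\<Sum>x\<in>S. a x) * P j \<eta>"
proof -
  have *: "(\<Sum>x\<in>S. a x * (u x - c)) = (\<Sum>x\<in>S. a x * u x) - (\<Sum>x\<in>S. a x) * c" for u :: "site \<Rightarrow> real" and c
    by (simp add: right_diff_distrib sum_subtractf sum_distrib_right)
  have "dv A euler (lin d N a (\<lambda>x. Pos x j)) \<eta> = (\<Sum>x\<in>S. a x * (\<eta> (Pos x j) - kap / real (N ^ d) * Q j \<eta>))"
    unfolding deriv_lin[OF derivation_dv] using assms
    by (intro sum.cong refl) (simp only: dv_coord[OF finite_coords Pos_in_coords], simp add: euler_def)
  then show "dv A euler (lin d N a (\<lambda>x. Pos x j)) \<eta> = lin d N a (\<lambda>x. Pos x j) \<eta> - kap / real (N ^ d) * (\<Sum>x\<in>S. a x) * Q j \<eta>"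
    unfolding * by (simp add: lin_def)
  have "dv A euler (lin d N a (\<lambda>x. Mom x j)) \<eta> = (\<Sum>x\<in>S. a x * (\<eta> (Mom x j) - kap / real (N ^ d) * P j \<eta>))"
    unfolding deriv_lin[OF derivation_dv] using assms
    by (intro sum.cong refl) (simp only: dv_coord[OF finite_coords Mom_in_coords], simp add: euler_def)
  then show "dv A euler (lin d N a (\<lambda>x. Mom x j)) \<eta> = lin d N a (\<lambda>x. Mom x j) \<eta> - kap / real (N ^ d) * (\<Sum>x\<in>S. a x) * P j \<eta>"
    unfolding * by (simp add: lin_def)
qed

lemma euler_PQ:
  assumes "j \<in> {1..d}"
  shows "dv A euler (P j) \<eta> = (1 - kap) * P j \<eta>" "dv A euler (Q j) \<eta> = (1 - kap) * Q j \<eta>"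
proof -
  have "real (N ^ d) \<noteq> 0" using Nd_ge by linarith
  then have "kap / real (N ^ d) * (\<Sum>x\<in>S. 1) = kap" by (simp add: card_sites)
  then show "dv A euler (P j) \<eta> = (1 - kap) * P j \<eta>" "dv A euler (Q j) \<eta> = (1 - kap) * Q j \<eta>"
    unfolding euler_lin[OF assms] by (simp_all only: left_diff_distrib mult_1)
qed

lemma H_euler: "(\<Sum>j=1..d. \<Sum>x\<in>S. \<eta> (Mom x j) * \<eta> (Mom x j) + W x j \<eta> * \<eta> (Pos x j)) = 2 * H \<eta>"
proof -
  have "(\<Sum>x\<in>S. W x j \<eta> * \<eta> (Pos x j)) = \<nu> * (\<Sum>x\<in>S. (\<eta> (Pos x j))\<^sup>2)
     + \<alpha> * (\<Sum>i=1..d. \<Sum>x\<in>S. (\<eta> (Pos (shift N i 1 x) j) - \<eta> (Pos x j))\<^sup>2)" for j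
  proof -
    have "(\<Sum>x\<in>S. W x j \<eta> * \<eta> (Pos x j)) = \<nu> * (\<Sum>x\<in>S. (\<eta> (Pos x j))\<^sup>2)
      + \<alpha> * (\<Sum>x\<in>S. \<Sum>i=1..d. (2 * \<eta> (Pos x j) - \<eta> (Pos (shift N i 1 x) j) - \<eta> (Pos (shift N i (-1) x) j)) * \<eta> (Pos x j))"
      by (simp add: W_def distrib_right sum.distrib sum_distrib_left sum_distrib_right power2_eq_square mult.assoc)
    also have "(\<Sum>x\<in>S. \<Sum>i=1..d. (2 * \<eta> (Pos x j) - \<eta> (Pos (shift N i 1 x) j) - \<eta> (Pos (shift N i (-1) x) j)) * \<eta> (Pos x j))
      = (\<Sum>i=1..d. \<Sum>x\<in>S. (\<eta> (Pos (shift N i 1 x) j) - \<eta> (Pos x j))\<^sup>2)"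
      unfolding power2_eq_square
      by (subst sum.swap, rule sum.cong[OF refl], rule sum_by_parts[symmetric, where f = "\<lambda>x. \<eta> (Pos x j)" and g = "\<lambda>x. \<eta> (Pos x j)"])
    finally show ?thesis .
  qed
  then show ?thesis
    unfolding hamiltonian_bonds
    by (simp add: sum.distrib sum_distrib_left power2_eq_square sum.swap[of _ S])
qed

text \<open>Energy is homogeneous of degree 2. Centring subtracts the momentum term kept in
  \<open>HH\<close>; the corresponding position term carries \<open>kap * \<nu>\<close>, which is
  0.\<close>

lemma euler_H: "dv A euler H = HH"
proof
  fix \<eta>
  let ?c = "kap / real (N ^ d)"
  have "dv A euler H \<eta> = (\<Sum>j=1..d. \<Sum>x\<in>S. \<eta> (Mom x j) * (\<eta> (Mom x j) - ?c * P j \<eta>) + W x j \<eta> * (\<eta> (Pos x j) - ?c * Q j \<eta>))"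
    unfolding deriv_H[OF derivation_dv]
    by (intro sum.cong refl) (simp only: dv_coord[OF finite_coords Pos_in_coords] dv_coord[OF finite_coords Mom_in_coords], simp add: euler_def)
  also have "\<dots> = (\<Sum>j=1..d. (\<Sum>x\<in>S. \<eta> (Mom x j) * \<eta> (Mom x j) + W x j \<eta> * \<eta> (Pos x j))
      - ?c * P j \<eta> * P j \<eta> - ?c * Q j \<eta> * (\<Sum>x\<in>S. W x j \<eta>))"
  proof (intro sum.cong refl)
    fix j
    have "(\<Sum>x\<in>S. \<eta> (Mom x j) * (\<eta> (Mom x j) - ?c * P j \<eta>) + W x j \<eta> * (\<eta> (Pos x j) - ?c * Q j \<eta>))
      = (\<Sum>x\<in>S. \<eta> (Mom x j) * \<eta> (Mom x j) + W x j \<eta> * \<eta> (Pos x j)) - ?c * P j \<eta> * (\<Sum>x\<in>S. \<eta> (Mom x j)) - ?c * Q j \<eta> * (\<Sum>x\<in>S. W x j \<eta>)"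
      unfolding sum_distrib_left sum_subtractf[symmetric] by (intro sum.cong refl) (simp add: algebra_simps)
    then show "(\<Sum>x\<in>S. \<eta> (Mom x j) * (\<eta> (Mom x j) - ?c * P j \<eta>) + W x j \<eta> * (\<eta> (Pos x j) - ?c * Q j \<eta>))
      = (\<Sum>x\<in>S. \<eta> (Mom x j) * \<eta> (Mom x j) + W x j \<eta> * \<eta> (Pos x j)) - ?c * P j \<eta> * P j \<eta> - ?c * Q j \<eta> * (\<Sum>x\<in>S. W x j \<eta>)"
      by (simp add: lin_def)
  qed
  also have "\<dots> = 2 * H \<eta> - ?c * (\<Sum>j=1..d. (P j \<eta>)\<^sup>2) - (\<Sum>j=1..d. ?c * Q j \<eta> * (\<nu> * Q j \<eta>))"
    unfolding sum_W sum_subtractf H_euler by (simp add: sum_distrib_left power2_eq_square mult.assoc)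
  also have "(\<Sum>j=1..d. ?c * Q j \<eta> * (\<nu> * Q j \<eta>)) = (\<Sum>j=1..d. (kap * \<nu>) * (Q j \<eta> * Q j \<eta> / real (N ^ d)))"
    by (intro sum.cong refl) (simp add: algebra_simps)
  finally show "dv A euler H \<eta> = HH \<eta>" by (simp add: kap_nu HH_def)
qed

lemma deriv_HH:
  assumes D: "derivation D"
  shows "D HH \<eta> = 2 * D H \<eta> - kap / real (N ^ d) * (\<Sum>j=1..d. 2 * P j \<eta> * D (P j) \<eta>)"
  unfolding HH_def[abs_def] by (simp add: deriv_simps[OF D] del: of_nat_power)

lemma euler_HH: "dv A euler HH \<eta> = 2 * HH \<eta>"
proof -
  have k: "kap * ((1 - kap) * y) = 0" for y by (simp add: kap_def)
  have "(\<Sum>j=1..d. 2 * P j \<eta> * dv A euler (P j) \<eta>) = (\<Sum>j=1..d. 2 * P j \<eta> * ((1 - kap) * P j \<eta>))"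
    by (intro sum.cong refl) (simp only: euler_PQ(1))
  also have "\<dots> = (1 - kap) * (\<Sum>j=1..d. 2 * P j \<eta> * P j \<eta>)"
    by (simp add: sum_distrib_left algebra_simps)
  finally have "kap * (\<Sum>j=1..d. 2 * P j \<eta> * dv A euler (P j) \<eta>) = 0" by (simp only: k)
  then have "kap / real (N ^ d) * (\<Sum>j=1..d. 2 * P j \<eta> * dv A euler (P j) \<eta>) = 0" by auto
  then show ?thesis unfolding deriv_HH[OF derivation_dv] euler_H by simp
qed

lemma deriv_JJ:
  assumes D: "derivation D"
  shows "D (JJ k) \<eta> = (\<Sum>j=1..d. D (cp k j) \<eta> * sq k j \<eta> + cp k j \<eta> * D (sq k j) \<eta>
    - (D (sp k j) \<eta> * cq k j \<eta> + sp k j \<eta> * D (cq k j) \<eta>))"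
  unfolding JJ_def[abs_def] by (simp add: deriv_simps[OF D])

lemma deriv_BB:
  assumes D: "derivation D"
  shows "D (BB k) \<eta> = (\<Sum>j=1..d. 2 * cq k j \<eta> * D (cq k j) \<eta> + 2 * sq k j \<eta> * D (sq k j) \<eta>)"
  unfolding BB_def[abs_def] by (simp add: deriv_simps[OF D])

definition nonzero :: "site \<Rightarrow> bool" where
  "nonzero k \<longleftrightarrow> k \<in> S \<and> (\<exists>i\<in>{1..d}. k i \<noteq> 0)"

lemma sum_modes: "nonzero k \<Longrightarrow> (\<Sum>x\<in>S. cosf k x) = 0" "(\<Sum>x\<in>S. sinf k x) = 0"
  using sum_sites_cos_phase[OF _ _ N_pos] sum_sites_sin_phase[OF N_pos] by (auto simp: nonzero_def)

lemma euler_modes: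
  assumes "nonzero k" "j \<in> {1..d}"
  shows "dv A euler (cq k j) = cq k j" "dv A euler (sq k j) = sq k j" "dv A euler (cp k j) = cp k j" "dv A euler (sp k j) = sp k j"
  by (rule ext, simp add: euler_lin[OF assms(2)] sum_modes assms(1))+

text \<open>Homogeneity of degree 2: the weights of a nonzero mode sum to 0, so these modes do not
  notice the centring.\<close>

lemma euler_JJ:
  assumes "nonzero k"
  shows "dv A euler (JJ k) \<eta> = 2 * JJ k \<eta>"
proof -
  have "dv A euler (JJ k) \<eta> = (\<Sum>j=1..d. 2 * (cp k j \<eta> * sq k j \<eta> - sp k j \<eta> * cq k j \<eta>))"
    unfolding deriv_JJ[OF derivation_dv] by (intro sum.cong refl) (simp only: euler_modes[OF assms], simp)
  then show ?thesis by (simp add: JJ_def sum_distrib_left)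
qed

lemma euler_BB:
  assumes "nonzero k"
  shows "dv A euler (BB k) \<eta> = 2 * BB k \<eta>"
proof -
  have "dv A euler (BB k) \<eta> = (\<Sum>j=1..d. 2 * ((cq k j \<eta>)\<^sup>2 + (sq k j \<eta>)\<^sup>2))"
    unfolding deriv_BB[OF derivation_dv] by (intro sum.cong refl) (simp only: euler_modes[OF assms], simp add: power2_eq_square)
  then show ?thesis by (simp add: BB_def sum_distrib_left)
qed

text \<open>Modes with vanishing first wave number have coefficient 0 in the current; all others are
  nonzero modes, for which \<open>euler_JJ\<close> applies.\<close>

lemma euler_J: "dv A euler J \<eta> = 2 * J \<eta>"
proof -
  have "dv A euler J \<eta> = - \<alpha> / real (N ^ d) * (\<Sum>k\<in>S. sin (freq N k 1) * dv A euler (JJ k) \<eta>)"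
  proof -
    have "dv A euler (\<lambda>\<eta>. c * (\<Sum>k\<in>S. b k * JJ k \<eta>)) \<eta> = c * (\<Sum>k\<in>S. b k * dv A euler (JJ k) \<eta>)" for b c
      by (simp add: deriv_cmult[OF derivation_dv] deriv_sum[OF derivation_dv])
    then show ?thesis unfolding total_current_modes[abs_def] .
  qed
  also have "(\<Sum>k\<in>S. sin (freq N k 1) * dv A euler (JJ k) \<eta>) = (\<Sum>k\<in>S. 2 * (sin (freq N k 1) * JJ k \<eta>))"
  proof (intro sum.cong refl)
    fix k assume k: "k \<in> S"
    show "sin (freq N k 1) * dv A euler (JJ k) \<eta> = 2 * (sin (freq N k 1) * JJ k \<eta>)"
    proof (cases "k 1 = 0")
      case True then show ?thesis by (simp add: freq_def)
    next
      case False
      then have "nonzero k" using k d by (auto simp: nonzero_def intro: bexI[of _ 1])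
      then show ?thesis by (simp add: euler_JJ)
    qed
  qed
  finally show ?thesis unfolding total_current_modes by (simp add: sum_distrib_left algebra_simps)
qed

lemma field1_coord:
  assumes "x \<in> S" "j \<in> {1..d}"
  shows "dv A field1 (\<lambda>\<eta>. \<eta> (Pos x j)) = (\<lambda>_. 0)"
    "dv A field1 (\<lambda>\<eta>. \<eta> (Mom x j)) = (\<lambda>\<eta>. - (\<alpha>/2) * (\<eta> (Pos (shift N 1 1 x) j) - \<eta> (Pos (shift N 1 (-1) x) j)))"
  unfolding dv_coord[OF finite_coords Pos_in_coords[OF assms]] dv_coord[OF finite_coords Mom_in_coords[OF assms]]
  by (simp_all add: field1_def)

lemma field2_coord:
  assumes "x \<in> S" "j \<in> {1..d}"
  shows "dv A (field2 k) (\<lambda>\<eta>. \<eta> (Pos x j)) = (\<lambda>\<eta>. cosf k x * cq k j \<eta> + sinf k x * sq k j \<eta>)"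
    "dv A (field2 k) (\<lambda>\<eta>. \<eta> (Mom x j)) = (\<lambda>_. 0)"
  unfolding dv_coord[OF finite_coords Pos_in_coords[OF assms]] dv_coord[OF finite_coords Mom_in_coords[OF assms]]
  by (simp_all add: field2_def)

lemma field1_H: "dv A field1 H = J"
proof
  fix \<eta>
  show "dv A field1 H \<eta> = J \<eta>"
    unfolding deriv_H[OF derivation_dv] total_current_eq
    by (intro sum.cong refl) (simp add: field1_coord)
qed

text \<open>The central difference is antisymmetric, so it moves from the positions to the weights
  with a change of sign.\<close>

lemma sum_antisym_shift:
  assumes "\<And>x. x \<in> S \<Longrightarrow> a (shift N 1 (-1) x) - a (shift N 1 1 x) = b x"
  shows "(\<Sum>x\<in>S. a x * (- (\<alpha>/2) * (\<eta> (Pos (shift N 1 1 x) j) - \<eta> (Pos (shift N 1 (-1) x) j))))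
    = - (\<alpha>/2) * lin d N b (\<lambda>x. Pos x j) \<eta>"
proof -
  have i: "(1::nat) \<in> {1..d}" using d by simp
  let ?q = "\<lambda>x. \<eta> (Pos x j)"
  have p: "(\<Sum>x\<in>S. a x * ?q (shift N 1 s x)) = (\<Sum>x\<in>S. a (shift N 1 (- s) x) * ?q x)" for s
  proof -
    have "(\<Sum>x\<in>S. a x * ?q (shift N 1 s x)) = (\<Sum>x\<in>S. a (shift N 1 (- s) x) * ?q (shift N 1 s (shift N 1 (- s) x)))"
      by (rule sum_shift[OF i N_pos, symmetric])
    also have "\<dots> = (\<Sum>x\<in>S. a (shift N 1 (- s) x) * ?q x)"
      by (intro sum.cong refl) (simp add: shift_shift shift_0[OF _ i, unfolded One_nat_def])
    finally show ?thesis .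
  qed
  have "(\<Sum>x\<in>S. a x * (- (\<alpha>/2) * (?q (shift N 1 1 x) - ?q (shift N 1 (-1) x))))
    = - (\<alpha>/2) * ((\<Sum>x\<in>S. a x * ?q (shift N 1 1 x)) - (\<Sum>x\<in>S. a x * ?q (shift N 1 (-1) x)))"
    unfolding sum_subtractf[symmetric] sum_distrib_left by (intro sum.cong refl) (simp add: algebra_simps)
  also have "(\<Sum>x\<in>S. a x * ?q (shift N 1 1 x)) - (\<Sum>x\<in>S. a x * ?q (shift N 1 (-1) x)) = lin d N b (\<lambda>x. Pos x j) \<eta>"
    unfolding p lin_def sum_subtractf[symmetric] left_diff_distrib[symmetric]
    by (intro sum.cong refl) (simp add: assms[symmetric])
  finally show ?thesis .
qed

text \<open>The central difference exchanges cosine and sine modes with a factor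
  \<open>sin (freq N k 1)\<close> and kills constants, so momentum modes go to position modes and
  the total momentum is preserved.\<close>

lemma field1_lin:
  assumes "j \<in> {1..d}"
  shows "dv A field1 (P j) = (\<lambda>_. 0)" "dv A field1 (lin d N a (\<lambda>x. Pos x j)) = (\<lambda>_. 0)"
    "dv A field1 (cp k j) = (\<lambda>\<eta>. - \<alpha> * sin (freq N k 1) * sq k j \<eta>)" "dv A field1 (sp k j) = (\<lambda>\<eta>. \<alpha> * sin (freq N k 1) * cq k j \<eta>)"
proof -
  have i: "(1::nat) \<in> {1..d}" using d by simp
  have lin: "dv A field1 (lin d N a (\<lambda>x. Mom x j)) \<eta> = - (\<alpha>/2) * lin d N b (\<lambda>x. Pos x j) \<eta>"
    if "\<And>x. x \<in> S \<Longrightarrow> a (shift N 1 (-1) x) - a (shift N 1 1 x) = b x" for a b \<eta>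
  proof -
    have "dv A field1 (lin d N a (\<lambda>x. Mom x j)) \<eta>
      = (\<Sum>x\<in>S. a x * (- (\<alpha>/2) * (\<eta> (Pos (shift N 1 1 x) j) - \<eta> (Pos (shift N 1 (-1) x) j))))"
      unfolding deriv_lin[OF derivation_dv] by (intro sum.cong refl) (simp only: field1_coord(2)[OF _ assms])
    also have "\<dots> = - (\<alpha>/2) * lin d N b (\<lambda>x. Pos x j) \<eta>" by (rule sum_antisym_shift[OF that])
    finally show ?thesis .
  qed
  show "dv A field1 (P j) = (\<lambda>_. 0)"
    by (rule ext) (subst lin[where b = "\<lambda>_. 0"], simp_all add: lin_def)
  show "dv A field1 (lin d N a (\<lambda>x. Pos x j)) = (\<lambda>_. 0)"
    unfolding deriv_lin[OF derivation_dv] by (rule ext, intro sum.neutral) (simp add: field1_coord(1)[OF _ assms])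
  show "dv A field1 (cp k j) = (\<lambda>\<eta>. - \<alpha> * sin (freq N k 1) * sq k j \<eta>)"
  proof
    fix \<eta>
    have "dv A field1 (cp k j) \<eta> = - (\<alpha>/2) * lin d N (\<lambda>x. 2 * sin (freq N k 1) * sinf k x) (\<lambda>x. Pos x j) \<eta>"
      by (rule lin) (simp only: cos_phase_shift[OF i N_pos], simp add: cos_add cos_diff)
    then show "dv A field1 (cp k j) \<eta> = - \<alpha> * sin (freq N k 1) * sq k j \<eta>"
      by (simp add: lin_def sum_distrib_left algebra_simps)
  qed
  show "dv A field1 (sp k j) = (\<lambda>\<eta>. \<alpha> * sin (freq N k 1) * cq k j \<eta>)"
  proof
    fix \<eta>
    have "dv A field1 (sp k j) \<eta> = - (\<alpha>/2) * lin d N (\<lambda>x. - 2 * sin (freq N k 1) * cosf k x) (\<lambda>x. Pos x j) \<eta>"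
      by (rule lin) (simp only: sin_phase_shift[OF i N_pos], simp add: sin_add sin_diff)
    then show "dv A field1 (sp k j) \<eta> = \<alpha> * sin (freq N k 1) * cq k j \<eta>"
      by (simp add: lin_def sum_distrib_left sum_negf algebra_simps)
  qed
qed

lemma field1_HH: "dv A field1 HH \<eta> = 2 * J \<eta>"
proof -
  have "(\<Sum>j=1..d. 2 * P j \<eta> * dv A field1 (P j) \<eta>) = 0"
    by (intro sum.neutral ballI) (simp only: field1_lin(1) mult_zero_right)
  then show ?thesis unfolding deriv_HH[OF derivation_dv] field1_H by simp
qed

lemma field1_JJ: "dv A field1 (JJ k) \<eta> = - \<alpha> * sin (freq N k 1) * BB k \<eta>"
proof -
  have "dv A field1 (JJ k) \<eta> = (\<Sum>j=1..d. - \<alpha> * sin (freq N k 1) * ((cq k j \<eta>)\<^sup>2 + (sq k j \<eta>)\<^sup>2))"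
    unfolding deriv_JJ[OF derivation_dv]
    by (intro sum.cong refl) (simp only: field1_lin, simp add: power2_eq_square algebra_simps)
  then show ?thesis by (simp add: BB_def sum_distrib_left)
qed

lemma field2_H: "dv A (field2 k) H \<eta> = om2 k * BB k \<eta>"
proof -
  have "dv A (field2 k) H \<eta> = (\<Sum>j=1..d. \<Sum>x\<in>S. W x j \<eta> * (cosf k x * cq k j \<eta> + sinf k x * sq k j \<eta>))"
    unfolding deriv_H[OF derivation_dv] by (intro sum.cong refl) (simp add: field2_coord)
  also have "\<dots> = (\<Sum>j=1..d. (\<Sum>x\<in>S. cosf k x * W x j \<eta>) * cq k j \<eta> + (\<Sum>x\<in>S. sinf k x * W x j \<eta>) * sq k j \<eta>)"
    unfolding sum_distrib_right sum.distrib[symmetric] by (intro sum.cong refl) (simp add: algebra_simps)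
  also have "\<dots> = om2 k * BB k \<eta>"
    unfolding sum_cosf_W sum_sinf_W by (simp add: BB_def sum_distrib_left power2_eq_square algebra_simps)
  finally show ?thesis .
qed

lemma field2_PQ:
  assumes "j \<in> {1..d}"
  shows "dv A (field2 k) (P j) = (\<lambda>_. 0)" "nonzero k \<Longrightarrow> dv A (field2 k) (Q j) = (\<lambda>_. 0)"
proof -
  show "dv A (field2 k) (P j) = (\<lambda>_. 0)"
    unfolding deriv_lin[OF derivation_dv] by (rule ext, intro sum.neutral) (simp add: field2_coord(2)[OF _ assms])
  assume k: "nonzero k"
  show "dv A (field2 k) (Q j) = (\<lambda>_. 0)"
  proof
    fix \<eta>
    have "dv A (field2 k) (Q j) \<eta> = (\<Sum>x\<in>S. 1 * (cosf k x * cq k j \<eta> + sinf k x * sq k j \<eta>))"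
      unfolding deriv_lin[OF derivation_dv] by (intro sum.cong refl) (simp only: field2_coord(1)[OF _ assms])
    also have "\<dots> = (\<Sum>x\<in>S. cosf k x) * cq k j \<eta> + (\<Sum>x\<in>S. sinf k x) * sq k j \<eta>"
      by (simp add: sum.distrib sum_distrib_right)
    finally show "dv A (field2 k) (Q j) \<eta> = 0" using sum_modes[of k] k by simp
  qed
qed

lemma field2_HH: "dv A (field2 k) HH \<eta> = 2 * om2 k * BB k \<eta>"
proof -
  have "(\<Sum>j=1..d. 2 * P j \<eta> * dv A (field2 k) (P j) \<eta>) = 0"
    by (intro sum.neutral ballI) (simp only: field2_PQ(1) mult_zero_right)
  then show ?thesis unfolding deriv_HH[OF derivation_dv] field2_H by simp
qed

lemma dvg_field1: "dvg A field1 \<eta> = 0"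
  unfolding dvg_def
proof (intro sum.neutral ballI)
  fix c assume "c \<in> A"
  then show "pd c (field1 c) \<eta> = 0"
  proof (cases rule: coords_cases)
    case (2 x j)
    then show ?thesis by (simp add: field1_def deriv_simps[OF derivation_pd])
  qed (simp add: field1_def)
qed

lemma pd_own_lin:
  assumes "x \<in> S"
  shows "pd (Pos x j) (lin d N a (\<lambda>x. Pos x j)) = (\<lambda>_. a x)" "pd (Mom x j) (lin d N a (\<lambda>x. Mom x j)) = (\<lambda>_. a x)"
  using assms by (auto simp: deriv_lin[OF derivation_pd] if_distrib cong: if_cong)

lemma dvg_euler: "dvg A euler \<eta> = nn"
proof -
  have "dvg A euler \<eta> = (\<Sum>j=1..d. \<Sum>x\<in>S. 2 * (1 - kap / real (N ^ d)))"
    unfolding dvg_def sum_coords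
    by (intro sum.cong refl) (simp add: euler_def deriv_simps[OF derivation_pd] pd_own_lin del: of_nat_power)
  also have "\<dots> = nn" unfolding nn_def using N_pos by (simp add: card_sites field_simps)
  finally show ?thesis .
qed

text \<open>Each position contributes the squares of its cosine and sine weights, which add up to
  1.\<close>

lemma dvg_field2: "dvg A (field2 k) \<eta> = real d * real (N ^ d)"
proof -
  have "dvg A (field2 k) \<eta> = (\<Sum>j=1..d. \<Sum>x\<in>S. 1)"
    unfolding dvg_def sum_coords
  proof (intro sum.cong refl)
    fix j x assume "x \<in> S"
    then have "pd (Pos x j) (\<lambda>\<eta>. cosf k x * cq k j \<eta> + sinf k x * sq k j \<eta>) \<eta> = cosf k x * cosf k x + sinf k x * sinf k x"
      by (simp add: pd_add pd_mult pd_own_lin)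
    then show "pd (Pos x j) (field2 k (Pos x j)) \<eta> + pd (Mom x j) (field2 k (Mom x j)) \<eta> = 1"
      using sin_cos_squared_add3[of "phase d N k x"] by (simp add: field2_def add.commute)
  qed
  then show ?thesis by (simp add: card_sites)
qed

text \<open>A nonzero entry of \<open>k\<close> lies strictly between 0 and \<open>N\<close>, so
  half its frequency lies in the open interval from 0 to pi. This permits division by
  \<open>om2 k\<close> without pinning.\<close>

lemma om2_pos:
  assumes "nonzero k"
  shows "om2 k > 0"
proof -
  obtain i where i: "i \<in> {1..d}" "k i \<noteq> 0" using assms by (auto simp: nonzero_def)
  then have ki: "0 < k i" "k i < int N" using assms by (auto simp: nonzero_def sites_def PiE_iff order_le_less)
  have "0 < freq N k i / 2" using ki(1) N_pos by (simp add: freq_def)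
  moreover have "freq N k i / 2 < pi"
    using ki(2) N_pos by (simp add: freq_def field_simps of_int_less_iff[symmetric, where 'a=real] del: of_int_less_iff)
  ultimately have "sin (freq N k i / 2) > 0" by (rule sin_gt_zero)
  then have "0 < (sin (freq N k i / 2))\<^sup>2" by simp
  also have "\<dots> \<le> (\<Sum>i=1..d. (sin (freq N k i / 2))\<^sup>2)" using i by (intro member_le_sum) auto
  finally have "0 < 4 * \<alpha> * (\<Sum>i=1..d. (sin (freq N k i / 2))\<^sup>2)" using \<alpha> by simp
  then show ?thesis unfolding om2_def using \<nu> by linarith
qed

abbreviation "shell_int \<E> \<delta> F \<equiv> (\<integral>\<eta>. indicator (micro_shell d N \<alpha> \<nu> \<E> \<delta>) \<eta> * F \<eta> \<partial>phase_lborel d N)"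

text \<open>For every vector field \<open>V\<close> the field \<open>HH V - (V H) R\<close>, with \<open>R\<close> the Euler field, is tangent to the
  energy surface. The divergence theorem for \<open>V = field1\<close> eliminates the momenta from the moment, and
  \<open>V = field2 k\<close> then eliminates the positions.\<close>

lemma shell_moment:
  assumes k: "nonzero k" and \<delta>: "0 < \<delta>" "\<delta> \<le> 1"
  shows "shell_int \<E> \<delta> (\<lambda>\<eta>. JJ k \<eta> * J \<eta>)
    = - \<alpha> * sin (freq N k 1) * real d * real (N ^ d) / (om2 k * nn * (nn + 2)) * shell_int \<E> \<delta> (\<lambda>\<eta>. (HH \<eta>)\<^sup>2)"
proof -
  let ?I = "shell_int \<E> \<delta>" and ?s = "\<alpha> * sin (freq N k 1)"
  have int: "integrable (phase_lborel d N) (\<lambda>\<eta>. indicator (micro_shell d N \<alpha> \<nu> \<E> \<delta>) \<eta> * F \<eta>)" if "F \<in> polys A" for F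
    by (rule shell_integrable[OF that \<delta>])
  have lin2: "?I (\<lambda>\<eta>. a * F \<eta> + b * G \<eta>) = a * ?I F + b * ?I G" if "F \<in> polys A" "G \<in> polys A" for a b F G
  proof -
    have "?I (\<lambda>\<eta>. a * F \<eta> + b * G \<eta>) = (\<integral>\<eta>. a * (indicator (micro_shell d N \<alpha> \<nu> \<E> \<delta>) \<eta> * F \<eta>)
        + b * (indicator (micro_shell d N \<alpha> \<nu> \<E> \<delta>) \<eta> * G \<eta>) \<partial>phase_lborel d N)"
      by (intro Bochner_Integration.integral_cong refl) (simp add: algebra_simps)
    then show ?thesis using int[OF that(1)] int[OF that(2)] by simp
  qed
  have C: "C1 (euler c)" "C1 (field1 c)" "C1 (field2 k c)" if "c \<in> A" for c
    using field_polys(1,2)[OF that] field_polys(3)[OF that, of k] by (auto intro: polys_Ck)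
  \<comment> \<open>The weight \<open>JJ k\<close> is chosen so that the divergence contains
    \<open>JJ k\<close> times the current. The weight \<open>HH\<close> in \<open>K2\<close> matches
    the other moment that \<open>K1\<close> produces.\<close>
  define K1 where "K1 c \<eta> = (HH \<eta> * field1 c \<eta> - J \<eta> * euler c \<eta>) * JJ k \<eta>" for c \<eta>
  define K2 where "K2 c \<eta> = (HH \<eta> * field2 k c \<eta> - (om2 k * BB k \<eta>) * euler c \<eta>) * HH \<eta>" for c \<eta>
  have J: "C1 J" by (rule polys_Ck[OF total_current_polys])
  have dv1: "dv A K1 f \<eta> = JJ k \<eta> * (HH \<eta> * dv A field1 f \<eta> - J \<eta> * dv A euler f \<eta>)" for f \<eta>
    unfolding K1_def[abs_def] by (rule dv_comb)
  have dv2: "dv A K2 f \<eta> = HH \<eta> * (HH \<eta> * dv A (field2 k) f \<eta> - om2 k * BB k \<eta> * dv A euler f \<eta>)" for f \<eta>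
    unfolding K2_def[abs_def] by (rule dv_comb)
  have kap1: "kap = 1" if "\<nu> = 0" unfolding kap_def by (rule if_P[OF that])
  have "?I (dvg A K1) = 0"
  proof (rule shell_divergence[OF _ \<delta>])
    show "K1 c \<in> polys A" if "c \<in> A" for c
      unfolding K1_def[abs_def] using field_polys[OF that] by (intro polys_intros) simp_all
    show "dv A K1 H = (\<lambda>_. 0)" by (rule ext) (simp add: dv1 field1_H euler_H)
    show "dv A K1 (P j) = (\<lambda>_. 0)" "dv A K1 (Q j) = (\<lambda>_. 0)" if "\<nu> = 0" "j \<in> {1..d}" for j
      by (rule ext, simp add: dv1 field1_lin[OF that(2)] euler_PQ[OF that(2)] kap1[OF that(1)])+
  qed
  \<comment> \<open>The derivative of \<open>HH\<close> along \<open>field1\<close> cancels that of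
    the current along the Euler field. The Euler divergence gives \<open>nn\<close>, and the degree
    2 of \<open>JJ k\<close> gives the additional 2.\<close>
  moreover have "dvg A K1 = (\<lambda>\<eta>. - (nn + 2) * (JJ k \<eta> * J \<eta>) + - ?s * (HH \<eta> * BB k \<eta>))"
  proof
    fix \<eta>
    show "dvg A K1 \<eta> = - (nn + 2) * (JJ k \<eta> * J \<eta>) + - ?s * (HH \<eta> * BB k \<eta>)"
      unfolding K1_def[abs_def]
      by (subst dvg_comb[OF Ck_HH J Ck_JJ C(2) C(1)])
         (simp_all only: dvg_field1 dvg_euler field1_HH euler_J field1_JJ euler_JJ[OF k], simp add: algebra_simps)
  qed
  ultimately have e1: "- (nn + 2) * ?I (\<lambda>\<eta>. JJ k \<eta> * J \<eta>) + - ?s * ?I (\<lambda>\<eta>. HH \<eta> * BB k \<eta>) = 0"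
    using lin2[of "\<lambda>\<eta>. JJ k \<eta> * J \<eta>" "\<lambda>\<eta>. HH \<eta> * BB k \<eta>" "- (nn + 2)" "- ?s"] by (simp only: polys.mult JJ_polys total_current_polys HH_polys BB_polys)
  have Bp: "(\<lambda>\<eta>. om2 k * BB k \<eta>) \<in> polys A" by (intro polys_intros BB_polys)
  have "?I (dvg A K2) = 0"
  proof (rule shell_divergence[OF _ \<delta>])
    show "K2 c \<in> polys A" if "c \<in> A" for c
      unfolding K2_def[abs_def] using field_polys[OF that] by (intro polys_intros) simp_all
    show "dv A K2 H = (\<lambda>_. 0)" by (rule ext) (simp add: dv2 field2_H euler_H)
    show "dv A K2 (P j) = (\<lambda>_. 0)" "dv A K2 (Q j) = (\<lambda>_. 0)" if "\<nu> = 0" "j \<in> {1..d}" for j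
      by (rule ext, simp add: dv2 field2_PQ[OF that(2)] k euler_PQ[OF that(2)] kap1[OF that(1)])+
  qed
  \<comment> \<open>All terms that come from differentiating \<open>HH\<close> and
    \<open>BB k\<close> cancel; only the divergences of the two fields remain.\<close>
  moreover have "dvg A K2 = (\<lambda>\<eta>. real d * real (N ^ d) * (HH \<eta>)\<^sup>2 + - nn * om2 k * (HH \<eta> * BB k \<eta>))"
  proof
    fix \<eta>
    have eB: "dv A euler (\<lambda>\<eta>. om2 k * BB k \<eta>) \<eta> = 2 * om2 k * BB k \<eta>"
      by (simp add: deriv_cmult[OF derivation_dv] euler_BB[OF k])
    show "dvg A K2 \<eta> = real d * real (N ^ d) * (HH \<eta>)\<^sup>2 + - nn * om2 k * (HH \<eta> * BB k \<eta>)"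
      unfolding K2_def[abs_def]
      by (subst dvg_comb[OF Ck_HH polys_Ck[OF Bp] Ck_HH C(3) C(1)])
         (simp_all only: dvg_field2 dvg_euler field2_HH eB euler_HH, simp add: power2_eq_square algebra_simps)
  qed
  ultimately have e2: "real d * real (N ^ d) * ?I (\<lambda>\<eta>. (HH \<eta>)\<^sup>2) + - nn * om2 k * ?I (\<lambda>\<eta>. HH \<eta> * BB k \<eta>) = 0"
    using lin2[of "\<lambda>\<eta>. (HH \<eta>)\<^sup>2" "\<lambda>\<eta>. HH \<eta> * BB k \<eta>" "real d * real (N ^ d)" "- nn * om2 k"]
    by (simp only: polys.mult polys_power HH_polys BB_polys)
  \<comment> \<open>Elimination of the common moment \<open>b\<close> of \<open>HH\<close> and
    \<open>BB k\<close> from the two linear equations.\<close>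
  have "a = - s * D / (o2 * n * (n + 2)) * h"
    if "- (n + 2) * a + - s * b = 0" "D * h + - n * o2 * b = 0" "n > 0" "o2 > 0" for a b h s D o2 n :: real
  proof -
    have "b = D * h / (n * o2)" using that by (simp add: field_simps)
    moreover have "a = - s * b / (n + 2)" using that by (simp add: field_simps)
    ultimately show ?thesis by (simp add: field_simps)
  qed
  from this[OF e1 e2 nn_pos om2_pos[OF k]] show ?thesis by (simp only: mult.assoc minus_mult_left)
qed

end

section \<open>Passage from thin shells to the microcanonical measure\<close>

lemma integral_uniform_measure:
  fixes f :: "'a \<Rightarrow> real"
  assumes S: "S \<in> sets M" and fin: "emeasure M S \<noteq> \<infinity>" and pos: "emeasure M S \<noteq> 0" and f: "f \<in> borel_measurable M"
  shows "(\<integral>x. f x \<partial>uniform_measure M S) = (\<integral>x. indicator S x * f x \<partial>M) / measure M S"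
proof -
  have m: "emeasure M S = ennreal (measure M S)" using fin by (simp add: emeasure_eq_ennreal_measure)
  then have mp: "measure M S > 0" using pos by (simp add: zero_less_measure_iff)
  have "indicator S x / emeasure M S = ennreal (indicator S x / measure M S)" for x
    unfolding m using mp by (simp add: divide_ennreal indicator_def ennreal_divide_numeral flip: ennreal_1)
  then have "uniform_measure M S = density M (\<lambda>x. ennreal (indicator S x / measure M S))"
    by (simp add: uniform_measure_def)
  then have "(\<integral>x. f x \<partial>uniform_measure M S) = (\<integral>x. (indicator S x / measure M S) * f x \<partial>M)"
    using S f mp by (simp add: integral_density)
  also have "\<dots> = (\<integral>x. (indicator S x * f x) / measure M S \<partial>M)" by simp
  finally show ?thesis by simp
qed

context chain
begin

abbreviation "PS \<equiv> phase_space d N"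
abbreviation "ML \<equiv> phase_lborel d N"
abbreviation "shell \<E> \<delta> \<equiv> micro_shell d N \<alpha> \<nu> \<E> \<delta>"

lemma shell_sets: "0 < \<delta> \<Longrightarrow> shell \<E> \<delta> \<in> sets ML"
proof -
  assume \<delta>: "0 < \<delta>"
  have "weight (real N ^ d * \<E>) \<delta> \<in> borel_measurable ML"
    using tame_C1_weight[of "real N ^ d * \<E>" \<delta>] by (simp add: tame_C1_def tame_def phase_lborel_def)
  then have "{\<eta> \<in> space ML. weight (real N ^ d * \<E>) \<delta> \<eta> \<noteq> 0} \<in> sets ML" by measurable
  then show ?thesis by (simp only: shell_eq[OF \<delta>] space_PL)
qed

lemma shell_finite:
  assumes "0 < \<delta>" "\<delta> \<le> 1"
  shows "emeasure ML (shell \<E> \<delta>) \<noteq> \<infinity>"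
proof -
  have "integrable ML (\<lambda>\<eta>. indicator (shell \<E> \<delta>) \<eta> * 1 :: real)"
    by (rule shell_integrable[OF polys.const assms])
  then show ?thesis using shell_sets[OF assms(1)] by (simp add: integrable_indicator_iff sets.Int_space_eq2)
qed

text \<open>Truncation turns polynomials into bounded continuous functions, the only ones for which
  the weak limit is given.\<close>

definition clamp :: "real \<Rightarrow> real \<Rightarrow> real" where
  "clamp K x = max (- K) (min K x)"

lemma clamp_id: "\<bar>x\<bar> \<le> K \<Longrightarrow> clamp K x = x"
  by (auto simp: clamp_def)

lemma clamp_bounded: "\<bar>clamp K x\<bar> \<le> \<bar>K\<bar>"
  by (auto simp: clamp_def)

context
  fixes \<E> :: real and \<mu> :: "config measure"
  assumes micro: "microcanonical d N \<alpha> \<nu> \<E> \<mu>"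
begin

lemma micro_prob: "prob_space \<mu>"
  and micro_sets: "sets \<mu> = sets ML"
  using micro by (auto simp: microcanonical_def)

lemma micro_measurable: "f \<in> borel_measurable ML \<Longrightarrow> f \<in> borel_measurable \<mu>"
  using micro_sets by (simp cong: measurable_cong_sets)

text \<open>Positivity of the shell volume is extracted from the weak limit itself, which makes the
  quotient a genuine mean for small \<open>\<delta>\<close>.\<close>

lemma shell_mean_tendsto:
  assumes f: "f \<in> borel_measurable ML" "continuous_on UNIV f" "\<And>\<eta>. \<bar>f \<eta>\<bar> \<le> (K::real)"
  shows "((\<lambda>\<delta>. shell_int \<E> \<delta> f / measure ML (shell \<E> \<delta>)) \<longlongrightarrow> (\<integral>\<eta>. f \<eta> \<partial>\<mu>)) (at_right 0)"
    and "\<forall>\<^sub>F \<delta> in at_right 0. measure ML (shell \<E> \<delta>) > 0"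
proof -
  interpret prob_space \<mu> by (rule micro_prob)
  have lim: "((\<lambda>\<delta>. \<integral>\<eta>. g \<eta> \<partial>uniform_measure ML (shell \<E> \<delta>)) \<longlongrightarrow> (\<integral>\<eta>. g \<eta> \<partial>\<mu>)) (at_right 0)"
    if "continuous_on PS g" "\<And>\<eta>. \<bar>g \<eta>\<bar> \<le> K" for g :: "config \<Rightarrow> real" and K
  proof -
    have "bounded (g ` PS)" using that(2) by (intro boundedI[of _ K]) auto
    then show ?thesis using micro that(1) unfolding microcanonical_def by blast
  qed
  have ev: "\<forall>\<^sub>F \<delta> in at_right (0::real). 0 < \<delta> \<and> \<delta> \<le> 1"
    unfolding eventually_at_right_field by (intro exI[of _ 1]) auto
  \<comment> \<open>Conditioning on a null set yields the zero measure, whose integral of 1 cannot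
    converge to 1; hence shells are eventually not null.\<close>
  have "((\<lambda>\<delta>. \<integral>\<eta>. (1::real) \<partial>uniform_measure ML (shell \<E> \<delta>)) \<longlongrightarrow> 1) (at_right 0)"
    using lim[of "\<lambda>_. 1" 1] by (simp add: prob_space)
  then have "\<forall>\<^sub>F \<delta> in at_right 0. (\<integral>\<eta>. 1 \<partial>uniform_measure ML (shell \<E> \<delta>)) > (0::real)"
    by (rule order_tendstoD) simp
  with ev have pos: "\<forall>\<^sub>F \<delta> in at_right 0. 0 < \<delta> \<and> \<delta> \<le> 1 \<and> emeasure ML (shell \<E> \<delta>) \<noteq> 0"
  proof eventually_elim
    case (elim \<delta>)
    have "emeasure ML (shell \<E> \<delta>) \<noteq> 0"
    proof
      assume z: "emeasure ML (shell \<E> \<delta>) = 0"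
      have s: "shell \<E> \<delta> \<in> sets ML" using elim by (intro shell_sets) simp
      then have "emeasure (uniform_measure ML (shell \<E> \<delta>)) (space ML) = 0"
        using z by (simp add: sets.Int_space_eq2)
      then have "measure (uniform_measure ML (shell \<E> \<delta>)) (space ML) = 0" by (simp add: measure_def)
      then show False using elim by simp
    qed
    then show ?case using elim by simp
  qed
  then show "\<forall>\<^sub>F \<delta> in at_right 0. measure ML (shell \<E> \<delta>) > 0"
    by eventually_elim (use shell_finite in \<open>auto simp: measure_def enn2real_positive_iff less_top[symmetric] zero_less_iff_neq_zero\<close>)
  have "((\<lambda>\<delta>. \<integral>\<eta>. f \<eta> \<partial>uniform_measure ML (shell \<E> \<delta>)) \<longlongrightarrow> (\<integral>\<eta>. f \<eta> \<partial>\<mu>)) (at_right 0)"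
    using f(2) by (intro lim[OF _ f(3)]) (auto intro: continuous_on_subset)
  then show "((\<lambda>\<delta>. shell_int \<E> \<delta> f / measure ML (shell \<E> \<delta>)) \<longlongrightarrow> (\<integral>\<eta>. f \<eta> \<partial>\<mu>)) (at_right 0)"
  proof (rule Lim_transform_eventually)
    show "\<forall>\<^sub>F \<delta> in at_right 0. (\<integral>\<eta>. f \<eta> \<partial>uniform_measure ML (shell \<E> \<delta>)) = shell_int \<E> \<delta> f / measure ML (shell \<E> \<delta>)"
      using pos
    proof eventually_elim
      case (elim \<delta>)
      then show ?case by (intro integral_uniform_measure shell_sets shell_finite f(1)) auto
    qed
  qed
qed

text \<open>One square comes from the energy and two from each component; each is below the square
  of \<open>\<delta>\<close>, hence at most \<open>\<delta>\<close>.\<close>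

lemma GG_on_shell:
  assumes \<delta>: "0 < \<delta>" "\<delta> \<le> 1" and \<eta>: "\<eta> \<in> shell \<E> \<delta>"
  shows "GG (real N ^ d * \<E>) \<eta> \<le> (1 + 2 * real d) * \<delta>"
proof -
  let ?e = "real N ^ d * \<E>"
  have w: "\<bar>H \<eta> - ?e\<bar> < \<delta>" "\<nu> = 0 \<Longrightarrow> \<forall>j\<in>{1..d}. \<bar>P j \<eta>\<bar> < \<delta> \<and> \<bar>Q j \<eta>\<bar> < \<delta>"
    using \<eta> unfolding shell_eq[OF \<delta>(1)] weight_neq_0_iff[OF \<delta>(1)] by auto
  have sq: "x\<^sup>2 \<le> \<delta>" if "\<bar>x\<bar> < \<delta>" for x
  proof -
    have "x\<^sup>2 \<le> \<delta>\<^sup>2" using that by (simp add: abs_le_square_iff[symmetric])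
    also have "\<dots> \<le> \<delta>" using \<delta> by (simp add: power2_eq_square mult_left_le)
    finally show ?thesis .
  qed
  have "kap * (\<Sum>j=1..d. (P j \<eta>)\<^sup>2 + (Q j \<eta>)\<^sup>2) \<le> 2 * real d * \<delta>"
  proof (cases "\<nu> = 0")
    case True
    have "(\<Sum>j=1..d. (P j \<eta>)\<^sup>2 + (Q j \<eta>)\<^sup>2) \<le> (\<Sum>j=1..d. 2 * \<delta>)"
    proof (rule sum_mono)
      fix j assume "j \<in> {1..d}"
      then have "\<bar>P j \<eta>\<bar> < \<delta>" "\<bar>Q j \<eta>\<bar> < \<delta>" using w(2)[OF True] by auto
      then show "(P j \<eta>)\<^sup>2 + (Q j \<eta>)\<^sup>2 \<le> 2 * \<delta>" using sq[of "P j \<eta>"] sq[of "Q j \<eta>"] by linarith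
    qed
    also have "\<dots> = 2 * real d * \<delta>" by simp
    moreover have "kap = 1" unfolding kap_def by (rule if_P[OF True])
    ultimately show ?thesis by simp
  qed (use \<delta> in \<open>simp add: kap_def\<close>)
  then show ?thesis unfolding GG_def using sq[OF w(1)] by (simp add: algebra_simps)
qed

text \<open>The bounded test function \<open>min 1 GG\<close> has shell mean of order
  \<open>\<delta>\<close>, so its integral under the limit is 0.\<close>

lemma micro_support: "AE \<eta> in \<mu>. GG (real N ^ d * \<E>) \<eta> = 0"
proof -
  interpret prob_space \<mu> by (rule micro_prob)
  define f where "f \<eta> = min 1 (GG (real N ^ d * \<E>) \<eta>)" for \<eta>
  have fM: "f \<in> borel_measurable ML"
    unfolding f_def[abs_def] phase_lborel_def by (intro borel_measurable_min borel_measurable_const polys_measurable GG_polys)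
  have fc: "continuous_on UNIV f"
    unfolding f_def[abs_def] by (intro continuous_intros Ck_continuous[OF Ck_GG[of 0]])
  have f0: "0 \<le> f \<eta>" and f1: "\<bar>f \<eta>\<bar> \<le> 1" for \<eta> using GG_nonneg[of "real N ^ d * \<E>" \<eta>] by (auto simp: f_def)
  have "(\<integral>\<eta>. f \<eta> \<partial>\<mu>) \<le> 0"
  proof (rule tendsto_le[OF _ _ shell_mean_tendsto(1)[OF fM fc f1]])
    show "((\<lambda>\<delta>. (1 + 2 * real d) * \<delta>) \<longlongrightarrow> 0) (at_right 0)"
      by (auto intro!: tendsto_eq_intros)
    have ev: "\<forall>\<^sub>F \<delta> in at_right (0::real). 0 < \<delta> \<and> \<delta> \<le> 1"
      unfolding eventually_at_right_field by (intro exI[of _ 1]) auto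
    show "\<forall>\<^sub>F \<delta> in at_right 0. shell_int \<E> \<delta> f / measure ML (shell \<E> \<delta>) \<le> (1 + 2 * real d) * \<delta>"
      using ev shell_mean_tendsto(2)[OF fM fc f1]
    proof eventually_elim
      case (elim \<delta>)
      then have \<delta>: "0 < \<delta>" "\<delta> \<le> 1" by auto
      have i1: "integrable ML (\<lambda>\<eta>. indicator (shell \<E> \<delta>) \<eta> * 1 :: real)" by (rule shell_integrable[OF polys.const \<delta>])
      have "shell_int \<E> \<delta> f \<le> (\<integral>\<eta>. ((1 + 2 * real d) * \<delta>) * (indicator (shell \<E> \<delta>) \<eta> * 1) \<partial>ML)"
      proof (rule integral_mono)
        show "integrable ML (\<lambda>\<eta>. ((1 + 2 * real d) * \<delta>) * (indicator (shell \<E> \<delta>) \<eta> * 1))"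
          using i1 by (rule integrable_mult_right)
        show "integrable ML (\<lambda>\<eta>. indicator (shell \<E> \<delta>) \<eta> * f \<eta>)"
          by (rule Bochner_Integration.integrable_bound[OF i1])
             (use fM shell_sets[OF \<delta>(1)] f1 in \<open>auto simp: abs_mult indicator_def\<close>)
        show "indicator (shell \<E> \<delta>) \<eta> * f \<eta> \<le> ((1 + 2 * real d) * \<delta>) * (indicator (shell \<E> \<delta>) \<eta> * 1)" for \<eta>
          using GG_on_shell[OF \<delta>, of \<eta>] by (auto simp: indicator_def f_def)
      qed
      also have "\<dots> = ((1 + 2 * real d) * \<delta>) * measure ML (shell \<E> \<delta>)"
        using shell_sets[OF \<delta>(1)] by (simp add: sets.Int_space_eq2)
      finally show ?case using elim by (simp add: pos_divide_le_eq)
    qed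
  qed simp
  moreover have "(\<integral>\<eta>. f \<eta> \<partial>\<mu>) \<ge> 0" using f0 by simp
  ultimately have "(\<integral>\<eta>. f \<eta> \<partial>\<mu>) = 0" by simp
  moreover have "integrable \<mu> f" by (rule integrable_const_bound[of _ 1]) (use f1 micro_measurable[OF fM] in auto)
  ultimately have "AE \<eta> in \<mu>. f \<eta> = 0" using integral_nonneg_eq_0_iff_AE[of \<mu> f] f0 by simp
  then show ?thesis by eventually_elim (auto simp: f_def min_def split: if_splits)
qed

text \<open>The shell volume divides both sides of the hypothesis and \<open>c\<close> does not
  depend on \<open>\<delta>\<close>, so an exact shell identity survives the weak limit.\<close>

lemma micro_transfer:
  assumes F: "F \<in> polys A" and G: "G \<in> polys A"
    and eq: "\<And>\<delta>. 0 < \<delta> \<Longrightarrow> \<delta> \<le> 1 \<Longrightarrow> shell_int \<E> \<delta> F = c * shell_int \<E> \<delta> G"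
  shows "(\<integral>\<eta>. F \<eta> \<partial>\<mu>) = c * (\<integral>\<eta>. G \<eta> \<partial>\<mu>)"
proof -
  interpret prob_space \<mu> by (rule micro_prob)
  let ?e = "real N ^ d * \<E>"
  obtain R where R: "\<And>\<eta>. weight ?e 1 \<eta> \<noteq> 0 \<Longrightarrow> \<forall>c\<in>A. \<bar>\<eta> c\<bar> \<le> R" using weight_support[of 1 ?e] by auto
  obtain K1 where K1: "\<And>\<eta>. (\<forall>c\<in>A. \<bar>\<eta> c\<bar> \<le> R) \<Longrightarrow> \<bar>F \<eta>\<bar> \<le> K1" using polys_bounded[OF F] by blast
  obtain K2 where K2: "\<And>\<eta>. (\<forall>c\<in>A. \<bar>\<eta> c\<bar> \<le> R) \<Longrightarrow> \<bar>G \<eta>\<bar> \<le> K2" using polys_bounded[OF G] by blast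
  \<comment> \<open>A bound on the shell of thickness 1, which contains all thinner shells and the
    surface itself; truncation at this level changes none of the integrals involved.\<close>
  define K where "K = max K1 K2"
  have K: "\<bar>F \<eta>\<bar> \<le> K" "\<bar>G \<eta>\<bar> \<le> K" if "weight ?e 1 \<eta> \<noteq> 0" for \<eta>
    using K1[OF R[OF that]] K2[OF R[OF that]] by (auto simp: K_def)
  have w1: "weight ?e 1 \<eta> \<noteq> 0" if "\<eta> \<in> shell \<E> \<delta>" "0 < \<delta>" "\<delta> \<le> 1" for \<eta> \<delta>
    using that(1) unfolding shell_eq[OF that(2)] using that(2,3)
    by (auto simp: weight_neq_0_iff[OF that(2)] weight_neq_0_iff[of 1] dest!: bspec)
  have GG0: "weight ?e 1 \<eta> \<noteq> 0" if "GG ?e \<eta> = 0" for \<eta>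
  proof -
    have nn: "0 \<le> (\<Sum>j=1..d. (P j \<eta>)\<^sup>2 + (Q j \<eta>)\<^sup>2)" by (intro sum_nonneg) auto
    have "H \<eta> = ?e" "kap * (\<Sum>j=1..d. (P j \<eta>)\<^sup>2 + (Q j \<eta>)\<^sup>2) = 0"
      using that nn kap_nonneg unfolding GG_def by (auto simp: add_nonneg_eq_0_iff)
    moreover have "P j \<eta> = 0 \<and> Q j \<eta> = 0" if "\<nu> = 0" "j \<in> {1..d}" for j
    proof -
      have "kap = 1" unfolding kap_def by (rule if_P[OF that(1)])
      then have "(\<Sum>j=1..d. (P j \<eta>)\<^sup>2 + (Q j \<eta>)\<^sup>2) = 0" using calculation(2) by simp
      then have "(P j \<eta>)\<^sup>2 + (Q j \<eta>)\<^sup>2 = 0" using that(2) by (subst (asm) sum_nonneg_eq_0_iff) auto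
      then show ?thesis by (simp add: sum_power2_eq_zero_iff)
    qed
    ultimately show ?thesis by (simp add: weight_neq_0_iff)
  qed
  have cl: "(\<lambda>\<eta>. clamp K (E \<eta>)) \<in> borel_measurable ML" "continuous_on UNIV (\<lambda>\<eta>. clamp K (E \<eta>))" if "E \<in> polys A" for E
  proof -
    show "(\<lambda>\<eta>. clamp K (E \<eta>)) \<in> borel_measurable ML"
      unfolding clamp_def phase_lborel_def by (intro borel_measurable_max borel_measurable_min borel_measurable_const polys_measurable that)
    show "continuous_on UNIV (\<lambda>\<eta>. clamp K (E \<eta>))"
      unfolding clamp_def by (intro continuous_intros Ck_continuous[OF polys_Ck[OF that, of 0]])
  qed
  have cl_shell: "shell_int \<E> \<delta> (\<lambda>\<eta>. clamp K (E \<eta>)) = shell_int \<E> \<delta> E"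
    if "0 < \<delta>" "\<delta> \<le> 1" "\<And>\<eta>. weight ?e 1 \<eta> \<noteq> 0 \<Longrightarrow> \<bar>E \<eta>\<bar> \<le> K" for \<delta> E
    by (rule Bochner_Integration.integral_cong[OF refl]) (use w1 that in \<open>auto simp: indicator_def clamp_id\<close>)
  have cl_mu: "(\<integral>\<eta>. clamp K (E \<eta>) \<partial>\<mu>) = (\<integral>\<eta>. E \<eta> \<partial>\<mu>)"
    if "E \<in> polys A" "\<And>\<eta>. weight ?e 1 \<eta> \<noteq> 0 \<Longrightarrow> \<bar>E \<eta>\<bar> \<le> K" for E
  proof (rule integral_cong_AE)
    show "(\<lambda>\<eta>. clamp K (E \<eta>)) \<in> borel_measurable \<mu>" by (rule micro_measurable[OF cl(1)[OF that(1)]])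
    show "E \<in> borel_measurable \<mu>" by (rule micro_measurable) (simp add: phase_lborel_def polys_measurable that(1))
    show "AE \<eta> in \<mu>. clamp K (E \<eta>) = E \<eta>"
      using micro_support by eventually_elim (intro clamp_id that(2) GG0)
  qed
  have "((\<lambda>\<delta>. shell_int \<E> \<delta> (\<lambda>\<eta>. clamp K (F \<eta>)) / measure ML (shell \<E> \<delta>)) \<longlongrightarrow> (\<integral>\<eta>. F \<eta> \<partial>\<mu>)) (at_right 0)"
    using shell_mean_tendsto(1)[OF cl[OF F] clamp_bounded] cl_mu[OF F K(1)] by simp
  moreover have "((\<lambda>\<delta>. c * (shell_int \<E> \<delta> (\<lambda>\<eta>. clamp K (G \<eta>)) / measure ML (shell \<E> \<delta>))) \<longlongrightarrow> c * (\<integral>\<eta>. G \<eta> \<partial>\<mu>)) (at_right 0)"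
    using shell_mean_tendsto(1)[OF cl[OF G] clamp_bounded] cl_mu[OF G K(2)] by (intro tendsto_mult_left) simp
  moreover have "\<forall>\<^sub>F \<delta> in at_right 0. c * (shell_int \<E> \<delta> (\<lambda>\<eta>. clamp K (G \<eta>)) / measure ML (shell \<E> \<delta>))
      = shell_int \<E> \<delta> (\<lambda>\<eta>. clamp K (F \<eta>)) / measure ML (shell \<E> \<delta>)"
    unfolding eventually_at_right_field
    by (intro exI[of _ 1] conjI allI impI) (simp_all add: cl_shell[OF _ _ K(1)] cl_shell[OF _ _ K(2)] eq)
  ultimately have "((\<lambda>\<delta>. shell_int \<E> \<delta> (\<lambda>\<eta>. clamp K (F \<eta>)) / measure ML (shell \<E> \<delta>)) \<longlongrightarrow> c * (\<integral>\<eta>. G \<eta> \<partial>\<mu>)) (at_right 0)"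
    by (rule_tac Lim_transform_eventually)
  then show ?thesis
    using \<open>((\<lambda>\<delta>. shell_int \<E> \<delta> (\<lambda>\<eta>. clamp K (F \<eta>)) / measure ML (shell \<E> \<delta>)) \<longlongrightarrow> (\<integral>\<eta>. F \<eta> \<partial>\<mu>)) (at_right 0)\<close>
    by (intro tendsto_unique[of "at_right 0"]) auto
qed

text \<open>On the surface the total momentum vanishes where \<open>kap\<close> sees it, so
  \<open>HH\<close> is almost surely the constant 2 N^d \<E>.\<close>

lemma micro_moment:
  assumes k: "nonzero k"
  shows "(\<integral>\<eta>. JJ k \<eta> * J \<eta> \<partial>\<mu>)
    = - \<alpha> * sin (freq N k 1) * real d * real (N ^ d) / (om2 k * nn * (nn + 2)) * (2 * (real N ^ d * \<E>))\<^sup>2"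
proof -
  interpret prob_space \<mu> by (rule micro_prob)
  let ?e = "real N ^ d * \<E>"
  have HHp: "(\<lambda>\<eta>. (HH \<eta>)\<^sup>2) \<in> polys A" by (intro polys_intros HH_polys)
  have "(\<integral>\<eta>. (HH \<eta>)\<^sup>2 \<partial>\<mu>) = (\<integral>\<eta>. (2 * ?e)\<^sup>2 \<partial>\<mu>)"
  proof (rule integral_cong_AE)
    show "(\<lambda>\<eta>. (HH \<eta>)\<^sup>2) \<in> borel_measurable \<mu>"
      by (rule micro_measurable) (simp only: phase_lborel_def polys_measurable[OF HHp])
    show "AE \<eta> in \<mu>. (HH \<eta>)\<^sup>2 = (2 * ?e)\<^sup>2"
      using micro_support
    proof eventually_elim
      fix \<eta> assume g: "GG ?e \<eta> = 0"
      have "0 \<le> kap * (\<Sum>j=1..d. (P j \<eta>)\<^sup>2 + (Q j \<eta>)\<^sup>2)" by (intro mult_nonneg_nonneg kap_nonneg sum_nonneg) auto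
      with g have H: "H \<eta> = ?e" and z: "kap * (\<Sum>j=1..d. (P j \<eta>)\<^sup>2 + (Q j \<eta>)\<^sup>2) = 0"
        unfolding GG_def by (auto simp: add_nonneg_eq_0_iff)
      have "0 \<le> kap * (\<Sum>j=1..d. (P j \<eta>)\<^sup>2)" "kap * (\<Sum>j=1..d. (P j \<eta>)\<^sup>2) \<le> kap * (\<Sum>j=1..d. (P j \<eta>)\<^sup>2 + (Q j \<eta>)\<^sup>2)"
        by (auto intro!: mult_left_mono mult_nonneg_nonneg sum_mono sum_nonneg kap_nonneg)
      then have "kap * (\<Sum>j=1..d. (P j \<eta>)\<^sup>2) = 0" using z by linarith
      then have "kap / real (N ^ d) * (\<Sum>j=1..d. (P j \<eta>)\<^sup>2) = 0" by (simp only: times_divide_eq_left div_0)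
      then show "(HH \<eta>)\<^sup>2 = (2 * ?e)\<^sup>2" by (simp only: HH_def H diff_zero)
    qed
  qed simp
  also have "\<dots> = (2 * ?e)\<^sup>2" by (simp add: prob_space)
  finally have HH: "(\<integral>\<eta>. (HH \<eta>)\<^sup>2 \<partial>\<mu>) = (2 * ?e)\<^sup>2" .
  have "(\<integral>\<eta>. JJ k \<eta> * J \<eta> \<partial>\<mu>) = - \<alpha> * sin (freq N k 1) * real d * real (N ^ d) / (om2 k * nn * (nn + 2)) * (\<integral>\<eta>. (HH \<eta>)\<^sup>2 \<partial>\<mu>)"
    by (rule micro_transfer[OF polys.mult[OF JJ_polys total_current_polys] HHp]) (rule shell_moment[OF k])
  then show ?thesis unfolding HH .
qed

end

end

text \<open>An exact identity at finite volume. One factor \<open>sin (freq N k 1)\<close> stems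
  from the mode expansion of the current and one from the static moment, whence the square.\<close>

lemma correlation_formula:
  assumes "d \<ge> 1" "N \<ge> 3" "\<gamma> \<ge> 0" "\<alpha> > 0" "\<nu> \<ge> 0"
    and md: "microcanonical_diffusion d N \<alpha> \<nu> \<gamma> \<E> M Z" and t: "t \<ge> 0"
  defines "n \<equiv> chain.nn d N \<nu>"
  shows "1 / real N ^ d * (\<integral>w. total_current d N \<alpha> (Z t w) * total_current d N \<alpha> (Z 0 w) \<partial>M)
    = 4 * \<alpha>\<^sup>2 * \<E>\<^sup>2 * real d * (real N ^ d)\<^sup>2 / (n * (n + 2))
      * (1 / real N ^ d * (\<Sum>k\<in>sites d N. (sin (freq N k 1))\<^sup>2 / chain.om2 d N \<alpha> \<nu> k * exp (- \<gamma> * chain.psi d N k * t)))"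
proof -
  interpret chain d N \<alpha> \<nu> using assms by unfold_locales auto
  have diff: "diffusion d N \<alpha> \<nu> \<gamma> M Z" and mu: "microcanonical d N \<alpha> \<nu> \<E> (distr M ML (Z 0))"
    using md by (auto simp: microcanonical_diffusion_def)
  have Z0: "Z 0 \<in> measurable M ML" using diff by (simp add: diffusion_def)
  have "AE w in M. GG (real N ^ d * \<E>) (Z 0 w) = 0"
  proof -
    have GM: "GG (real N ^ d * \<E>) \<in> borel_measurable ML" by (simp add: phase_lborel_def polys_measurable)
    have "{\<eta> \<in> space ML. GG (real N ^ d * \<E>) \<eta> = 0} \<in> sets ML" using GM by measurable
    then show ?thesis using micro_support[OF mu] by (simp add: AE_distr_iff[OF Z0])
  qed
  then interpret chain_diffusion d N \<alpha> \<nu> \<gamma> "real N ^ d * \<E>" M Z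
    using diff by unfold_locales auto
  let ?n = "real (N ^ d)" and ?T = "\<lambda>k. (sin (freq N k 1))\<^sup>2 / om2 k * exp (- \<gamma> * psi k * t)"
  define c where "c = real d * ?n / (nn * (nn + 2)) * (2 * (real N ^ d * \<E>))\<^sup>2"
  have n: "n = nn" by (simp add: n_def)
  have modes: "sin (freq N k 1) * (exp (- \<gamma> * psi k * t) * (\<integral>\<eta>. JJ k \<eta> * J \<eta> \<partial>distr M ML (Z 0))) = - \<alpha> * c * ?T k" if k: "k \<in> S" for k
  proof (cases "k 1 = 0")
    case True then show ?thesis by (simp add: freq_def)
  next
    case False
    then have "nonzero k" using k d by (auto simp: nonzero_def intro: bexI[of _ 1])
    then show ?thesis by (simp add: micro_moment[OF mu] c_def power2_eq_square) (simp add: mult_ac)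
  qed
  have "(\<integral>w. J (Z t w) * J (Z 0 w) \<partial>M) = - \<alpha> / ?n * (\<Sum>k\<in>S. - \<alpha> * c * ?T k)"
    unfolding current_correlation[OF t assms(3)] by (intro arg_cong[where f = "(*) (- \<alpha> / ?n)"] sum.cong refl modes)
  also have "\<dots> = \<alpha>\<^sup>2 * c / ?n * (\<Sum>k\<in>S. ?T k)"
    unfolding sum_distrib_left[symmetric] by (simp add: power2_eq_square)
  also have "\<alpha>\<^sup>2 * c / ?n = 4 * \<alpha>\<^sup>2 * \<E>\<^sup>2 * real d * (real N ^ d)\<^sup>2 / (n * (n + 2))"
    using N_pos unfolding c_def n by (simp add: power_mult_distrib)
  finally show ?thesis by simp
qed

section \<open>The infinite-volume limit\<close>

text \<open>Wave numbers \<open>k / N\<close> fill the unit interval. Using a probability measure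
  makes bounded functions integrable and provides the product measure on the cube.\<close>

definition unif :: "real measure" where
  "unif = uniform_measure lborel {0..1}"

definition torus_measure :: "nat \<Rightarrow> (nat \<Rightarrow> real) measure" where
  "torus_measure d = PiM {1..d} (\<lambda>_. unif)"

definition sinsq :: "nat \<Rightarrow> (nat \<Rightarrow> real) \<Rightarrow> real" where
  "sinsq d y = (\<Sum>i=1..d. (sin (pi * y i))\<^sup>2)"

definition Omega2 :: "nat \<Rightarrow> real \<Rightarrow> real \<Rightarrow> (nat \<Rightarrow> real) \<Rightarrow> real" where
  "Omega2 d \<alpha> \<nu> y = \<nu> + 4 * \<alpha> * sinsq d y"

definition Psi :: "nat \<Rightarrow> (nat \<Rightarrow> real) \<Rightarrow> real" where
  "Psi d y = (if d = 1 then 1/3 * (4 * (sin (pi * y 1))\<^sup>2 + 2 * (sin (2 * pi * y 1))\<^sup>2) else 8 * sinsq d y)"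

definition modef :: "nat \<Rightarrow> real \<Rightarrow> real \<Rightarrow> real \<Rightarrow> real \<Rightarrow> (nat \<Rightarrow> real) \<Rightarrow> real" where
  "modef d \<alpha> \<nu> \<gamma> t y = (sin (2 * pi * y 1))\<^sup>2 / Omega2 d \<alpha> \<nu> y * exp (- \<gamma> * Psi d y * t)"

lemma prob_space_unif: "prob_space unif"
  unfolding unif_def by (rule prob_space_uniform_measure) auto

lemma sets_unif [measurable_cong]: "sets unif = sets borel"
  by (simp add: unif_def)

lemma space_unif [simp]: "space unif = UNIV"
  by (simp add: unif_def)

interpretation unif: prob_space unif by (rule prob_space_unif)

interpretation unifs: product_sigma_finite "\<lambda>_. unif" ..

lemma prob_space_torus: "prob_space (torus_measure d)"
  unfolding torus_measure_def by (rule prob_space_PiM) (rule prob_space_unif)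

lemma integral_unif:
  fixes f :: "real \<Rightarrow> real"
  assumes "f \<in> borel_measurable borel"
  shows "(\<integral>x. f x \<partial>unif) = (\<integral>x. indicator {0..1} x * f x \<partial>lborel)"
  unfolding unif_def using assms by (subst integral_uniform_measure) auto

lemma coord_measurable [measurable]: "i \<in> {1..d} \<Longrightarrow> (\<lambda>y. y i) \<in> borel_measurable (torus_measure d)"
  unfolding torus_measure_def using measurable_component_singleton[of i "{1..d}" "\<lambda>_. unif"]
  by (simp add: measurable_cong_sets[OF refl sets_unif])

lemma sinsq_nonneg: "0 \<le> sinsq d y"
  unfolding sinsq_def by (intro sum_nonneg) auto

lemma sinsq_ge: "i \<in> {1..d} \<Longrightarrow> (sin (pi * y i))\<^sup>2 \<le> sinsq d y"
  unfolding sinsq_def by (rule member_le_sum) auto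

lemma sin_double_sq_le: "(sin (2 * x))\<^sup>2 \<le> 4 * (sin x)\<^sup>2" for x :: real
proof -
  have "(sin (2 * x))\<^sup>2 = 4 * (sin x)\<^sup>2 * (cos x)\<^sup>2" by (simp add: sin_double power_mult_distrib)
  also have "\<dots> \<le> 4 * (sin x)\<^sup>2 * 1" by (intro mult_left_mono) (auto simp: abs_square_le_1)
  finally show ?thesis by simp
qed

text \<open>Comparison with \<open>sinsq\<close> removes the distinction between
  \<open>d = 1\<close> and \<open>d \<ge> 2\<close> from all later estimates.\<close>

lemma Psi_bounds: assumes "d \<ge> 1" shows "sinsq d y \<le> Psi d y" "Psi d y \<le> 8 * sinsq d y"
proof -
  have "sinsq d y \<le> Psi d y \<and> Psi d y \<le> 8 * sinsq d y"
  proof (cases "d = 1")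
    case True
    have s: "sinsq d y = (sin (pi * y 1))\<^sup>2" by (simp add: sinsq_def True)
    have P: "Psi d y = 1/3 * (4 * (sin (pi * y 1))\<^sup>2 + 2 * (sin (2 * pi * y 1))\<^sup>2)" unfolding Psi_def by (rule if_P[OF True])
    have le: "(sin (2 * pi * y 1))\<^sup>2 \<le> 4 * (sin (pi * y 1))\<^sup>2"
      using sin_double_sq_le[of "pi * y 1"] by (simp add: mult.assoc)
    have "x \<le> 1/3 * (4 * x + 2 * z) \<and> 1/3 * (4 * x + 2 * z) \<le> 8 * x" if "z \<le> 4 * x" "0 \<le> z" "0 \<le> x" for x z :: real
      using that by (simp add: field_simps)
    from this[OF le zero_le_power2 zero_le_power2] show ?thesis unfolding s P .
  qed (use sinsq_nonneg[of d y] in \<open>auto simp: Psi_def\<close>)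
  then show "sinsq d y \<le> Psi d y" "Psi d y \<le> 8 * sinsq d y" by auto
qed

lemma modef_nonneg:
  assumes "\<nu> \<ge> 0" "\<alpha> > 0"
  shows "0 \<le> modef d \<alpha> \<nu> \<gamma> t y"
  unfolding modef_def Omega2_def using assms sinsq_nonneg[of d y] by (intro mult_nonneg_nonneg divide_nonneg_nonneg) auto

text \<open>By the double angle formula the numerator is at most 4 \<open>sinsq\<close>, which the
  denominator dominates up to the factor \<alpha>. So without pinning the integrand stays bounded at
  its singular points, where division by 0 gives 0.\<close>

lemma sin_ratio_le:
  assumes "d \<ge> 1" "\<nu> \<ge> 0" "\<alpha> > 0"
  shows "(sin (2 * pi * y 1))\<^sup>2 / Omega2 d \<alpha> \<nu> y \<le> 1 / \<alpha>"
proof (cases "Omega2 d \<alpha> \<nu> y = 0")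
  case False
  then have pos: "Omega2 d \<alpha> \<nu> y > 0" using assms sinsq_nonneg[of d y] by (simp add: Omega2_def less_le)
  have "(sin (2 * pi * y 1))\<^sup>2 \<le> 4 * (sin (pi * y 1))\<^sup>2" using sin_double_sq_le[of "pi * y 1"] by (simp add: mult.assoc)
  also have "\<dots> \<le> 4 * sinsq d y" using sinsq_ge[of 1 d y] assms by simp
  finally have "\<alpha> * (sin (2 * pi * y 1))\<^sup>2 \<le> \<alpha> * (4 * sinsq d y)" using assms(3) by (intro mult_left_mono) auto
  also have "\<dots> \<le> Omega2 d \<alpha> \<nu> y" using assms(2) by (simp add: Omega2_def)
  finally have "\<alpha> * (sin (2 * pi * y 1))\<^sup>2 \<le> Omega2 d \<alpha> \<nu> y" .
  then show ?thesis using pos assms by (simp add: field_simps)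
qed (use assms in simp)

lemma modef_bound:
  assumes "d \<ge> 1" "\<nu> \<ge> 0" "\<alpha> > 0" "\<gamma> \<ge> 0" "t \<ge> 0"
  shows "modef d \<alpha> \<nu> \<gamma> t y \<le> 1 / \<alpha> * exp (- \<gamma> * sinsq d y * t)" "\<bar>modef d \<alpha> \<nu> \<gamma> t y\<bar> \<le> 1 / \<alpha>"
proof -
  have "\<gamma> * sinsq d y * t \<le> \<gamma> * Psi d y * t"
    using assms Psi_bounds(1)[OF assms(1), of y] by (intro mult_right_mono mult_left_mono) auto
  then show 1: "modef d \<alpha> \<nu> \<gamma> t y \<le> 1 / \<alpha> * exp (- \<gamma> * sinsq d y * t)"
    unfolding modef_def using assms sin_ratio_le[OF assms(1-3), of y] by (intro mult_mono) auto
  also have "\<dots> \<le> 1 / \<alpha> * 1" using assms sinsq_nonneg[of d y] by (intro mult_left_mono) auto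
  finally show "\<bar>modef d \<alpha> \<nu> \<gamma> t y\<bar> \<le> 1 / \<alpha>" using modef_nonneg[OF assms(2,3), of d \<gamma> t y] by simp
qed

lemma sinsq_measurable [measurable]: "sinsq d \<in> borel_measurable (torus_measure d)"
  unfolding sinsq_def[abs_def]
  by (intro borel_measurable_sum borel_measurable_power measurable_compose[OF _ borel_measurable_sin] borel_measurable_times borel_measurable_const coord_measurable)

lemma modef_measurable [measurable]:
  assumes "d \<ge> 1"
  shows "modef d \<alpha> \<nu> \<gamma> t \<in> borel_measurable (torus_measure d)"
proof -
  have [measurable]: "(\<lambda>y. y 1) \<in> borel_measurable (torus_measure d)" using assms by (intro coord_measurable) simp
  have [measurable]: "(\<lambda>y. y (Suc 0)) \<in> borel_measurable (torus_measure d)" using assms by (intro coord_measurable) simp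
  have "Psi d \<in> borel_measurable (torus_measure d)"
    unfolding Psi_def[abs_def] by (cases "d = 1") (simp_all only: if_True if_False, measurable)
  then show ?thesis unfolding modef_def[abs_def] Omega2_def by measurable
qed

lemma modef_continuous:
  assumes "d \<ge> 1" and conv: "\<And>i. i \<in> {1..d} \<Longrightarrow> (\<lambda>n. z n i) \<longlonglongrightarrow> y i" and nz: "Omega2 d \<alpha> \<nu> y \<noteq> 0"
  shows "(\<lambda>n. modef d \<alpha> \<nu> \<gamma> t (z n)) \<longlonglongrightarrow> modef d \<alpha> \<nu> \<gamma> t y"
proof -
  have c1: "(\<lambda>n. z n 1) \<longlonglongrightarrow> y 1" using assms(1) by (intro conv) simp
  have s: "(\<lambda>n. sinsq d (z n)) \<longlonglongrightarrow> sinsq d y" unfolding sinsq_def by (intro tendsto_intros conv)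
  have o: "(\<lambda>n. Omega2 d \<alpha> \<nu> (z n)) \<longlonglongrightarrow> Omega2 d \<alpha> \<nu> y" unfolding Omega2_def by (intro tendsto_intros s)
  have p: "(\<lambda>n. Psi d (z n)) \<longlonglongrightarrow> Psi d y"
  proof (cases "d = 1")
    case True
    show ?thesis unfolding Psi_def if_P[OF True] by (intro tendsto_intros c1)
  next
    case False
    show ?thesis unfolding Psi_def if_not_P[OF False] by (intro tendsto_intros s)
  qed
  show ?thesis unfolding modef_def by (intro tendsto_intros c1 o p nz)
qed

text \<open>Half open, so that the cells tile without overlap and membership is the value of a floor
  function.\<close>

definition cell :: "nat \<Rightarrow> int \<Rightarrow> real set" where
  "cell N m = {of_int m / real N ..< (of_int m + 1) / real N}"

lemma cell_iff: "N > 0 \<Longrightarrow> x \<in> cell N m \<longleftrightarrow> \<lfloor>x * real N\<rfloor> = m"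
  unfolding cell_def by (auto simp: field_simps floor_unique floor_eq_iff)

lemma integral_cell:
  assumes "m \<in> {0..<int N}"
  shows "(\<integral>x. indicator (cell N m) x \<partial>unif) = 1 / real N"
proof -
  have N: "N > 0" using assms by auto
  have "cell N m \<subseteq> {0..1}"
  proof
    fix x assume "x \<in> cell N m"
    then have x: "of_int m / real N \<le> x" "x < (of_int m + 1) / real N" by (auto simp: cell_def)
    have "0 \<le> of_int m / real N" using assms by simp
    moreover have "(of_int m + 1) / real N \<le> 1"
    proof -
      have "m + 1 \<le> int N" using assms by simp
      then have "real_of_int (m + 1) \<le> real_of_int (int N)" by (simp only: of_int_le_iff)
      then show ?thesis using N by simp
    qed
    ultimately show "x \<in> {0..1}" using x by auto
  qed
  then have ind: "indicator {0..1} x * indicator (cell N m) x = (indicator (cell N m) x :: real)" for x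
    by (auto simp: indicator_def)
  have "(\<integral>x. indicator (cell N m) x \<partial>unif) = (\<integral>x. indicator {0..1} x * (indicator (cell N m) x :: real) \<partial>lborel)"
    by (rule integral_unif) (simp add: cell_def)
  also have "\<dots> = measure lborel (cell N m)" unfolding ind by simp
  also have "\<dots> = 1 / real N"
    unfolding cell_def using N by (subst measure_lborel_Ico) (auto simp: divide_right_mono diff_divide_distrib[symmetric])
  finally show ?thesis .
qed

text \<open>The average is the integral of a step function on the cube, so the limit over
  \<open>N\<close> becomes a question of dominated convergence.\<close>

lemma lattice_average_eq_integral:
  assumes N: "N > 0"
  shows "1 / real N ^ d * (\<Sum>k\<in>sites d N. F k) = (\<integral>y. (\<Sum>k\<in>sites d N. F k * (\<Prod>i=1..d. indicator (cell N (k i)) (y i))) \<partial>torus_measure d)"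
proof -
  have int: "integrable unif (indicator (cell N m) :: real \<Rightarrow> real)" for m
    by (rule unif.integrable_const_bound[of _ 1]) (auto simp: cell_def sets_unif measurable_cong_sets[OF sets_unif refl])
  have "(\<integral>y. (\<Sum>k\<in>sites d N. F k * (\<Prod>i=1..d. indicator (cell N (k i)) (y i))) \<partial>torus_measure d)
    = (\<Sum>k\<in>sites d N. F k * (\<integral>y. (\<Prod>i=1..d. indicator (cell N (k i)) (y i)) \<partial>torus_measure d))"
    unfolding torus_measure_def
    by (subst Bochner_Integration.integral_sum) (auto intro!: integrable_mult_right unifs.product_integrable_prod int)
  also have "\<dots> = (\<Sum>k\<in>sites d N. F k * (1 / real N ^ d))"
  proof (intro sum.cong refl arg_cong2[where f = "(*)"])
    fix k assume k: "k \<in> sites d N"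
    have "(\<integral>y. (\<Prod>i=1..d. indicator (cell N (k i)) (y i) :: real) \<partial>torus_measure d) = (\<Prod>i=1..d. \<integral>x. indicator (cell N (k i)) x \<partial>unif)"
      unfolding torus_measure_def by (rule unifs.product_integral_prod) (auto intro: int)
    also have "\<dots> = (\<Prod>i=1..d. 1 / real N)"
      using k by (intro prod.cong refl integral_cell) (auto simp: sites_def PiE_iff)
    finally show "(\<integral>y. (\<Prod>i=1..d. indicator (cell N (k i)) (y i) :: real) \<partial>torus_measure d) = 1 / real N ^ d"
      by (simp add: power_one_over)
  qed
  finally show ?thesis by (simp add: sum_divide_distrib)
qed

lemma AE_torus_interior: "AE y in torus_measure d. \<forall>i\<in>{1..d}. 0 < y i \<and> y i < 1"
proof -
  have "AE x in unif. 0 < x \<and> x < 1"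
    unfolding unif_def
  proof (rule AE_uniform_measureI)
    show "AE x in lborel. x \<in> {0..1} \<longrightarrow> 0 < x \<and> x < (1::real)"
      using AE_lborel_singleton[of 0] AE_lborel_singleton[of 1] by eventually_elim auto
  qed simp
  then have "AE y in torus_measure d. 0 < y i \<and> y i < 1" if "i \<in> {1..d}" for i
    unfolding torus_measure_def using AE_PiM_component[OF prob_space_unif that] by blast
  then show ?thesis by (intro AE_finite_allI) auto
qed

text \<open>The step function evaluates \<open>modef\<close> at the rounded-down point and is
  bounded by \<open>1 / \<alpha>\<close>. Without pinning the integrand may be discontinuous at
  corners of the cube, but these lie on its null boundary.\<close>

lemma riemann_sum_tendsto:
  assumes d: "d \<ge> 1" and \<nu>: "\<nu> \<ge> 0" and \<alpha>: "\<alpha> > 0" and \<gamma>: "\<gamma> \<ge> 0" and t: "t \<ge> 0"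
  shows "(\<lambda>N. 1 / real N ^ d * (\<Sum>k\<in>sites d N. modef d \<alpha> \<nu> \<gamma> t (\<lambda>i. of_int (k i) / real N)))
    \<longlonglongrightarrow> (\<integral>y. modef d \<alpha> \<nu> \<gamma> t y \<partial>torus_measure d)"
proof -
  interpret prob_space "torus_measure d" by (rule prob_space_torus)
  define F where "F N k = modef d \<alpha> \<nu> \<gamma> t (\<lambda>i. of_int (k i) / real N)" for N and k :: site
  define s where "s N y = (\<Sum>k\<in>sites d N. F N k * (\<Prod>i=1..d. indicator (cell N (k i)) (y i)))" for N and y :: "nat \<Rightarrow> real"
  have s_eq: "s N y = modef d \<alpha> \<nu> \<gamma> t (\<lambda>i. of_int (\<lfloor>y i * real N\<rfloor>) / real N)"
    if y: "\<forall>i\<in>{1..d}. 0 < y i \<and> y i < 1" and N: "N > 0" for N y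
  proof -
    define k where "k = (\<lambda>i\<in>{1..d}. \<lfloor>y i * real N\<rfloor>)"
    have kS: "k \<in> sites d N"
      unfolding sites_def k_def using y N by (auto simp: floor_less_iff intro!: mult_nonneg_nonneg)
    have prod: "(\<Prod>i=1..d. indicator (cell N (k' i)) (y i)) = (if k' = k then 1 else 0 :: real)" if k': "k' \<in> sites d N" for k'
    proof (cases "k' = k")
      case True
      then show ?thesis by (simp add: k_def cell_iff[OF N])
    next
      case False
      then obtain i where i: "k' i \<noteq> k i" by auto
      have "i \<in> {1..d}"
      proof (rule ccontr)
        assume "i \<notin> {1..d}"
        then have "k' i = undefined" "k i = undefined" using k' kS unfolding sites_def by (auto simp: PiE_iff extensional_def)
        with i show False by simp
      qed
      with i have "y i \<notin> cell N (k' i)" by (auto simp: cell_iff[OF N] k_def)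
      then show ?thesis using \<open>i \<in> {1..d}\<close> False by (auto intro!: prod_zero bexI[of _ i])
    qed
    have "s N y = (\<Sum>k'\<in>sites d N. if k' = k then F N k else 0)"
      unfolding s_def by (intro sum.cong refl) (simp only: prod, simp)
    also have "\<dots> = F N k" using kS by simp
    also have "\<dots> = modef d \<alpha> \<nu> \<gamma> t (\<lambda>i. of_int (\<lfloor>y i * real N\<rfloor>) / real N)"
      using d by (simp add: F_def k_def modef_def Omega2_def Psi_def sinsq_def)
    finally show ?thesis .
  qed
  have "(\<lambda>N. \<integral>y. s (Suc N) y \<partial>torus_measure d) \<longlonglongrightarrow> (\<integral>y. modef d \<alpha> \<nu> \<gamma> t y \<partial>torus_measure d)"
  proof (rule integral_dominated_convergence[where w = "\<lambda>_. 1 / \<alpha>"])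
    show "modef d \<alpha> \<nu> \<gamma> t \<in> borel_measurable (torus_measure d)" by (rule modef_measurable[OF d])
    show "s (Suc N) \<in> borel_measurable (torus_measure d)" for N
    proof -
      have "(\<lambda>y. indicator (cell (Suc N) m) (y i) :: real) \<in> borel_measurable (torus_measure d)" if "i \<in> {1..d}" for m i
        by (rule measurable_compose[OF coord_measurable[OF that]]) (simp add: cell_def)
      then show ?thesis unfolding s_def[abs_def]
        by (intro borel_measurable_sum borel_measurable_times borel_measurable_const borel_measurable_prod)
    qed
    show "AE y in torus_measure d. (\<lambda>N. s (Suc N) y) \<longlonglongrightarrow> modef d \<alpha> \<nu> \<gamma> t y"
      using AE_torus_interior
    proof eventually_elim
      fix y :: "nat \<Rightarrow> real" assume y: "\<forall>i\<in>{1..d}. 0 < y i \<and> y i < 1"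
      have eq: "s (Suc N) y = modef d \<alpha> \<nu> \<gamma> t (\<lambda>i. of_int (\<lfloor>y i * real (Suc N)\<rfloor>) / real (Suc N))" for N
        by (rule s_eq[OF y]) simp
      have y1: "0 < y 1" "y 1 < 1" using y d by auto
      \<comment> \<open>In the open cube the first coordinate alone keeps the denominator away from
        0.\<close>
      have "0 < sin (pi * y 1)" using y1 by (intro sin_gt_zero) auto
      then have "0 < (sin (pi * y 1))\<^sup>2" by simp
      also have "\<dots> \<le> sinsq d y" using d by (intro sinsq_ge) simp
      finally have "0 < 4 * \<alpha> * sinsq d y" using \<alpha> by simp
      then have nz: "Omega2 d \<alpha> \<nu> y \<noteq> 0" unfolding Omega2_def using \<nu> by linarith
      show "(\<lambda>N. s (Suc N) y) \<longlonglongrightarrow> modef d \<alpha> \<nu> \<gamma> t y"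
        unfolding eq
      proof (rule modef_continuous[OF d _ nz])
        fix i
        show "(\<lambda>n. of_int \<lfloor>y i * real (Suc n)\<rfloor> / real (Suc n)) \<longlonglongrightarrow> y i"
          by (rule floor_mult_div_tendsto)
      qed
    qed
    show "AE y in torus_measure d. norm (s (Suc N) y) \<le> 1 / \<alpha>" for N
      using AE_torus_interior
    proof eventually_elim
      fix y :: "nat \<Rightarrow> real" assume y: "\<forall>i\<in>{1..d}. 0 < y i \<and> y i < 1"
      show "norm (s (Suc N) y) \<le> 1 / \<alpha>"
        unfolding s_eq[OF y zero_less_Suc] real_norm_def by (rule modef_bound(2)[OF d \<nu> \<alpha> \<gamma> t])
    qed
  qed simp
  moreover have "(\<integral>y. s (Suc N) y \<partial>torus_measure d) = 1 / real (Suc N) ^ d * (\<Sum>k\<in>sites d (Suc N). F (Suc N) k)" for N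
    unfolding s_def by (rule lattice_average_eq_integral[symmetric]) simp
  ultimately have "(\<lambda>N. 1 / real (Suc N) ^ d * (\<Sum>k\<in>sites d (Suc N). F (Suc N) k)) \<longlonglongrightarrow> (\<integral>y. modef d \<alpha> \<nu> \<gamma> t y \<partial>torus_measure d)"
    by simp
  then show ?thesis unfolding F_def by (rule LIMSEQ_imp_Suc)
qed

section \<open>Decay of the limiting correlation\<close>

text \<open>The graph of the concave sine lies above its chord between 0 and pi / 2.\<close>

lemma sin_pi_ge:
  assumes "0 \<le> x" "x \<le> 1/2"
  shows "2 * x \<le> sin (pi * x)"
proof -
  have "concave_on {0..pi} sin"
    by (rule f''_le0_imp_concave[where f' = cos and f'' = "\<lambda>x. - sin x"])
       (auto intro!: derivative_eq_intros sin_ge_zero)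
  from concave_onD[OF this, of "2 * x" 0 "pi/2"] show ?thesis
    using assms by (simp add: mult.commute)
qed

lemma sin_pi_sq_ge:
  assumes "0 \<le> x" "x \<le> 1"
  shows "4 * (min x (1 - x))\<^sup>2 \<le> (sin (pi * x))\<^sup>2"
proof -
  define z where "z = min x (1 - x)"
  have z: "0 \<le> z" "z \<le> 1/2" using assms by (auto simp: z_def min_def)
  have "sin (pi * (1 - x)) = sin (pi * x)" by (simp add: right_diff_distrib)
  then have s: "sin (pi * z) = sin (pi * x)" by (auto simp: z_def min_def)
  have "(2 * z)\<^sup>2 \<le> (sin (pi * z))\<^sup>2" using sin_pi_ge[OF z] z by (intro power_mono) auto
  then show ?thesis unfolding s by (simp add: z_def power_mult_distrib)
qed

text \<open>A rescaled normal density with variance \<open>1 / (8 * \<tau>)\<close>.\<close>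

lemma gaussian_integral:
  fixes \<mu> \<tau> :: real
  assumes "\<tau> > 0"
  shows "integrable lborel (\<lambda>x. exp (- 4 * \<tau> * (x - \<mu>)\<^sup>2))" "(\<integral>x. exp (- 4 * \<tau> * (x - \<mu>)\<^sup>2) \<partial>lborel) = sqrt (pi / (4 * \<tau>))"
proof -
  define \<sigma> where "\<sigma> = 1 / sqrt (8 * \<tau>)"
  have \<sigma>: "\<sigma>\<^sup>2 = 1 / (8 * \<tau>)" "\<sigma> > 0" using assms by (auto simp: \<sigma>_def power_divide)
  have r: "sqrt (pi / (4 * \<tau>)) \<noteq> 0" using assms by simp
  have *: "(\<lambda>x. exp (- 4 * \<tau> * (x - \<mu>)\<^sup>2)) = (\<lambda>x. sqrt (pi / (4 * \<tau>)) * normal_density \<mu> \<sigma> x)"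
  proof
    fix x
    have a: "2 * pi * \<sigma>\<^sup>2 = pi / (4 * \<tau>)" using assms unfolding \<sigma>(1) by (simp add: field_simps)
    have b: "- (x - \<mu>)\<^sup>2 / (2 * \<sigma>\<^sup>2) = - 4 * \<tau> * (x - \<mu>)\<^sup>2" using assms unfolding \<sigma>(1) by (simp add: field_simps)
    show "exp (- 4 * \<tau> * (x - \<mu>)\<^sup>2) = sqrt (pi / (4 * \<tau>)) * normal_density \<mu> \<sigma> x"
      unfolding normal_density_def a b using r by simp
  qed
  show "integrable lborel (\<lambda>x. exp (- 4 * \<tau> * (x - \<mu>)\<^sup>2))"
    unfolding * by (intro integrable_mult_right integrable_normal_density \<sigma>)
  show "(\<integral>x. exp (- 4 * \<tau> * (x - \<mu>)\<^sup>2) \<partial>lborel) = sqrt (pi / (4 * \<tau>))"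
    unfolding * using integral_normal_density[OF \<sigma>(2)] by simp
qed

text \<open>The sine vanishes at both ends of the interval, so the integrand is dominated by two
  Gaussians centred at 0 and at 1; their masses add up to the stated root.\<close>

lemma one_dim_integral_le:
  assumes "\<tau> > 0"
  shows "(\<integral>x. exp (- \<tau> * (sin (pi * x))\<^sup>2) \<partial>unif) \<le> sqrt (pi / \<tau>)"
proof -
  let ?g = "\<lambda>x. exp (- 4 * \<tau> * (x - 0)\<^sup>2) + exp (- 4 * \<tau> * (x - 1)\<^sup>2)"
  have gint: "integrable lborel ?g" by (intro Bochner_Integration.integrable_add gaussian_integral(1)[OF assms])
  have le: "indicator {0..1} x * exp (- \<tau> * (sin (pi * x))\<^sup>2) \<le> ?g x" for x
  proof (cases "x \<in> {0..1}")
    case True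
    have "exp (- \<tau> * (sin (pi * x))\<^sup>2) \<le> exp (- 4 * \<tau> * (min x (1 - x))\<^sup>2)"
      using sin_pi_sq_ge[of x] True mult_left_mono[of "4 * (min x (1 - x))\<^sup>2" "(sin (pi * x))\<^sup>2" \<tau>] assms by (simp add: mult.left_commute)
    also have "\<dots> \<le> ?g x"
      by (cases "x \<le> 1 - x") (simp_all add: min_def power2_commute[of 1 x])
    finally show ?thesis using True by simp
  qed (simp add: add_nonneg_nonneg)
  have "(\<integral>x. exp (- \<tau> * (sin (pi * x))\<^sup>2) \<partial>unif) = (\<integral>x. indicator {0..1} x * exp (- \<tau> * (sin (pi * x))\<^sup>2) \<partial>lborel)"
    by (rule integral_unif) measurable
  also have "\<dots> \<le> (\<integral>x. ?g x \<partial>lborel)"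
  proof (rule integral_mono[OF _ gint le])
    show "integrable lborel (\<lambda>x. indicator {0..1} x * exp (- \<tau> * (sin (pi * x))\<^sup>2))"
      by (rule Bochner_Integration.integrable_bound[OF gint]) (use le in \<open>auto simp: abs_mult intro!: AE_I2 order_trans[OF le abs_ge_self]\<close>)
  qed
  also have "\<dots> = 2 * sqrt (pi / (4 * \<tau>))"
    by (subst Bochner_Integration.integral_add[OF gaussian_integral(1)[OF assms] gaussian_integral(1)[OF assms]])
       (simp only: gaussian_integral(2)[OF assms])
  also have "\<dots> = sqrt (pi / \<tau>)" by (simp add: real_sqrt_divide real_sqrt_mult)
  finally show ?thesis .
qed

text \<open>The exponential of the sum factorises over coordinates, and each factor contributes a
  root of \<open>1 / \<tau>\<close>.\<close>

lemma exp_sinsq_integral: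
  assumes "\<tau> > 0"
  shows "integrable (torus_measure d) (\<lambda>y. exp (- \<tau> * sinsq d y))"
    "(\<integral>y. exp (- \<tau> * sinsq d y) \<partial>torus_measure d) \<le> sqrt (pi / \<tau>) ^ d"
proof -
  interpret prob_space "torus_measure d" by (rule prob_space_torus)
  show "integrable (torus_measure d) (\<lambda>y. exp (- \<tau> * sinsq d y))"
    by (rule integrable_const_bound[of _ 1]) (use assms sinsq_nonneg in auto)
  let ?f = "\<lambda>x. exp (- \<tau> * (sin (pi * x))\<^sup>2)"
  have "(\<lambda>y. exp (- \<tau> * sinsq d y)) = (\<lambda>y. \<Prod>i=1..d. ?f (y i))"
    by (simp add: sinsq_def sum_distrib_left exp_sum sum_negf[symmetric])
  then have "(\<integral>y. exp (- \<tau> * sinsq d y) \<partial>torus_measure d) = (\<integral>y. (\<Prod>i=1..d. ?f (y i)) \<partial>torus_measure d)" by simp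
  also have "\<dots> = (\<Prod>i=1..d. \<integral>x. ?f x \<partial>unif)"
    unfolding torus_measure_def
  proof (rule unifs.product_integral_prod)
    show "integrable unif ?f"
    proof (rule unif.integrable_const_bound[of _ 1])
      show "?f \<in> borel_measurable unif" 
        unfolding measurable_cong_sets[OF sets_unif refl] by (intro borel_measurable_continuous_onI continuous_intros)
    qed (use assms in simp)
  qed simp
  also have "\<dots> = (\<integral>x. ?f x \<partial>unif) ^ d" by simp
  also have "\<dots> \<le> sqrt (pi / \<tau>) ^ d"
    by (intro power_mono one_dim_integral_le assms integral_nonneg_AE) auto
  finally show "(\<integral>y. exp (- \<tau> * sinsq d y) \<partial>torus_measure d) \<le> sqrt (pi / \<tau>) ^ d" .
qed

text \<open>Half of the exponential absorbs the factor \<open>s\<close> at the price of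
  \<open>2 / \<tau>\<close>. With pinning this is the source of the additional power of
  \<open>t\<close>.\<close>

lemma mult_exp_le:
  fixes s \<tau> :: real
  assumes "\<tau> > 0"
  shows "s * exp (- \<tau> * s) \<le> 2 / \<tau> * exp (- (\<tau> / 2) * s)"
proof -
  have "\<tau> / 2 * s \<le> exp (\<tau> / 2 * s)" using exp_ge_add_one_self[of "\<tau> / 2 * s"] by linarith
  then have "(\<tau> / 2 * s) * exp (- \<tau> * s) \<le> exp (\<tau> / 2 * s) * exp (- \<tau> * s)" by (intro mult_right_mono) auto
  also have "\<dots> = exp (- (\<tau> / 2) * s)" by (simp add: exp_add[symmetric] field_simps)
  finally show ?thesis using assms by (simp add: field_simps)
qed

context
  fixes d :: nat and \<alpha> \<nu> \<gamma> :: real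
  assumes d: "d \<ge> 1" and \<nu>: "\<nu> \<ge> 0" and \<alpha>: "\<alpha> > 0" and \<gamma>: "\<gamma> > 0"
begin

abbreviation "I t \<equiv> (\<integral>y. modef d \<alpha> \<nu> \<gamma> t y \<partial>torus_measure d)"

lemma modef_integrable: "t \<ge> 0 \<Longrightarrow> integrable (torus_measure d) (modef d \<alpha> \<nu> \<gamma> t)"
proof -
  assume t: "t \<ge> 0"
  interpret prob_space "torus_measure d" by (rule prob_space_torus)
  show ?thesis
    by (rule integrable_const_bound[of _ "1 / \<alpha>"])
       (use modef_bound(2)[OF d \<nu> \<alpha> less_imp_le[OF \<gamma>] t] modef_measurable[OF d] in auto)
qed

lemma I_upper_unpinned:
  assumes t: "t > 0"
  shows "I t \<le> 1 / \<alpha> * sqrt (pi / (\<gamma> * t)) ^ d"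
proof -
  have \<tau>: "\<gamma> * t > 0" using \<gamma> t by simp
  have "I t \<le> (\<integral>y. 1 / \<alpha> * exp (- (\<gamma> * t) * sinsq d y) \<partial>torus_measure d)"
  proof (rule integral_mono)
    show "integrable (torus_measure d) (modef d \<alpha> \<nu> \<gamma> t)" using t by (intro modef_integrable) simp
    show "integrable (torus_measure d) (\<lambda>y. 1 / \<alpha> * exp (- (\<gamma> * t) * sinsq d y))"
      by (intro integrable_mult_right exp_sinsq_integral(1) \<tau>)
    show "modef d \<alpha> \<nu> \<gamma> t y \<le> 1 / \<alpha> * exp (- (\<gamma> * t) * sinsq d y)" for y
      using modef_bound(1)[OF d \<nu> \<alpha> less_imp_le[OF \<gamma>] less_imp_le[OF t], of y] by (simp add: algebra_simps)
  qed
  also have "\<dots> = 1 / \<alpha> * (\<integral>y. exp (- (\<gamma> * t) * sinsq d y) \<partial>torus_measure d)" by simp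
  also have "\<dots> \<le> 1 / \<alpha> * sqrt (pi / (\<gamma> * t)) ^ d"
    using \<alpha> by (intro mult_left_mono exp_sinsq_integral(2) \<tau>) auto
  finally show ?thesis .
qed

text \<open>With pinning the denominator is at least \<nu>, so the numerator keeps its factor
  \<open>sinsq\<close>, which \<open>mult_exp_le\<close> converts into \<open>1 / t\<close>.\<close>

lemma I_upper_pinned:
  assumes t: "t > 0" and pinned: "\<nu> > 0"
  shows "I t \<le> 8 / (\<nu> * \<gamma> * t) * sqrt (pi / (\<gamma> * t / 2)) ^ d"
proof -
  have \<tau>: "\<gamma> * t > 0" "\<gamma> * t / 2 > 0" using \<gamma> t by auto
  have "I t \<le> (\<integral>y. 8 / (\<nu> * \<gamma> * t) * exp (- (\<gamma> * t / 2) * sinsq d y) \<partial>torus_measure d)"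
  proof (rule integral_mono)
    show "integrable (torus_measure d) (modef d \<alpha> \<nu> \<gamma> t)" using t by (intro modef_integrable) simp
    show "integrable (torus_measure d) (\<lambda>y. 8 / (\<nu> * \<gamma> * t) * exp (- (\<gamma> * t / 2) * sinsq d y))"
      by (intro integrable_mult_right exp_sinsq_integral(1) \<tau>)
    fix y :: "nat \<Rightarrow> real"
    have "(sin (2 * pi * y 1))\<^sup>2 \<le> 4 * (sin (pi * y 1))\<^sup>2" using sin_double_sq_le[of "pi * y 1"] by (simp add: mult.assoc)
    also have "\<dots> \<le> 4 * sinsq d y" using sinsq_ge[of 1 d y] d by simp
    finally have "(sin (2 * pi * y 1))\<^sup>2 / Omega2 d \<alpha> \<nu> y \<le> 4 * sinsq d y / \<nu>"
      using pinned \<alpha> sinsq_nonneg[of d y] by (intro frac_le) (auto simp: Omega2_def)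
    moreover have "\<gamma> * sinsq d y * t \<le> \<gamma> * Psi d y * t"
      using \<gamma> t Psi_bounds(1)[OF d, of y] by (intro mult_right_mono mult_left_mono) auto
    ultimately have "modef d \<alpha> \<nu> \<gamma> t y \<le> 4 * sinsq d y / \<nu> * exp (- (\<gamma> * t) * sinsq d y)"
      unfolding modef_def using pinned sinsq_nonneg[of d y] by (intro mult_mono) (auto simp: algebra_simps)
    also have "\<dots> = 4 / \<nu> * (sinsq d y * exp (- (\<gamma> * t) * sinsq d y))" by simp
    also have "\<dots> \<le> 4 / \<nu> * (2 / (\<gamma> * t) * exp (- (\<gamma> * t / 2) * sinsq d y))"
      using pinned by (intro mult_left_mono mult_exp_le \<tau>) auto
    finally show "modef d \<alpha> \<nu> \<gamma> t y \<le> 8 / (\<nu> * \<gamma> * t) * exp (- (\<gamma> * t / 2) * sinsq d y)"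
      by (simp add: mult.assoc)
  qed
  also have "\<dots> = 8 / (\<nu> * \<gamma> * t) * (\<integral>y. exp (- (\<gamma> * t / 2) * sinsq d y) \<partial>torus_measure d)" by simp
  also have "\<dots> \<le> 8 / (\<nu> * \<gamma> * t) * sqrt (pi / (\<gamma> * t / 2)) ^ d"
    using \<gamma> t pinned by (intro mult_left_mono exp_sinsq_integral(2) \<tau>) auto
  finally show ?thesis .
qed

text \<open>At time \<open>t\<close> only wave numbers of size \<open>1 / sqrt t\<close> contribute, and on a box of that size
  away from the hyperplane \<open>y\<^sub>1 = 0\<close> the integrand is bounded below.\<close>

lemma I_lower:
  assumes t: "t \<ge> 1"
  shows "1 / (4 * t) / (\<nu> + \<alpha> * pi\<^sup>2 * real d / (4 * t)) * exp (- (\<gamma> * real d * pi\<^sup>2 / 2)) * (1 / (8 * sqrt t)) ^ d \<le> I t"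
proof -
  \<comment> \<open>For \<open>t \<ge> 1\<close> this is at most 1/8, so twice the first coordinate,
    up to \<open>4 * \<epsilon>\<close>, stays in the range of \<open>sin_pi_ge\<close>.\<close>
  define \<epsilon> where "\<epsilon> = 1 / (8 * sqrt t)"
  have st: "sqrt t \<ge> 1" using t by simp
  have \<epsilon>: "0 < \<epsilon>" "\<epsilon> \<le> 1/8" using st by (auto simp: \<epsilon>_def field_simps)
  have \<epsilon>2: "\<epsilon>\<^sup>2 = 1 / (64 * t)" using t by (simp add: \<epsilon>_def power_divide power_mult_distrib)
  \<comment> \<open>The numerator contains only the first coordinate, so only that one must stay
    away from 0.\<close>
  define B where "B i = (if i = 1 then {\<epsilon>..2 * \<epsilon>} else {0..\<epsilon>})" for i :: nat
  define low where "low = 1 / (4 * t) / (\<nu> + \<alpha> * pi\<^sup>2 * real d / (4 * t)) * exp (- (\<gamma> * real d * pi\<^sup>2 / 2))"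
  have den: "\<alpha> * pi\<^sup>2 * real d / (4 * t) > 0" using \<alpha> d t by simp
  have low0: "0 \<le> low" unfolding low_def using den \<nu> \<alpha> t by (intro mult_nonneg_nonneg divide_nonneg_nonneg add_nonneg_nonneg) auto
  have Bm: "B i \<in> sets borel" for i by (simp add: B_def)
  have Bsub: "B i \<subseteq> {0..1}" for i using \<epsilon> by (auto simp: B_def)
  have Bint: "integrable unif (indicator (B i) :: real \<Rightarrow> real)" for i
  proof (rule unif.integrable_const_bound[of _ 1])
    show "(indicator (B i) :: real \<Rightarrow> real) \<in> borel_measurable unif"
      unfolding measurable_cong_sets[OF sets_unif refl] by (rule borel_measurable_indicator[OF Bm])
  qed simp
  have ptwise: "low * (\<Prod>i=1..d. indicator (B i) (y i)) \<le> modef d \<alpha> \<nu> \<gamma> t y" for y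
  proof (cases "\<forall>i\<in>{1..d}. y i \<in> B i")
    case False
    then obtain i where "i \<in> {1..d}" "y i \<notin> B i" by blast
    then have z: "(\<Prod>i=1..d. indicator (B i) (y i) :: real) = 0" by (auto intro!: prod_zero bexI[of _ i])
    show ?thesis unfolding z using modef_nonneg[OF \<nu> \<alpha>] by simp
  next
    case True
    have "y 1 \<in> B 1" using True d by simp
    then have y1: "\<epsilon> \<le> y 1" "y 1 \<le> 2 * \<epsilon>" by (auto simp: B_def)
    have yi: "0 \<le> y i" "y i \<le> 2 * \<epsilon>" if "i \<in> {1..d}" for i
    proof -
      have "y i \<in> B i" using True that by simp
      then show "0 \<le> y i" "y i \<le> 2 * \<epsilon>" using \<epsilon> by (auto simp: B_def split: if_splits)
    qed
    have s: "sinsq d y \<le> real d * pi\<^sup>2 / (16 * t)"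
    proof -
      have "sinsq d y \<le> (\<Sum>i=1..d. (pi * (2 * \<epsilon>))\<^sup>2)"
        unfolding sinsq_def
      proof (rule sum_mono)
        fix i assume i: "i \<in> {1..d}"
        have "\<bar>sin (pi * y i)\<bar> \<le> \<bar>pi * y i\<bar>" by (rule abs_sin_x_le_abs_x)
        also have "\<dots> \<le> \<bar>pi * (2 * \<epsilon>)\<bar>" using yi[OF i] by (simp add: abs_mult)
        finally show "(sin (pi * y i))\<^sup>2 \<le> (pi * (2 * \<epsilon>))\<^sup>2" by (simp add: abs_le_square_iff)
      qed
      also have "\<dots> = real d * pi\<^sup>2 * (4 * \<epsilon>\<^sup>2)" by (simp add: power_mult_distrib)
      also have "\<dots> = real d * pi\<^sup>2 / (16 * t)" unfolding \<epsilon>2 by simp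
      finally show ?thesis .
    qed
    \<comment> \<open>Squaring this lower bound gives 16 \<open>\<epsilon>\<^sup>2\<close>, which is
      the \<open>1 / (4 * t)\<close> in \<open>low\<close>.\<close>
    have "4 * \<epsilon> \<le> 2 * (2 * y 1)" using y1 by simp
    also have "\<dots> \<le> sin (pi * (2 * y 1))" using y1 \<epsilon> by (intro sin_pi_ge) auto
    finally have "(4 * \<epsilon>)\<^sup>2 \<le> (sin (pi * (2 * y 1)))\<^sup>2" using \<epsilon> by (intro power_mono) auto
    then have num: "1 / (4 * t) \<le> (sin (2 * pi * y 1))\<^sup>2"
      by (simp add: power_mult_distrib \<epsilon>2 algebra_simps)
    have "0 < (sin (2 * pi * y 1))\<^sup>2" using num t by (smt (verit) divide_pos_pos)
    also have "\<dots> \<le> 4 * (sin (pi * y 1))\<^sup>2" using sin_double_sq_le[of "pi * y 1"] by (simp add: mult.assoc)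
    also have "\<dots> \<le> 4 * sinsq d y" using sinsq_ge[of 1 d y] d by simp
    finally have spos: "0 < sinsq d y" by simp
    have "4 * \<alpha> * sinsq d y \<le> 4 * \<alpha> * (real d * pi\<^sup>2 / (16 * t))" using s \<alpha> by (intro mult_left_mono) auto
    then have O: "Omega2 d \<alpha> \<nu> y \<le> \<nu> + \<alpha> * pi\<^sup>2 * real d / (4 * t)" "0 < Omega2 d \<alpha> \<nu> y"
      using spos \<alpha> \<nu> by (auto simp: Omega2_def algebra_simps intro!: add_nonneg_pos)
    have "Psi d y \<le> 8 * (real d * pi\<^sup>2 / (16 * t))" using Psi_bounds(2)[OF d, of y] s by linarith
    then have "\<gamma> * Psi d y * t \<le> \<gamma> * (8 * (real d * pi\<^sup>2 / (16 * t))) * t"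
      using \<gamma> t by (intro mult_right_mono mult_left_mono) auto
    also have "\<dots> = \<gamma> * real d * pi\<^sup>2 / 2" using t by (simp add: field_simps)
    finally have ex: "exp (- (\<gamma> * real d * pi\<^sup>2 / 2)) \<le> exp (- \<gamma> * Psi d y * t)" by simp
    have "low \<le> modef d \<alpha> \<nu> \<gamma> t y"
      unfolding low_def modef_def using num O t by (intro mult_mono ex frac_le) auto
    moreover have "(\<Prod>i=1..d. indicator (B i) (y i) :: real) = 1" using True by (intro prod.neutral) auto
    ultimately show ?thesis by (simp only: mult_1_right)
  qed
  have "measure lborel (B i) = \<epsilon>" for i using \<epsilon> by (simp add: B_def)
  then have Bi: "(\<integral>x. indicator (B i) x \<partial>unif) = \<epsilon>" for i
  proof -
    have "(\<integral>x. indicator (B i) x \<partial>unif) = (\<integral>x. indicator {0..1} x * (indicator (B i) x :: real) \<partial>lborel)"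
      by (rule integral_unif) (rule borel_measurable_indicator[OF Bm])
    also have "\<dots> = (\<integral>x. indicator (B i) x \<partial>lborel)"
      by (intro Bochner_Integration.integral_cong refl) (use Bsub[of i] in \<open>auto simp: indicator_def\<close>)
    also have "\<dots> = measure lborel (B i)" by simp
    finally show ?thesis by (simp add: \<open>\<And>i. measure lborel (B i) = \<epsilon>\<close>)
  qed
  have "low * \<epsilon> ^ d = low * (\<Prod>i=1..d. \<integral>x. indicator (B i) x \<partial>unif)" unfolding Bi by simp
  also have "\<dots> = low * (\<integral>y. (\<Prod>i=1..d. indicator (B i) (y i)) \<partial>torus_measure d)"
    unfolding torus_measure_def by (subst unifs.product_integral_prod) (auto intro: Bint)
  also have "\<dots> = (\<integral>y. low * (\<Prod>i=1..d. indicator (B i) (y i)) \<partial>torus_measure d)" by simp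
  also have "\<dots> \<le> I t"
  proof (rule integral_mono)
    show "integrable (torus_measure d) (\<lambda>y. low * (\<Prod>i=1..d. indicator (B i) (y i)))"
      unfolding torus_measure_def by (intro integrable_mult_right unifs.product_integrable_prod Bint) simp
    show "integrable (torus_measure d) (modef d \<alpha> \<nu> \<gamma> t)" using t by (intro modef_integrable) simp
  qed (rule ptwise)
  finally show ?thesis unfolding low_def \<epsilon>_def .
qed

lemma sqrt_power_eq_powr: "t > 0 \<Longrightarrow> (1 / sqrt t) ^ n = t powr (- real n / 2)"
  by (simp add: powr_half_sqrt[symmetric] powr_minus_divide[symmetric] powr_power)

text \<open>Taking \<open>max c C\<close> as the upper constant secures the required order of the
  two constants without comparing them.\<close>

lemma same_orderI:
  assumes "c > 0" "\<And>t. b t \<ge> 0" "\<And>t. t \<ge> T \<Longrightarrow> c * b t \<le> a t" "\<And>t. t \<ge> T \<Longrightarrow> a t \<le> C * b t"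
  shows "same_order a b"
  unfolding same_order_def
proof (intro exI conjI)
  show "0 < c" "c \<le> max c C" using assms(1) by auto
  show "\<forall>\<^sub>F t in at_top. c * b t \<le> a t \<and> a t \<le> max c C * b t"
    using eventually_ge_at_top[of T]
  proof eventually_elim
    fix t assume "T \<le> t"
    moreover have "C * b t \<le> max c C * b t" using assms(2) by (intro mult_right_mono) auto
    ultimately show "c * b t \<le> a t \<and> a t \<le> max c C * b t" using assms(3,4)[of t] by linarith
  qed
qed

text \<open>The box volume supplies \<open>t powr (- d / 2)\<close>. The prefactor of
  \<open>I_lower\<close> is constant in \<open>t\<close> if \<nu> = 0 and of order
  \<open>1 / t\<close> if \<nu> > 0, and the upper bounds match.\<close>

lemma I_order:
  assumes A: "A > 0"
  shows "\<nu> = 0 \<Longrightarrow> same_order (\<lambda>t. A * I t) (\<lambda>t. t powr (- real d / 2))"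
    and "\<nu> > 0 \<Longrightarrow> same_order (\<lambda>t. A * I t) (\<lambda>t. t powr (- real d / 2 - 1))"
proof -
  let ?E = "exp (- (\<gamma> * real d * pi\<^sup>2 / 2)) * (1/8) ^ d"
  have box: "(1 / (8 * sqrt t)) ^ d = (1/8) ^ d * t powr (- real d / 2)" if "t \<ge> 1" for t
  proof -
    have "(1 / (8 * sqrt t)) ^ d = (1/8) ^ d * (1 / sqrt t) ^ d" unfolding power_mult_distrib[symmetric] by simp
    then show ?thesis using sqrt_power_eq_powr[of t d] that by simp
  qed
  have gs: "sqrt (pi / (g * t)) ^ d = sqrt (pi / g) ^ d * t powr (- real d / 2)" if "t \<ge> 1" for t g
  proof -
    have "sqrt (pi / (g * t)) = sqrt (pi / g) * (1 / sqrt t)" by (simp add: real_sqrt_divide real_sqrt_mult)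
    then show ?thesis using sqrt_power_eq_powr[of t d] that by (simp only: power_mult_distrib)
  qed
  show "same_order (\<lambda>t. A * I t) (\<lambda>t. t powr (- real d / 2))" if \<nu>0: "\<nu> = 0"
  proof (rule same_orderI[where T = 1 and c = "A * (1 / (\<alpha> * pi\<^sup>2 * real d) * ?E)" and C = "A * (1 / \<alpha> * sqrt (pi / \<gamma>) ^ d)"])
    show "0 < A * (1 / (\<alpha> * pi\<^sup>2 * real d) * ?E)" using A \<alpha> d by simp
    fix t :: real assume t: "t \<ge> 1"
    have "1 / (4 * t) / (\<nu> + \<alpha> * pi\<^sup>2 * real d / (4 * t)) = 1 / (\<alpha> * pi\<^sup>2 * real d)"
      using t \<alpha> d by (simp add: \<nu>0)
    then have "1 / (\<alpha> * pi\<^sup>2 * real d) * ?E * t powr (- real d / 2) \<le> I t"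
      using I_lower[OF t] box[OF t] by (simp add: mult.assoc)
    then show "A * (1 / (\<alpha> * pi\<^sup>2 * real d) * ?E) * t powr (- real d / 2) \<le> A * I t"
      using A unfolding mult.assoc[of A] by (intro mult_left_mono) auto
    have "I t \<le> 1 / \<alpha> * sqrt (pi / \<gamma>) ^ d * t powr (- real d / 2)"
      using I_upper_unpinned[of t] gs[OF t, of \<gamma>] t by (simp add: mult.assoc)
    then show "A * I t \<le> A * (1 / \<alpha> * sqrt (pi / \<gamma>) ^ d) * t powr (- real d / 2)"
      using A unfolding mult.assoc[of A] by (intro mult_left_mono) auto
  qed simp
  show "same_order (\<lambda>t. A * I t) (\<lambda>t. t powr (- real d / 2 - 1))" if pinned: "\<nu> > 0"
  proof (rule same_orderI[where T = 1 and c = "A * (1 / (4 * \<nu> + \<alpha> * pi\<^sup>2 * real d) * ?E)" and C = "A * (8 / (\<nu> * \<gamma>) * sqrt (pi / (\<gamma> / 2)) ^ d)"])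
    have pos: "4 * \<nu> + \<alpha> * pi\<^sup>2 * real d > 0" using pinned \<alpha> d by (intro add_pos_pos) auto
    then show "0 < A * (1 / (4 * \<nu> + \<alpha> * pi\<^sup>2 * real d) * ?E)" using A by simp
    fix t :: real assume t: "t \<ge> 1"
    have pw: "t powr (- real d / 2 - 1) = t powr (- real d / 2) / t" using t by (simp add: powr_diff)
    have "1 / (4 * \<nu> + \<alpha> * pi\<^sup>2 * real d) / t \<le> 1 / (4 * t) / (\<nu> + \<alpha> * pi\<^sup>2 * real d / (4 * t))"
    proof -
      have "1 / (4 * t) / (\<nu> + \<alpha> * pi\<^sup>2 * real d / (4 * t)) = 1 / (4 * \<nu> * t + \<alpha> * pi\<^sup>2 * real d)"
        using t by (simp add: field_simps)
      moreover have "4 * \<nu> * t + \<alpha> * pi\<^sup>2 * real d \<le> (4 * \<nu> + \<alpha> * pi\<^sup>2 * real d) * t"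
        using mult_left_mono[OF t, of "\<alpha> * pi\<^sup>2 * real d"] \<alpha> by (simp add: distrib_right)
      moreover have "0 < 4 * \<nu> * t + \<alpha> * pi\<^sup>2 * real d" using pinned \<alpha> d t by (intro add_pos_pos) auto
      ultimately show ?thesis by (simp add: divide_left_mono frac_le)
    qed
    then have "1 / (4 * \<nu> + \<alpha> * pi\<^sup>2 * real d) / t * (?E * t powr (- real d / 2))
      \<le> 1 / (4 * t) / (\<nu> + \<alpha> * pi\<^sup>2 * real d / (4 * t)) * (?E * t powr (- real d / 2))"
      by (intro mult_right_mono) auto
    also have "\<dots> \<le> I t" using I_lower[OF t] box[OF t] by (simp add: mult.assoc)
    finally have "1 / (4 * \<nu> + \<alpha> * pi\<^sup>2 * real d) * ?E * t powr (- real d / 2 - 1) \<le> I t"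
      unfolding pw by (simp add: mult_ac)
    then show "A * (1 / (4 * \<nu> + \<alpha> * pi\<^sup>2 * real d) * ?E) * t powr (- real d / 2 - 1) \<le> A * I t"
      using A unfolding mult.assoc[of A] by (intro mult_left_mono) auto
    have "I t \<le> 8 / (\<nu> * \<gamma>) * sqrt (pi / (\<gamma> / 2)) ^ d * t powr (- real d / 2 - 1)"
      using I_upper_pinned[of t] gs[OF t, of "\<gamma> / 2"] t pinned unfolding pw by (simp add: mult_ac)
    then show "A * I t \<le> A * (8 / (\<nu> * \<gamma>) * sqrt (pi / (\<gamma> / 2)) ^ d) * t powr (- real d / 2 - 1)"
      using A unfolding mult.assoc[of A] by (intro mult_left_mono) auto
  qed simp
qed

end

text \<open>Dividing by the square of the number of sites makes the constraint \<kappa> and the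
  summand 2 vanish in the limit, leaving 4 A d / (2 d)^2.\<close>

lemma prefactor_tendsto:
  fixes A \<kappa> :: real
  assumes d: "d \<ge> 1"
  shows "(\<lambda>N. 4 * A * real d * (real N ^ d)\<^sup>2 / (2 * real d * (real N ^ d - \<kappa>) * (2 * real d * (real N ^ d - \<kappa>) + 2))) \<longlonglongrightarrow> A / real d"
proof -
  define m where "m N = real N ^ d" for N
  have "filterlim m at_top sequentially"
    unfolding m_def using d by (intro filterlim_pow_at_top filterlim_real_sequentially) simp
  then have inv: "(\<lambda>N. inverse (m N)) \<longlonglongrightarrow> 0" by (rule tendsto_inverse_0_at_top)
  have "(\<lambda>N. 4 * A * real d / (2 * real d * (1 - \<kappa> * inverse (m N)) * (2 * real d * (1 - \<kappa> * inverse (m N)) + 2 * inverse (m N))))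
    \<longlonglongrightarrow> 4 * A * real d / (2 * real d * (1 - \<kappa> * 0) * (2 * real d * (1 - \<kappa> * 0) + 2 * 0))"
    using d by (intro tendsto_intros inv) auto
  then have "(\<lambda>N. 4 * A * real d / (2 * real d * (1 - \<kappa> * inverse (m N)) * (2 * real d * (1 - \<kappa> * inverse (m N)) + 2 * inverse (m N)))) \<longlonglongrightarrow> A / real d"
    using d by (simp add: power2_eq_square)
  then show ?thesis
  proof (rule Lim_transform_eventually)
    show "\<forall>\<^sub>F N in sequentially. 4 * A * real d / (2 * real d * (1 - \<kappa> * inverse (m N)) * (2 * real d * (1 - \<kappa> * inverse (m N)) + 2 * inverse (m N)))
      = 4 * A * real d * (real N ^ d)\<^sup>2 / (2 * real d * (real N ^ d - \<kappa>) * (2 * real d * (real N ^ d - \<kappa>) + 2))"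
      using eventually_gt_at_top[of 0]
    proof eventually_elim
      fix N :: nat assume "0 < N"
      then have m: "m N > 0" by (simp add: m_def)
      have "a / (b * (1 - \<kappa> * inverse x) * (b * (1 - \<kappa> * inverse x) + 2 * inverse x)) = a * x\<^sup>2 / (b * (x - \<kappa>) * (b * (x - \<kappa>) + 2))"
        if "x > 0" for a b x :: real
      proof -
        have "b * (1 - \<kappa> * inverse x) = b * (x - \<kappa>) / x" "b * (1 - \<kappa> * inverse x) + 2 * inverse x = (b * (x - \<kappa>) + 2) / x"
          using that by (simp_all add: field_simps)
        then show ?thesis by (simp only:) (simp add: power2_eq_square)
      qed
      from this[OF m] show "4 * A * real d / (2 * real d * (1 - \<kappa> * inverse (m N)) * (2 * real d * (1 - \<kappa> * inverse (m N)) + 2 * inverse (m N)))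
        = 4 * A * real d * (real N ^ d)\<^sup>2 / (2 * real d * (real N ^ d - \<kappa>) * (2 * real d * (real N ^ d - \<kappa>) + 2))"
        by (simp add: m_def)
    qed
  qed
qed

theorem theorem4:
  fixes d :: nat and \<gamma> \<alpha> \<nu> \<E> :: real
    and M :: "nat \<Rightarrow> 'w measure" and Z :: "nat \<Rightarrow> real \<Rightarrow> 'w \<Rightarrow> config"
  assumes "d \<ge> 1" and "\<gamma> > 0" and "\<alpha> > 0" and "\<nu> \<ge> 0" and "\<E> > 0"
    and "\<And>N. N \<ge> 3 \<Longrightarrow> microcanonical_diffusion d N \<alpha> \<nu> \<gamma> \<E> (M N) (Z N)"
  shows "\<exists>C :: real \<Rightarrow> real.
    (\<forall>t\<ge>0. (\<lambda>N. 1 / real N ^ d *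
        (\<integral>w. total_current d N \<alpha> (Z N t w) * total_current d N \<alpha> (Z N 0 w) \<partial>M N))
      \<longlonglongrightarrow> C t) \<and>
    (\<nu> = 0 \<longrightarrow> same_order C (\<lambda>t. t powr (- real d / 2))) \<and>
    (\<nu> > 0 \<longrightarrow> same_order C (\<lambda>t. t powr (- real d / 2 - 1)))"
proof -
  \<comment> \<open>The limit of the finite-volume prefactor; it does not depend on
    \<open>t\<close>.\<close>
  define A where "A = \<alpha>\<^sup>2 * \<E>\<^sup>2 / real d"
  define \<kappa> where "\<kappa> = (if \<nu> = 0 then 1 else 0 :: real)"
  have A: "A > 0" using assms by (simp add: A_def)
  have lim: "(\<lambda>N. 1 / real N ^ d * (\<integral>w. total_current d N \<alpha> (Z N t w) * total_current d N \<alpha> (Z N 0 w) \<partial>M N))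
      \<longlonglongrightarrow> A * (\<integral>y. modef d \<alpha> \<nu> \<gamma> t y \<partial>torus_measure d)" if t: "t \<ge> 0" for t
  proof -
    let ?p = "\<lambda>N. 4 * (\<alpha>\<^sup>2 * \<E>\<^sup>2) * real d * (real N ^ d)\<^sup>2 / (2 * real d * (real N ^ d - \<kappa>) * (2 * real d * (real N ^ d - \<kappa>) + 2))"
    let ?a = "\<lambda>N. 1 / real N ^ d * (\<Sum>k\<in>sites d N. modef d \<alpha> \<nu> \<gamma> t (\<lambda>i. of_int (k i) / real N))"
    have "(\<lambda>N. ?p N * ?a N) \<longlonglongrightarrow> A * (\<integral>y. modef d \<alpha> \<nu> \<gamma> t y \<partial>torus_measure d)"
      unfolding A_def using assms t by (intro tendsto_mult prefactor_tendsto riemann_sum_tendsto) auto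
    then show ?thesis
    proof (rule Lim_transform_eventually)
      show "\<forall>\<^sub>F N in sequentially. ?p N * ?a N
        = 1 / real N ^ d * (\<integral>w. total_current d N \<alpha> (Z N t w) * total_current d N \<alpha> (Z N 0 w) \<partial>M N)"
        \<comment> \<open>The exact formula holds from \<open>N = 3\<close> on, where the bonds are
          distinct; smaller \<open>N\<close> are irrelevant to the limit.\<close>
        using eventually_ge_at_top[of 3]
      proof eventually_elim
        fix N :: nat assume N: "3 \<le> N"
        interpret chain d N \<alpha> \<nu> using assms N by unfold_locales auto
        have nn: "nn = 2 * real d * (real N ^ d - \<kappa>)" by (simp add: nn_def kap_def \<kappa>_def)
        have mode: "(sin (freq N k 1))\<^sup>2 / om2 k * exp (- \<gamma> * psi k * t) = modef d \<alpha> \<nu> \<gamma> t (\<lambda>i. of_int (k i) / real N)" for k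
        proof -
          have f: "freq N k i = 2 * pi * (of_int (k i) / real N)" "freq N k i / 2 = pi * (of_int (k i) / real N)" for i
            by (simp_all add: freq_def)
          show ?thesis unfolding modef_def Omega2_def Psi_def sinsq_def om2_def psi_def f(2) unfolding f(1) ..
        qed
        show "?p N * ?a N = 1 / real N ^ d * (\<integral>w. total_current d N \<alpha> (Z N t w) * total_current d N \<alpha> (Z N 0 w) \<partial>M N)"
          unfolding correlation_formula[OF assms(1) N less_imp_le[OF assms(2)] assms(3,4) assms(6)[OF N] t] nn mode
          by (simp only: mult.assoc)
      qed
    qed
  qed
  show ?thesis
  proof (intro exI[of _ "\<lambda>t. A * (\<integral>y. modef d \<alpha> \<nu> \<gamma> t y \<partial>torus_measure d)"] conjI allI impI)
    fix t :: real assume "0 \<le> t"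
    then show "(\<lambda>N. 1 / real N ^ d * (\<integral>w. total_current d N \<alpha> (Z N t w) * total_current d N \<alpha> (Z N 0 w) \<partial>M N))
      \<longlonglongrightarrow> A * (\<integral>y. modef d \<alpha> \<nu> \<gamma> t y \<partial>torus_measure d)" by (rule lim)
  qed (fact I_order[OF assms(1,4,3,2) A])+
qed

end
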